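(* Let $k\ge 1$ be an integer and let $Q_\pm(k,x)$ be defined by the $k$-fold residue described in the context. Then $Q_\pm(k,x)$ is a polynomial in $x$ of degree at most $k(k+1)/2$; write $$Q_\pm(k,x)=\sum_{r=0}^{k(k+1)/2} c_\pm(r,k)\,x^{k(k+1)/2-r}.$$ The leading coefficients $c_+(0,k)$ and $c_-(0,k)$ are both equal to $$c(0,k):=\frac{a_k}{2^k}\prod_{j=0}^{k-1}\frac{(2j)!}{(k+j)!},$$ and for every $r\ge 1$, $$c_\pm(r,k)=c(0,k)\sum_{|\lambda|=r} b^\pm_\lambda(k)\,N_\lambda(k),$$ the sum running over all partitions $\lambda$ of $r$. Moreover, for each partition $\lambda$ there is a polynomial in $k$ of degree at most $2|\lambda|$ (not depending on the choice of sign $\pm$) whose value at every integer $k\ge1$ equals $N_\lambda(k)$.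
   Context: Notation: $\Delta(w_1,\dots,w_k)=\det(w_i^{j-1})_{k\times k}=\prod_{1\le i<j\le k}(w_j-w_i)$. For $a\in\{0,1\}$ let $X(s,a)=\pi^{s-1/2}\Gamma(\frac{1-s+a}{2})/\Gamma(\frac{s+a}{2})$. Let $$A_k(z_1,\dots,z_k)=\prod_p\prod_{1\le i\le j\le k}\Bigl(1-\tfrac{1}{p^{1+z_i+z_j}}\Bigr)\Bigl(\tfrac12\Bigl(\prod_{j=1}^k(1-p^{-1/2-z_j})^{-1}+\prod_{j=1}^k(1+p^{-1/2-z_j})^{-1}\Bigr)+\tfrac1p\Bigr)\Bigl(1+\tfrac1p\Bigr)^{-1},$$ an Euler product absolutely convergent near $z=0$, and $a_k=A_k(0,\dots,0)$. Let $G_\pm(z_1,\dots,z_k)=A_k(z)\prod_{j=1}^k X(\tfrac12+z_j,a)^{-1/2}\prod_{1\le i\le j\le k}\zeta(1+z_i+z_j)$ with $a=0$ for $G_+$ and $a=1$ for $G_-$ (principal branch; $X(1/2,a)=1$). Define $$Q_\pm(k,x)=\frac{(-1)^{k(k-1)/2}2^k}{k!}\frac{1}{(2\pi i)^k}\oint\cdots\oint\frac{G_\pm(z_1,\dots,z_k)\Delta(z_1^2,\dots,z_k^2)^2}{\prod_{j=1}^k z_j^{2k-1}}e^{\frac x2\sum_j z_j}\,dz_1\cdots dz_k,$$ with each contour a small circle around $0$. For a partition $\lambda$ (weakly decreasing sequence of positive integers, $|\lambda|$ its sum, $l(\lambda)$ its length), $m_\lambda(z_1,\dots,z_k)$ is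 the monomial symmetric polynomial (sum of all distinct monomials $z^\alpha$ with $\alpha$ a permutation of $\lambda$ padded with zeros; it is $0$ if $l(\lambda)>k$, and $m_\emptyset=1$). The coefficients $b^\pm_\lambda(k)$ (for $l(\lambda)\le k$) are defined by the Taylor expansion about $z=0$ $$\frac1{a_k}A_k(z)\prod_{j=1}^kX(\tfrac12+z_j,a)^{-1/2}\prod_{1\le i\le j\le k}(z_i+z_j)\zeta(1+z_i+z_j)=\sum_{\lambda}b^\pm_\lambda(k)\,m_\lambda(z_1,\dots,z_k),$$ with $a=0$ for $b^+$ and $a=1$ for $b^-$; set $b^\pm_\lambda(k)=0$ if $l(\lambda)>k$. For a partition $\lambda$ and integer $k\ge1$ put $n=k(k+1)/2-|\lambda|$; set $N_\lambda(k)=0$ if $n<0$, and otherwise $$N_\lambda(k)=\frac{(-1)^{k(k-1)/2}\,2^k}{k!}\prod_{j=0}^{k-1}\frac{(k+j)!}{(2j)!}\;[z_1^{2k-1}\cdots z_k^{2k-1}]\Bigl(m_\lambda(z)\,\Delta(z_1,\dots,z_k)\,\Delta(z_1^2,\dots,z_k^2)\frac{(z_1+\dots+z_k)^n}{2^n\,n!}\Bigr),$$ where $[z^\beta]F$ denotes the coefficient of $z^\beta$ in $F$. *)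

theory Defs
  imports
    "HOL-Complex_Analysis.Complex_Analysis"
    "HOL-Library.Poly_Mapping"
    "HOL-Library.Multiset"
    "HOL-Computational_Algebra.Polynomial"
    "HOL-Computational_Algebra.Primes"
begin

text \<open>
  The number \<open>k\<close> of variables varies inside the statement, so a point of \<open>\<complex>\<^sup>k\<close> is a function
  \<open>z :: nat \<Rightarrow> complex\<close> of which only the values \<open>z 0, \<dots>, z (k - 1)\<close> are used: indices are shifted
  down by one with respect to the usual \<open>z\<^sub>1, \<dots>, z\<^sub>k\<close>. The sign \<open>\<plusminus>\<close> is encoded by \<open>a :: nat\<close>, with
  \<open>a = 0\<close> for \<open>+\<close> and \<open>a = 1\<close> for \<open>-\<close>.
\<close>

definition upairs :: "nat \<Rightarrow> (nat \<times> nat) set" where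
  "upairs k = {(i, j). i \<le> j \<and> j < k}"

definition Delta :: "nat \<Rightarrow> (nat \<Rightarrow> 'a::comm_ring_1) \<Rightarrow> 'a" where
  "Delta k w = (\<Prod>(i, j)\<in>{(i, j). i < j \<and> j < k}. w j - w i)"

text \<open>
  The Riemann zeta function, as the analytic continuation of the Dirichlet series to
  \<open>Re s > 0\<close>, \<open>s \<noteq> 1\<close>. This region is connected, so its values there are determined; only
  values near \<open>s = 1\<close> are used below, and the value at the pole \<open>s = 1\<close> carries no meaning.
\<close>

definition zeta :: "complex \<Rightarrow> complex" where
  "zeta = (SOME f. f holomorphic_on ({s. Re s > 0} - {1}) \<and>
                   (\<forall>s. Re s > 1 \<longrightarrow> (\<lambda>n. 1 / of_nat (Suc n) powr s) sums f s))"

definition X :: "complex \<Rightarrow> nat \<Rightarrow> complex" where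
  "X s a = of_real pi powr (s - 1/2) * Gamma ((1 - s + of_nat a) / 2) / Gamma ((s + of_nat a) / 2)"

definition A_factor :: "nat \<Rightarrow> (nat \<Rightarrow> complex) \<Rightarrow> nat \<Rightarrow> complex" where
  "A_factor k z p =
     (\<Prod>(i, j)\<in>upairs k. 1 - 1 / of_nat p powr (1 + z i + z j)) *
     (1/2 * ((\<Prod>j<k. inverse (1 - of_nat p powr (- 1/2 - z j))) +
             (\<Prod>j<k. inverse (1 + of_nat p powr (- 1/2 - z j)))) + 1 / of_nat p) *
     inverse (1 + 1 / of_nat p)"

definition A :: "nat \<Rightarrow> (nat \<Rightarrow> complex) \<Rightarrow> complex" where
  "A k z = prodinf (\<lambda>p. if prime p then A_factor k z p else 1)"

definition a_const :: "nat \<Rightarrow> complex" where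
  "a_const k = A k (\<lambda>_. 0)"

definition G :: "nat \<Rightarrow> nat \<Rightarrow> (nat \<Rightarrow> complex) \<Rightarrow> complex" where
  "G k a z = A k z * (\<Prod>j<k. X (1/2 + z j) a powr (- 1/2)) *
             (\<Prod>(i, j)\<in>upairs k. zeta (1 + z i + z j))"

text \<open>
  The iterated integral over the circles \<open>\<bar>z\<^sub>j\<bar> = \<rho> j\<close>, with \<open>z 0\<close> innermost.
\<close>

fun torus_integral ::
    "nat \<Rightarrow> (nat \<Rightarrow> real) \<Rightarrow> ((nat \<Rightarrow> complex) \<Rightarrow> complex) \<Rightarrow> complex" where
  "torus_integral 0 \<rho> F = F (\<lambda>_. 0)"
| "torus_integral (Suc k) \<rho> F =
     contour_integral (circlepath 0 (\<rho> k)) (\<lambda>w. torus_integral k \<rho> (\<lambda>z. F (z(k := w))))"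

text \<open>
  The integrand also involves \<open>zeta\<close> at its pole, at points with \<open>z i + z j = 0\<close>, \<open>i < j\<close>.
  There the factor \<open>Delta\<^sup>2\<close> vanishes, so the formal value is \<open>0\<close>; this is also the value of the
  holomorphic extension, since the double zero of \<open>Delta\<^sup>2\<close> exceeds the simple pole.
\<close>

definition Q :: "nat \<Rightarrow> nat \<Rightarrow> (nat \<Rightarrow> real) \<Rightarrow> complex \<Rightarrow> complex" where
  "Q k a \<rho> x =
     (- 1) ^ (k * (k - 1) div 2) * 2 ^ k / fact k * (1 / (2 * of_real pi * \<i>) ^ k) *
     torus_integral k \<rho>
       (\<lambda>z. G k a z * (Delta k (\<lambda>j. z j ^ 2)) ^ 2 / (\<Prod>j<k. z j ^ (2 * k - 1)) *
            exp (x / 2 * (\<Sum>j<k. z j)))"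

definition is_partition :: "nat list \<Rightarrow> bool" where
  "is_partition l \<longleftrightarrow> sorted_wrt (\<ge>) l \<and> (\<forall>i\<in>set l. i > 0)"

text \<open>
  The index set consists of the exponent vectors of length \<open>k\<close> that are rearrangements of \<open>l\<close>
  padded with zeros; it is empty if \<open>length l > k\<close>. The definition is generic in the ring, so that
  \<open>m\<^sub>\<lambda>\<close> can be evaluated both at complex numbers and at polynomial indeterminates.
\<close>

definition msym :: "nat list \<Rightarrow> nat \<Rightarrow> (nat \<Rightarrow> 'a::comm_semiring_1) \<Rightarrow> 'a" where
  "msym l k z = (\<Sum>\<alpha> | length \<alpha> = k \<and> mset \<alpha> = mset (l @ replicate (k - length l) 0).
                   \<Prod>i<k. z i ^ (\<alpha> ! i))"

text \<open>
  The function \<open>w \<zeta>(1 + w)\<close> with its removable singularity at \<open>w = 0\<close> filled in by the residue of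
  zeta at 1.
\<close>

definition zeta_reg :: "complex \<Rightarrow> complex" where
  "zeta_reg w = (if w = 0 then 1 else w * zeta (1 + w))"

definition H :: "nat \<Rightarrow> nat \<Rightarrow> (nat \<Rightarrow> complex) \<Rightarrow> complex" where
  "H k a z = 1 / a_const k * A k z * (\<Prod>j<k. X (1/2 + z j) a powr (- 1/2)) *
             (\<Prod>(i, j)\<in>upairs k. zeta_reg (z i + z j))"

text \<open>
  The expansion is required to hold on a polydisc about the origin. Summation over partitions is
  unconditional; evaluated at positive real points it gives absolute convergence of the
  underlying power series in \<open>z 0, \<dots>, z (k - 1)\<close>, so the coefficients are unique.
\<close>

definition is_taylor_coeffs :: "nat \<Rightarrow> nat \<Rightarrow> (nat list \<Rightarrow> complex) \<Rightarrow> bool" where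
  "is_taylor_coeffs k a c \<longleftrightarrow>
     (\<forall>l. \<not> (is_partition l \<and> length l \<le> k) \<longrightarrow> c l = 0) \<and>
     (\<exists>\<delta>>0. \<forall>z. (\<forall>i<k. norm (z i) < \<delta>) \<longrightarrow>
        ((\<lambda>l. c l * msym l k z) has_sum H k a z) {l. is_partition l \<and> length l \<le> k})"

definition b :: "nat \<Rightarrow> nat list \<Rightarrow> nat \<Rightarrow> complex" where
  "b a l k = (SOME c. is_taylor_coeffs k a c) l"

type_synonym mpoly = "(nat \<Rightarrow>\<^sub>0 nat) \<Rightarrow>\<^sub>0 complex"

definition Var :: "nat \<Rightarrow> mpoly" where
  "Var i = Poly_Mapping.single (Poly_Mapping.single i 1) 1"

definition Const :: "complex \<Rightarrow> mpoly" where
  "Const c = Poly_Mapping.single 0 c"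

definition N :: "nat list \<Rightarrow> nat \<Rightarrow> complex" where
  "N l k =
     (if sum_list l > k * (k + 1) div 2 then 0
      else let n = k * (k + 1) div 2 - sum_list l in
        (- 1) ^ (k * (k - 1) div 2) * 2 ^ k / fact k *
        (\<Prod>j<k. fact (k + j) / fact (2 * j)) *
        Poly_Mapping.lookup
          (msym l k Var * Delta k Var * Delta k (\<lambda>i. Var i ^ 2) *
           (Const (1 / (2 ^ n * fact n)) * (\<Sum>i<k. Var i) ^ n))
          (\<Sum>i<k. Poly_Mapping.single i (2 * k - 1)))"

definition c0 :: "nat \<Rightarrow> complex" where
  "c0 k = a_const k / 2 ^ k * (\<Prod>j<k. fact (2 * j) / fact (k + j))"

end

theory Submission
  imports Defs "Jordan_Normal_Form.Determinant"
begin

text \<open>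
  On the torus the factor \<open>Delta (z\<^sup>2)\<^sup>2\<close> cancels the poles of \<open>G\<close>, so \<open>Q\<close> is the coefficient of
  \<open>\<Prod> z\<^sub>j\<^bsup>2k-1\<^esup>\<close> in \<open>H(z) Delta(z) Delta(z\<^sup>2) exp(x/2 \<Sum> z\<^sub>j)\<close>, up to constants. Integrating the symmetric
  Taylor series of \<open>H\<close> term by term, homogeneity leaves a single power of \<open>x\<close> for each partition, and
  its coefficient is the combinatorial number \<open>N\<close>.

  For the dependence on \<open>k\<close> consider the functional \<open>L f = [\<Prod> z\<^sub>j\<^bsup>2k-1\<^esup>] f Delta(z) Delta(z\<^sup>2) exp(1/2 \<Sum> z\<^sub>j)\<close>
  and the power sums \<open>p\<^sub>r\<close>. It kills all multiples of \<open>p\<^sub>r\<close> for even \<open>r > 0\<close>, because \<open>p\<^sub>r Delta(z\<^sup>2)\<close> lies in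
  the ideal generated by the \<open>z\<^sub>j\<^bsup>2k\<^esup>\<close>; for odd \<open>r\<close>, integration by parts reduces \<open>L(p\<^sub>r f)\<close> to values of \<open>L\<close> at
  products of power sums of smaller total degree. In this recursion \<open>k\<close> enters only through
  \<open>L(p\<^sub>1 f) = (k (k + 1) - 2 deg f) L f\<close>, so on products of power sums of total degree \<open>d\<close> the
  functional \<open>L / L 1\<close> is a polynomial in \<open>k\<close> of degree at most \<open>2 d\<close>. Finally \<open>L 1\<close> is a Vandermonde
  determinant in falling factorials.
\<close>

section \<open>Polynomials in several variables\<close>

text \<open>The bound \<open>2 d\<close> reflects a balance. Splitting off a \<open>p_1\<close>
  lowers the total degree by one and costs a factor quadratic in \<open>k\<close>; splitting off
  \<open>p_(2s+1)\<close> with \<open>s \<ge> 1\<close> also lowers it by one and costs only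
  constants, because \<open>p_0 = k\<close> and \<open>2 k - 1 - 2 s\<close> then always multiply a
  value of \<open>L\<close> at a multiple of \<open>p_(2s)\<close>, which is zero. The passage from
  power sums to monomial symmetric functions has coefficients free of \<open>k\<close> and preserves
  the bound. On the analytic side \<open>zeta\<close> and \<open>b\<close> are chosen by
  description, so nothing can be said about them before a continuation of the Dirichlet series and a
  Taylor expansion of \<open>H\<close> have been produced. The expansion is built one variable at a
  time from a uniform bound and holomorphy in each variable separately, properties that pass to the
  Euler product. Its unconditional convergence at positive points also dominates the integrand:
  monomial symmetric functions have nonnegative coefficients, so on the torus they are largest at
  the point with coordinates \<open>\<rho> j\<close>.\<close>

abbreviation lpairs :: "nat \<Rightarrow> (nat \<times> nat) set" where "lpairs k \<equiv> {(i, j). i < j \<and> j < k}"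

lemma finite_lpairs [simp]: "finite (lpairs k)"
  by (rule finite_subset[of _ "{..<k} \<times> {..<k}"]) auto

lemma card_lpairs: "card (lpairs k) = k * (k - 1) div 2"
proof (induction k)
  case (Suc k)
  have "lpairs (Suc k) = lpairs k \<union> (\<lambda>i. (i, k)) ` {..<k}" by (auto simp: image_iff less_Suc_eq)
  then have "card (lpairs (Suc k)) = card (lpairs k) + k"
    by (simp only:) (subst card_Un_disjoint, auto simp: card_image inj_on_def)
  then show ?case using Suc by (cases k) auto
qed simp

abbreviation lookup where "lookup \<equiv> Poly_Mapping.lookup"
abbreviation keys where "keys \<equiv> Poly_Mapping.keys"
abbreviation single where "single \<equiv> Poly_Mapping.single"

lemma poly_mapping_sum_single: "P = (\<Sum>m\<in>keys P. single m (lookup P m))"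
proof (rule poly_mapping_eqI)
  fix m
  have "lookup (\<Sum>m\<in>keys P. single m (lookup P m)) m = (\<Sum>l\<in>keys P. if l = m then lookup P l else 0)"
    unfolding lookup_sum by (intro sum.cong) (auto simp: lookup_single when_def)
  also have "\<dots> = lookup P m" by (auto simp: in_keys_iff)
  finally show "lookup P m = lookup (\<Sum>m\<in>keys P. single m (lookup P m)) m" by simp
qed

lemma poly_mapping_single_induct [case_names zero single add]:
  fixes P :: "'a \<Rightarrow>\<^sub>0 'b::comm_monoid_add"
  assumes "R 0" "\<And>m c. R (single m c)" "\<And>f g. R f \<Longrightarrow> R g \<Longrightarrow> R (f + g)"
  shows "R P"
proof -
  have "R (\<Sum>m\<in>S. single m (lookup P m))" if "finite S" for S
    using that by (induction S rule: finite_induct) (auto intro: assms)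
  from this[of "keys P"] show ?thesis using poly_mapping_sum_single[of P] by simp
qed

definition total_degree :: "(nat \<Rightarrow>\<^sub>0 nat) \<Rightarrow> nat" where
  "total_degree m = (\<Sum>i\<in>keys m. lookup m i)"

lemma total_degree_add: "total_degree (m + n) = total_degree m + total_degree n"
  unfolding total_degree_def by (rule setsum_keys_plus_distrib) auto

lemma total_degree_0 [simp]: "total_degree 0 = 0" by (simp add: total_degree_def)

lemma total_degree_single [simp]: "total_degree (single i e) = e"
  by (simp add: total_degree_def)

lemma total_degree_sum: "total_degree (sum f S) = (\<Sum>i\<in>S. total_degree (f i))"
  by (induction S rule: infinite_finite_induct) (auto simp: total_degree_add)

definition homogeneous :: "nat \<Rightarrow> mpoly \<Rightarrow> bool" where
  "homogeneous d P \<longleftrightarrow> (\<forall>m. lookup P m \<noteq> 0 \<longrightarrow> total_degree m = d)"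

lemma homogeneous_0 [simp]: "homogeneous d 0" by (simp add: homogeneous_def)

lemma homogeneous_add: "homogeneous d P \<Longrightarrow> homogeneous d R \<Longrightarrow> homogeneous d (P + R)"
  unfolding homogeneous_def lookup_add by (metis add.right_neutral)

lemma homogeneous_diff: "homogeneous d P \<Longrightarrow> homogeneous d R \<Longrightarrow> homogeneous d (P - R)"
  unfolding homogeneous_def lookup_minus by (metis diff_zero diff_self)

lemma homogeneous_sum: "(\<And>i. i \<in> S \<Longrightarrow> homogeneous d (f i)) \<Longrightarrow> homogeneous d (sum f S)"
  by (induction S rule: infinite_finite_induct) (auto intro: homogeneous_add)

lemma homogeneous_mult:
  assumes "homogeneous d P" "homogeneous e R" shows "homogeneous (d + e) (P * R)"
  unfolding homogeneous_def
proof (intro allI impI)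
  fix m assume "lookup (P * R) m \<noteq> 0"
  then have "m \<in> keys (P * R)" by (simp add: in_keys_iff)
  then obtain a b where "m = a + b" "a \<in> keys P" "b \<in> keys R" using keys_mult by blast
  with assms show "total_degree m = d + e"
    by (auto simp: homogeneous_def total_degree_add in_keys_iff)
qed

lemma homogeneous_1 [simp]: "homogeneous 0 1"
  by (auto simp: homogeneous_def lookup_one when_def)

lemma homogeneous_Const [simp]: "homogeneous 0 (Const c)"
  by (auto simp: homogeneous_def Const_def lookup_single when_def)

lemma homogeneous_Var [simp]: "homogeneous 1 (Var i)"
  by (auto simp: homogeneous_def Var_def lookup_single when_def)

lemma homogeneous_prod:
  "(\<And>i. i \<in> S \<Longrightarrow> homogeneous (d i) (f i)) \<Longrightarrow> homogeneous (sum d S) (prod f S)"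
  by (induction S rule: infinite_finite_induct) (auto intro: homogeneous_mult)

lemma homogeneous_power: "homogeneous d P \<Longrightarrow> homogeneous (n * d) (P ^ n)"
  by (induction n) (auto intro: homogeneous_mult)

text \<open>A factor of too high degree cannot contribute. This disposes of the term by which a
  truncated exponential fails to satisfy its differential equation.\<close>

lemma lookup_mult_eq_0_of_homogeneous:
  assumes "homogeneous d P" "total_degree m < d" shows "lookup (P * R) m = 0"
proof (rule ccontr)
  assume "lookup (P * R) m \<noteq> 0"
  then have "m \<in> keys (P * R)" by (simp add: in_keys_iff)
  then obtain a b where "m = a + b" "a \<in> keys P" "b \<in> keys R" using keys_mult by blast
  with assms show False
    by (auto simp: homogeneous_def total_degree_add in_keys_iff)
qed

lemma Var_power: "Var i ^ e = single (single i e) 1"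
  by (induction e) (auto simp: Var_def mult_single simp flip: single_add)

lemma lookup_Var_power_mult:
  assumes "lookup m i < e" shows "lookup (Var i ^ e * P) m = 0"
proof (rule ccontr)
  assume "lookup (Var i ^ e * P) m \<noteq> 0"
  then have "m \<in> keys (Var i ^ e * P)" by (simp add: in_keys_iff)
  then obtain a b where "m = a + b" "a \<in> keys (Var i ^ e)" using keys_mult by blast
  then have "lookup m i = e + lookup b i" by (simp add: Var_power lookup_add)
  with assms show False by simp
qed

lemma lookup_single_mult:
  fixes P :: mpoly
  shows "lookup (single m c * P) (m + n) = c * lookup P n"
proof (induction P rule: poly_mapping_single_induct)
  case (single l d)
  then show ?case by (auto simp: mult_single lookup_single when_def)
qed (auto simp: distrib_left lookup_add)

lemma Const_mult_lookup: "lookup (Const c * P) m = c * lookup P m"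
  using lookup_single_mult[of 0 c P m] by (simp add: Const_def)

lemma prod_Var_power: "(\<Prod>i\<in>S. Var i ^ e i) = single (\<Sum>i\<in>S. single i (e i)) 1"
  by (induction S rule: infinite_finite_induct) (auto simp: Var_power mult_single)

lemma lookup_sum_single: "finite S \<Longrightarrow> lookup (\<Sum>i\<in>S. single i (e i)) j = (if j \<in> S then e j else 0)"
  for e :: "nat \<Rightarrow> nat"
  by (auto simp: lookup_sum lookup_single when_def)

text \<open>The Euler operator \<open>z\<^sub>i \<partial>/\<partial>z\<^sub>i\<close>.\<close>

definition euler :: "nat \<Rightarrow> mpoly \<Rightarrow> mpoly" where
  "euler i P = Poly_Mapping.mapp (\<lambda>m c. of_nat (lookup m i) * c) P"

lemma lookup_euler: "lookup (euler i P) m = of_nat (lookup m i) * lookup P m"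
  by (simp add: euler_def lookup_mapp when_def in_keys_iff)

lemma euler_0 [simp]: "euler i 0 = 0"
  by (rule poly_mapping_eqI) (simp add: lookup_euler)

lemma euler_add: "euler i (P + R) = euler i P + euler i R"
  by (rule poly_mapping_eqI) (simp add: lookup_euler lookup_add algebra_simps)

lemma euler_single: "euler i (single m c) = single m (of_nat (lookup m i) * c)"
  by (rule poly_mapping_eqI) (simp add: lookup_euler lookup_single when_def)

lemma euler_mult: "euler i (P * R) = euler i P * R + P * euler i R"
proof (induction P rule: poly_mapping_single_induct)
  case (single m c)
  show ?case
  proof (induction R rule: poly_mapping_single_induct)
    case (single n d)
    show ?case by (simp add: mult_single euler_single lookup_add algebra_simps flip: single_add)
  qed (simp_all add: algebra_simps euler_add)
qed (simp_all add: algebra_simps euler_add)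

lemma euler_Var: "euler i (Var j) = (if i = j then Var j else 0)"
  by (auto simp: Var_def euler_single lookup_single)

text \<open>The Witt vector field \<open>\<Sum> z_i^(r+1) d/dz_i\<close>. It is written with the
  Euler operator because that operator is diagonal on monomials, which makes coefficients of its
  values immediate.\<close>

definition witt :: "nat \<Rightarrow> nat \<Rightarrow> mpoly \<Rightarrow> mpoly" where
  "witt k r P = (\<Sum>i<k. Var i ^ r * euler i P)"

lemma witt_mult: "witt k r (P * R) = witt k r P * R + P * witt k r R"
  unfolding witt_def sum_distrib_left sum_distrib_right sum.distrib[symmetric]
  by (intro sum.cong) (auto simp: euler_mult algebra_simps)

lemma witt_add: "witt k r (P + R) = witt k r P + witt k r R"
  unfolding witt_def sum.distrib[symmetric] by (simp add: euler_add algebra_simps)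

lemma witt_0 [simp]: "witt k r 0 = 0" by (simp add: witt_def)

lemma witt_sum: "witt k r (sum f S) = (\<Sum>i\<in>S. witt k r (f i))"
  by (induction S rule: infinite_finite_induct) (auto simp: witt_add)

lemma witt_diff: "witt k r (P - R) = witt k r P - witt k r R"
  using witt_add[of k r "P - R" R] by simp

lemma witt_1 [simp]: "witt k r 1 = 0"
  using witt_mult[of k r 1 1] by simp

lemma witt_Const [simp]: "witt k r (Const c) = 0"
  by (simp add: witt_def Const_def euler_single)

lemma witt_Var: "j < k \<Longrightarrow> witt k r (Var j) = Var j ^ Suc r"
  unfolding witt_def by (subst sum.remove[of _ j]) (auto simp: euler_Var)

lemma witt_power: "witt k r (P ^ n) = of_nat n * P ^ (n - 1) * witt k r P"
proof (induction n)
  case (Suc n)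
  then show ?case by (cases n) (auto simp: witt_mult algebra_simps)
qed simp

text \<open>The logarithmic derivative of a product is the sum of those of the factors, stated
  without division.\<close>

lemma witt_prod_eigen:
  "finite S \<Longrightarrow> (\<And>i. i \<in> S \<Longrightarrow> witt k r (f i) = h i * f i) \<Longrightarrow> witt k r (prod f S) = (\<Sum>i\<in>S. h i) * prod f S"
  by (induction S rule: finite_induct) (auto simp: witt_mult algebra_simps)

section \<open>The loop equation\<close>

definition psum :: "nat \<Rightarrow> nat \<Rightarrow> mpoly" where
  "psum k r = (\<Sum>i<k. Var i ^ r)"

definition trunc_exp :: "nat \<Rightarrow> nat \<Rightarrow> mpoly" where
  "trunc_exp k B = (\<Sum>n\<le>B. Const (1 / (2 ^ n * fact n)) * (\<Sum>i<k. Var i) ^ n)"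

definition top_exp :: "nat \<Rightarrow> nat \<Rightarrow>\<^sub>0 nat" where
  "top_exp k = (\<Sum>i<k. single i (2 * k - 1))"

text \<open>The cut-off \<open>k * (2 * k - 1)\<close> is the total degree of
  \<open>top_exp k\<close>. The discarded terms of the exponential series could not contribute to
  the coefficient that \<open>L\<close> extracts, and the weight stays a polynomial.\<close>

definition weight :: "nat \<Rightarrow> mpoly" where
  "weight k = Delta k Var * Delta k (\<lambda>i. Var i ^ 2) * trunc_exp k (k * (2 * k - 1))"

definition L :: "nat \<Rightarrow> mpoly \<Rightarrow> complex" where
  "L k f = lookup (f * weight k) (top_exp k)"

lemma L_0 [simp]: "L k 0 = 0" by (simp add: L_def)
lemma L_add: "L k (f + g) = L k f + L k g" by (simp add: L_def distrib_right lookup_add)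
lemma L_diff: "L k (f - g) = L k f - L k g" by (simp add: L_def left_diff_distrib lookup_minus)
lemma L_sum: "L k (sum f S) = (\<Sum>i\<in>S. L k (f i))"
  by (induction S rule: infinite_finite_induct) (auto simp: L_add)
lemma L_Const: "L k (Const c * f) = c * L k f" by (simp add: L_def Const_mult_lookup mult.assoc)

lemma Const_1: "Const 1 = 1" by (simp add: Const_def)
lemma Const_mult: "Const (c * d) = Const c * Const d" by (simp add: Const_def mult_single)
lemma Const_of_nat: "Const (of_nat n) = of_nat n" by (simp add: Const_def)
lemma L_of_nat: "L k (of_nat n * f) = of_nat n * L k f" using L_Const[of k "of_nat n" f] by (simp add: Const_of_nat)

lemma sum_lpairs_symmetric:
  fixes F :: "nat \<Rightarrow> nat \<Rightarrow> 'a::comm_ring_1"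
  assumes "\<And>i j. F i j = F j i"
  shows "2 * (\<Sum>(i, j)\<in>lpairs k. F j i) = (\<Sum>i<k. \<Sum>j<k. F i j) - (\<Sum>i<k. F i i)"
proof -
  have "{..<k} \<times> {..<k} = lpairs k \<union> prod.swap ` lpairs k \<union> (\<lambda>i. (i, i)) ` {..<k}"
    by (auto simp: image_iff)
  then have "(\<Sum>(i,j)\<in>{..<k} \<times> {..<k}. F i j)
      = (\<Sum>(i,j)\<in>lpairs k \<union> prod.swap ` lpairs k. F i j) + (\<Sum>(i,j)\<in>(\<lambda>i. (i, i)) ` {..<k}. F i j)"
    by (simp only:) (subst sum.union_disjoint, auto)
  also have "(\<Sum>(i,j)\<in>lpairs k \<union> prod.swap ` lpairs k. F i j)
      = (\<Sum>(i,j)\<in>lpairs k. F i j) + (\<Sum>(i,j)\<in>prod.swap ` lpairs k. F i j)"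
    by (subst sum.union_disjoint) auto
  also have "(\<Sum>(i,j)\<in>prod.swap ` lpairs k. F i j) = (\<Sum>(i,j)\<in>lpairs k. F j i)"
    by (subst sum.reindex) (auto intro!: sum.cong)
  also have "(\<Sum>(i,j)\<in>lpairs k. F i j) = (\<Sum>(i,j)\<in>lpairs k. F j i)"
    using assms by (intro sum.cong) auto
  also have "(\<Sum>(i,j)\<in>(\<lambda>i. (i, i)) ` {..<k}. F i j) = (\<Sum>i<k. F i i)"
    by (subst sum.reindex) (auto simp: inj_on_def)
  finally show ?thesis by (simp add: sum.cartesian_product)
qed

text \<open>The quotient \<open>(x^(r+1) - y^(r+1)) / (x - y)\<close>, the complete homogeneous
  polynomial of degree \<open>r\<close> in two variables.\<close>

definition hsum :: "nat \<Rightarrow> 'a \<Rightarrow> 'a \<Rightarrow> 'a::comm_ring_1" where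
  "hsum r x y = (\<Sum>p<Suc r. x ^ p * y ^ (r - p))"

lemma hsum_commute: "hsum r x y = hsum r y x"
  unfolding hsum_def by (subst sum.nat_diff_reindex[symmetric]) (auto intro!: sum.cong)

lemma hsum_self: "hsum r x x = of_nat (Suc r) * x ^ r"
proof -
  have "hsum r x x = (\<Sum>p<Suc r. x ^ r)" unfolding hsum_def
    by (intro sum.cong) (auto simp flip: power_add)
  then show ?thesis by simp
qed

text \<open>Expanding \<open>hsum\<close> turns the double sum into products of two power sums, the
  quadratic part of the loop equation; the last term removes the diagonal. The factor
  \<open>2\<close> stands on the left so that nothing is divided in the ring.\<close>

lemma sum_lpairs_hsum:
  "2 * (\<Sum>(i, j)\<in>lpairs k. hsum r (x j) (x i)) =
     (\<Sum>p<Suc r. (\<Sum>i<k. x i ^ p) * (\<Sum>i<k. x i ^ (r - p))) - of_nat (Suc r) * (\<Sum>i<k. x i ^ r)"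
proof -
  have "(\<Sum>i<k. \<Sum>j<k. hsum r (x i) (x j)) = (\<Sum>p<Suc r. (\<Sum>i<k. x i ^ p) * (\<Sum>i<k. x i ^ (r - p)))"
    unfolding hsum_def sum_product by (simp only: sum.swap[of _ _ "{..<Suc r}"])
  then show ?thesis
    by (subst sum_lpairs_symmetric) (auto simp: hsum_commute hsum_self sum_distrib_left)
qed

lemma witt_Delta:
  "witt k r (Delta k Var) = (\<Sum>(i, j)\<in>lpairs k. hsum r (Var j) (Var i)) * Delta k Var"
  unfolding Delta_def case_prod_unfold
proof (rule witt_prod_eigen)
  fix p assume "p \<in> {p. fst p < snd p \<and> snd p < k}"
  then show "witt k r (Var (snd p) - Var (fst p)) = hsum r (Var (snd p)) (Var (fst p)) * (Var (snd p) - Var (fst p))"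
    by (simp add: witt_diff witt_Var hsum_def diff_power_eq_sum del: sum.lessThan_Suc power_Suc)
qed (use finite_lpairs[of k] in \<open>simp add: case_prod_unfold\<close>)

text \<open>The field of index \<open>2 * s\<close> sends \<open>w = z^2\<close> to
  \<open>2 * w^(s+1)\<close>, so in the squared variables it is twice the field of index
  \<open>s\<close>.\<close>

lemma witt_Delta2:
  "witt k (2 * s) (Delta k (\<lambda>i. Var i ^ 2)) =
     (2 * (\<Sum>(i, j)\<in>lpairs k. hsum s (Var j ^ 2) (Var i ^ 2))) * Delta k (\<lambda>i. Var i ^ 2)"
  unfolding Delta_def case_prod_unfold sum_distrib_left
proof (rule witt_prod_eigen)
  fix p assume p: "p \<in> {p. fst p < snd p \<and> snd p < k}"
  have *: "witt k (2 * s) (Var i ^ 2) = 2 * (Var i ^ 2) ^ Suc s" if "i < k" for i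
    using that unfolding witt_power by (simp add: witt_Var power_mult power2_eq_square algebra_simps)
  show "witt k (2 * s) (Var (snd p) ^ 2 - Var (fst p) ^ 2) =
    2 * hsum s (Var (snd p) ^ 2) (Var (fst p) ^ 2) * (Var (snd p) ^ 2 - Var (fst p) ^ 2)"
  proof -
    have "witt k (2 * s) (Var (snd p) ^ 2 - Var (fst p) ^ 2) =
        2 * ((Var (snd p) ^ 2) ^ Suc s - (Var (fst p) ^ 2) ^ Suc s)"
    proof -
      have "fst p < k" "snd p < k" using p by auto
      then show ?thesis by (simp only: witt_diff * right_diff_distrib)
    qed
    then show ?thesis by (simp only: diff_power_eq_sum hsum_def ac_simps)
  qed
qed (use finite_lpairs[of k] in \<open>simp add: case_prod_unfold\<close>)

lemma psum_1: "psum k (Suc 0) = (\<Sum>i<k. Var i)" by (simp add: psum_def)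
lemma psum_0: "psum k 0 = of_nat k" by (simp add: psum_def)

lemma witt_psum: "witt k r (psum k m) = of_nat m * psum k (m + r)"
proof (cases m)
  case (Suc n)
  show ?thesis unfolding psum_def witt_sum sum_distrib_left
  proof (intro sum.cong refl)
    fix i assume "i \<in> {..<k}"
    then show "witt k r (Var i ^ m) = of_nat m * Var i ^ (m + r)"
      unfolding witt_power Suc by (simp add: witt_Var power_add algebra_simps)
  qed
qed (use witt_Const[of k r "of_nat k"] in \<open>simp add: Const_of_nat psum_def\<close>)

lemma trunc_exp_Suc:
  "trunc_exp k (Suc B) = trunc_exp k B + Const (1 / (2 ^ Suc B * fact (Suc B))) * (\<Sum>i<k. Var i) ^ Suc B"
  by (simp add: trunc_exp_def)

text \<open>The full exponential would simply be multiplied by \<open>psum k (Suc r) / 2\<close>.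
  Differentiation lowers the degree in the linear form by one, so the truncation misses its last
  term.\<close>

lemma witt_trunc_exp:
  "witt k r (trunc_exp k B) = Const (1/2) * psum k (Suc r) *
     (trunc_exp k B - Const (1 / (2 ^ B * fact B)) * (\<Sum>i<k. Var i) ^ B)"
proof (induction B)
  case 0
  show ?case by (simp add: trunc_exp_def witt_mult)
next
  case (Suc B)
  let ?S = "\<Sum>i<k. Var i"
  have w: "witt k r (?S ^ Suc B) = of_nat (Suc B) * ?S ^ B * psum k (Suc r)"
    using witt_psum[of k r 1] unfolding witt_power by (simp add: psum_1)
  have c: "Const (1 / (2 ^ Suc B * fact (Suc B))) * of_nat (Suc B) = Const (1/2) * Const (1 / (2 ^ B * fact B))"
    unfolding Const_of_nat[symmetric] Const_mult[symmetric]
    by (rule arg_cong[of _ _ Const]) (simp add: field_simps flip: of_nat_Suc)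
  have "witt k r (trunc_exp k (Suc B)) = Const (1/2) * psum k (Suc r) *
     (trunc_exp k B - Const (1 / (2 ^ B * fact B)) * ?S ^ B) +
      (Const (1 / (2 ^ Suc B * fact (Suc B))) * of_nat (Suc B)) * ?S ^ B * psum k (Suc r)"
    unfolding trunc_exp_Suc witt_add witt_mult Suc.IH witt_Const w by (simp only: ac_simps mult_zero_left add_0_left)
  also have "\<dots> = Const (1/2) * psum k (Suc r) * trunc_exp k B"
    unfolding c by (simp add: algebra_simps)
  finally show ?case by (simp add: trunc_exp_Suc)
qed

lemma lookup_top_exp: "i < k \<Longrightarrow> lookup (top_exp k) i = 2 * k - 1"
  by (simp add: top_exp_def lookup_sum_single)

lemma total_degree_top_exp: "total_degree (top_exp k) = k * (2 * k - 1)"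
  by (simp add: top_exp_def total_degree_sum)

lemma sum_euler_Var_power:
  "(\<Sum>i<k. euler i (Var i ^ r * F)) = of_nat r * psum k r * F + witt k r F"
proof -
  have e: "euler i (Var i ^ r) = of_nat r * Var i ^ r" for i
    by (induction r) (auto simp: euler_mult euler_Var algebra_simps Poly_Mapping.single_one[symmetric] euler_single simp del: single_one)
  show ?thesis unfolding psum_def witt_def sum_distrib_left sum_distrib_right sum.distrib[symmetric]
    by (intro sum.cong) (auto simp: euler_mult e algebra_simps)
qed

text \<open>This is the vanishing of the residue of a total derivative. Every exponent in
  \<open>top_exp k\<close> is \<open>2 * k - 1\<close>, which is the eigenvalue of each Euler
  operator there; moving \<open>Var i ^ r\<close> across the operator costs the
  \<open>- r\<close>.\<close>

lemma lookup_witt_top_exp: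
  assumes "k \<ge> 1"
  shows "lookup (witt k r F) (top_exp k) = (2 * of_nat k - 1 - of_nat r) * lookup (psum k r * F) (top_exp k)"
proof -
  have "lookup (\<Sum>i<k. euler i (Var i ^ r * F)) (top_exp k) = (2 * of_nat k - 1) * lookup (psum k r * F) (top_exp k)"
    using assms unfolding psum_def sum_distrib_right lookup_sum sum_distrib_left
    by (intro sum.cong) (auto simp: lookup_euler lookup_top_exp of_nat_diff)
  moreover have "lookup (of_nat r * psum k r * F) (top_exp k) = of_nat r * lookup (psum k r * F) (top_exp k)"
    using Const_mult_lookup[of "of_nat r" "psum k r * F"] by (simp add: Const_of_nat mult.assoc)
  ultimately show ?thesis unfolding sum_euler_Var_power lookup_add by (simp add: algebra_simps)
qed

lemma homogeneous_psum: "homogeneous r (psum k r)"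
  unfolding psum_def by (intro homogeneous_sum) (use homogeneous_power[OF homogeneous_Var] in auto)

text \<open>Integration by parts against the weight, with the vector field \<open>\<Sum>\<^sub>i z\<^sub>i\<^sup>r\<^sup>+\<^sup>1 \<partial>/\<partial>z\<^sub>i\<close>. Only for even
  \<open>r\<close> does it map \<open>Delta (z\<^sup>2)\<close> to a polynomial multiple of itself.\<close>

lemma loop_equation:
  assumes "k \<ge> 1"
  shows "L k (psum k (Suc (2 * s)) * f) / 2 = (2 * of_nat k - 1 - of_nat (2 * s)) * L k (psum k (2 * s) * f)
     - L k (witt k (2 * s) f)
     - L k ((\<Sum>(i, j)\<in>lpairs k. hsum (2 * s) (Var j) (Var i)) * f)
     - L k (2 * (\<Sum>(i, j)\<in>lpairs k. hsum s (Var j ^ 2) (Var i ^ 2)) * f)"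
proof -
  let ?r = "2 * s" let ?S = "\<Sum>i<k. Var i" let ?B = "k * (2 * k - 1)"
  let ?E = "trunc_exp k ?B"
  let ?W = "Delta k Var * Delta k (\<lambda>i. Var i ^ 2)"
  let ?h = "\<Sum>(i, j)\<in>lpairs k. hsum ?r (Var j) (Var i)"
  let ?g = "2 * (\<Sum>(i, j)\<in>lpairs k. hsum s (Var j ^ 2) (Var i ^ 2))"
  have "witt k ?r (f * weight k) = witt k ?r f * weight k + ?h * f * weight k + ?g * f * weight k
     + Const (1/2) * (psum k (Suc ?r) * f) * weight k
     - psum k (Suc ?r) * ?S ^ ?B * (Const (1/2) * Const (1 / (2 ^ ?B * fact ?B)) * f * ?W)"
    unfolding weight_def witt_mult witt_Delta witt_Delta2 witt_trunc_exp by (simp add: algebra_simps)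
  \<comment> \<open>The truncation error has degree above that of \<open>top_exp k\<close>.\<close>
  moreover have "lookup (psum k (Suc ?r) * ?S ^ ?B * (Const (1/2) * Const (1 / (2 ^ ?B * fact ?B)) * f * ?W)) (top_exp k) = 0"
  proof (rule lookup_mult_eq_0_of_homogeneous)
    show "homogeneous (Suc ?r + ?B * 1) (psum k (Suc ?r) * ?S ^ ?B)"
      by (intro homogeneous_mult homogeneous_psum homogeneous_power homogeneous_sum homogeneous_Var)
  qed (simp add: total_degree_top_exp)
  ultimately have "lookup (witt k ?r (f * weight k)) (top_exp k) =
     L k (witt k ?r f) + L k (?h * f) + L k (?g * f) + L k (Const (1/2) * (psum k (Suc ?r) * f))"
    unfolding L_def by (simp add: lookup_add lookup_minus)
  also have "lookup (witt k ?r (f * weight k)) (top_exp k) = (2 * of_nat k - 1 - of_nat ?r) * L k (psum k ?r * f)"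
    using lookup_witt_top_exp[OF assms] by (simp add: L_def mult.assoc)
  finally show ?thesis unfolding L_Const by (simp add: algebra_simps)
qed

section \<open>Vandermonde determinants and even power sums\<close>

text \<open>The alternant \<open>det (w_i^(c_j))\<close>, kept in Leibniz form because coefficients
  of polynomials are read off one permutation at a time.\<close>

definition power_det :: "nat \<Rightarrow> (nat \<Rightarrow> nat) \<Rightarrow> (nat \<Rightarrow> 'a::comm_ring_1) \<Rightarrow> 'a" where
  "power_det k c w = (\<Sum>p | p permutes {0..<k}. signof p * (\<Prod>i = 0..<k. w i ^ c (p i)))"

lemma power_det_eq_det: "power_det k c w = Determinant.det (mat k k (\<lambda>(i, j). w i ^ c j))"
  unfolding power_det_def
  by (subst det_def'[of _ k]) (auto intro!: sum.cong prod.cong simp: permutes_in_image)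

text \<open>Column operations: the matrix is the Vandermonde matrix times the matrix of
  coefficients, which is triangular with ones on the diagonal.\<close>

lemma det_monic_polys:
  fixes w :: "nat \<Rightarrow> 'a::comm_ring_1"
  assumes "\<And>j. j < k \<Longrightarrow> degree (f j) \<le> j \<and> coeff (f j) j = 1"
  shows "Determinant.det (mat k k (\<lambda>(i, j). poly (f j) (w i))) = power_det k id w"
proof -
  let ?V = "mat k k (\<lambda>(i, j). w i ^ id j)"
  let ?U = "mat k k (\<lambda>(i, j). coeff (f j) i)"
  have "mat k k (\<lambda>(i, j). poly (f j) (w i)) = ?V * ?U"
  proof (rule eq_matI, goal_cases)
    case (1 i j)
    then have "degree (f j) < k" using assms[of j] by auto
    have "poly (f j) (w i) = (\<Sum>l\<le>degree (f j). coeff (f j) l * w i ^ l)" by (rule poly_altdef)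
    also have "\<dots> = (\<Sum>l<k. coeff (f j) l * w i ^ l)"
      by (intro sum.mono_neutral_left) (use \<open>degree (f j) < k\<close> in \<open>auto simp: coeff_eq_0\<close>)
    finally show ?case using 1
      by (simp add: times_mat_def scalar_prod_def atLeast0LessThan mult.commute)
  qed auto
  moreover have "Determinant.det ?U = 1"
  proof -
    have "upper_triangular ?U" unfolding upper_triangular_def
      by (auto intro!: coeff_eq_0 le_less_trans[OF conjunct1[OF assms]])
    then have "Determinant.det ?U = prod_list (diag_mat ?U)" by (rule det_upper_triangular) auto
    also have "\<dots> = 1" unfolding prod_list_diag_prod by (auto intro!: prod.neutral simp: assms)
    finally show ?thesis .
  qed
  ultimately show ?thesis unfolding power_det_eq_det by (subst (asm) eq_commute) (simp add: det_mult[of _ k])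
qed

lemma monic_prod_linear:
  fixes a :: "nat \<Rightarrow> 'a::comm_ring_1"
  shows "degree (\<Prod>l<j. [:- a l, 1:]) \<le> j \<and> coeff (\<Prod>l<j. [:- a l, 1:]) j = 1"
proof (induction j)
  case (Suc j)
  let ?p = "\<Prod>l<j. [:- a l, 1:]"
  have e: "(\<Prod>l<Suc j. [:- a l, 1:]) = pCons 0 ?p - Polynomial.smult (a j) ?p" by (simp add: algebra_simps)
  have "coeff ?p (Suc j) = 0" using Suc by (auto intro: coeff_eq_0)
  moreover have "degree (pCons 0 ?p - Polynomial.smult (a j) ?p) \<le> Suc j"
    using Suc by (intro degree_diff_le) (auto simp: le_Suc_eq intro: order.trans[OF degree_pCons_le] order.trans[OF degree_smult_le])
  ultimately show ?case unfolding e using Suc by simp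
qed simp

lemma Delta_altdef: "Delta k w = (\<Prod>j<k. \<Prod>i<j. w j - w i)"
proof -
  have "Delta k w = (\<Prod>(j, i)\<in>(SIGMA j:{..<k}. {..<j}). w j - w i)"
    unfolding Delta_def
    by (rule prod.reindex_bij_witness[of _ prod.swap prod.swap]) auto
  then show ?thesis by (simp add: prod.Sigma)
qed

text \<open>All monic bases give the same determinant, and for the Newton basis with nodes
  \<open>w l\<close> the matrix is triangular with the factors of \<open>Delta\<close> on its
  diagonal. The argument works over any commutative ring, in particular for polynomials.\<close>

lemma det_monic_polys_eq_Delta:
  fixes w :: "nat \<Rightarrow> 'a::comm_ring_1"
  assumes "\<And>j. j < k \<Longrightarrow> degree (f j) \<le> j \<and> coeff (f j) j = 1"
  shows "Determinant.det (mat k k (\<lambda>(i, j). poly (f j) (w i))) = Delta k w"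
proof -
  let ?n = "\<lambda>j. \<Prod>l<j. [:- w l, 1:]"
  let ?M = "mat k k (\<lambda>(i, j). poly (?n j) (w i))"
  have "Determinant.det ?M = prod_list (diag_mat ?M)"
  proof (rule det_lower_triangular[of k])
    fix i j assume "i < j" "j < k"
    then show "?M $$ (i, j) = 0" by (auto simp: poly_prod intro!: prod_zero)
  qed auto
  also have "\<dots> = (\<Prod>j = 0..<k. \<Prod>i<j. w j - w i)"
    unfolding prod_list_diag_prod by (auto intro!: prod.cong simp: poly_prod)
  also have "\<dots> = Delta k w" by (simp add: Delta_altdef atLeast0LessThan)
  finally show ?thesis
    using det_monic_polys[of k f w, OF assms] det_monic_polys[of k ?n w, OF monic_prod_linear] by simp
qed

lemma power_det_id: "power_det k id w = Delta k w"
  using det_monic_polys[of k "monom 1" w] det_monic_polys_eq_Delta[of k "monom 1" w]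
  by (simp add: degree_monom_le)

lemma power_det_eq_0:
  assumes "m < k" "n < k" "m \<noteq> n" "c m = c n"
  shows "power_det k c w = 0"
proof -
  let ?M = "mat k k (\<lambda>(i, j). w i ^ c j)"
  have "Determinant.det (transpose_mat ?M) = 0"
    by (rule det_identical_rows[of _ k m n]) (use assms in \<open>auto simp: row_transpose intro!: eq_vecI\<close>)
  then show ?thesis unfolding power_det_eq_det by (subst (asm) det_transpose[of _ k]) auto
qed

text \<open>In the summand of a permutation \<open>p\<close>, multiplying by \<open>w m ^ s\<close>
  raises the exponent of row \<open>m\<close>, which is the exponent belonging to column
  \<open>p m\<close>. Summing over \<open>m\<close> is therefore summing over the raised
  column.\<close>

lemma power_sum_mult_power_det:
  "(\<Sum>i<k. w i ^ s) * power_det k id w = (\<Sum>n<k. power_det k (\<lambda>j. if j = n then j + s else j) w)"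
proof -
  let ?P = "{p. p permutes {0..<k}}"
  have "(\<Sum>i<k. w i ^ s) * power_det k id w
     = (\<Sum>p\<in>?P. \<Sum>m<k. signof p * (w m ^ s * (\<Prod>i = 0..<k. w i ^ p i)))"
    unfolding power_det_def sum_product by (subst sum.swap) (simp add: algebra_simps)
  also have "\<dots> = (\<Sum>p\<in>?P. \<Sum>n<k. signof p * (\<Prod>i = 0..<k. w i ^ (if p i = n then p i + s else p i)))"
  proof (rule sum.cong[OF refl])
    fix p assume "p \<in> ?P"
    then have p: "p permutes {0..<k}" by simp
    show "(\<Sum>m<k. signof p * (w m ^ s * (\<Prod>i = 0..<k. w i ^ p i)))
      = (\<Sum>n<k. signof p * (\<Prod>i = 0..<k. w i ^ (if p i = n then p i + s else p i)))"
    proof (rule sum.reindex_bij_betw[of p "{..<k}" "{..<k}", THEN subst])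
      show "bij_betw p {..<k} {..<k}" using permutes_imp_bij[OF p] by (simp add: atLeast0LessThan)
      show "(\<Sum>m<k. signof p * (w m ^ s * (\<Prod>i = 0..<k. w i ^ p i)))
         = (\<Sum>x<k. signof p * (\<Prod>i = 0..<k. w i ^ (if p i = p x then p i + s else p i)))"
      proof (intro sum.cong refl arg_cong2[of _ _ _ _ "(*)"])
        fix x assume x: "x \<in> {..<k}"
        have "(\<Prod>i = 0..<k. w i ^ (if p i = p x then p i + s else p i))
           = (\<Prod>i = 0..<k. (if i = x then w x ^ s else 1) * w i ^ p i)"
          using permutes_inj[OF p] by (intro prod.cong) (auto simp: power_add inj_eq)
        also have "\<dots> = w x ^ s * (\<Prod>i = 0..<k. w i ^ p i)"
          using x unfolding prod.distrib by simp
        finally show "w x ^ s * (\<Prod>i = 0..<k. w i ^ p i) = (\<Prod>i = 0..<k. w i ^ (if p i = p x then p i + s else p i))" by simp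
      qed
    qed
  qed
  also have "\<dots> = (\<Sum>n<k. power_det k (\<lambda>j. if j = n then j + s else j) w)"
    unfolding power_det_def by (subst sum.swap) simp
  finally show ?thesis .
qed

text \<open>In the squared variables \<open>psum k (2 * s)\<close> is an ordinary power sum, so it
  raises one exponent of the alternant \<open>Delta k (\<lambda>i. Var i ^ 2)\<close> from
  \<open>n\<close> to \<open>n + s\<close>. If \<open>n + s < k\<close>, two columns coincide.
  Otherwise every term contains some \<open>Var i\<close> to a power at least \<open>2 * k\<close>,
  beyond the exponent \<open>2 * k - 1\<close> that is extracted.\<close>

lemma L_even_psum:
  assumes "s \<ge> 1" shows "L k (psum k (2 * s) * f) = 0"
proof -
  let ?w = "\<lambda>i. Var i ^ 2"
  let ?E = "trunc_exp k (k * (2 * k - 1))"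
  have "psum k (2 * s) * Delta k ?w = (\<Sum>n<k. power_det k (\<lambda>j. if j = n then j + s else j) ?w)"
    using power_sum_mult_power_det[where w = ?w and k = k and s = s] by (simp add: psum_def power_det_id power_mult)
  moreover have "psum k (2 * s) * f * weight k = (psum k (2 * s) * Delta k ?w) * (f * Delta k Var * ?E)"
    unfolding weight_def by (simp only: ac_simps)
  ultimately have "psum k (2 * s) * f * weight k
     = (\<Sum>n<k. power_det k (\<lambda>j. if j = n then j + s else j) ?w) * (f * Delta k Var * ?E)"
    by simp
  then have "L k (psum k (2 * s) * f) =
     (\<Sum>n<k. lookup (power_det k (\<lambda>j. if j = n then j + s else j) ?w * (f * Delta k Var * ?E)) (top_exp k))"
    unfolding L_def by (simp add: sum_distrib_right lookup_sum)
  also have "\<dots> = 0"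
  proof (rule sum.neutral, rule ballI)
    fix n assume "n \<in> {..<k}"
    then have n: "n < k" by simp
    let ?F = "f * Delta k Var * ?E"
    show "lookup (power_det k (\<lambda>j. if j = n then j + s else j) ?w * ?F) (top_exp k) = 0"
    proof (cases "n + s < k")
      case True
      then have "power_det k (\<lambda>j. if j = n then j + s else j) ?w = 0"
        using assms n by (intro power_det_eq_0[of n k "n + s"]) auto
      then show ?thesis by simp
    next
      case False
      show ?thesis unfolding power_det_def sum_distrib_right lookup_sum
      proof (rule sum.neutral, rule ballI)
        fix p assume "p \<in> {p. p permutes {0..<k}}"
        then have p: "p permutes {0..<k}" by simp
        obtain i where i: "i < k" "p i = n"
          using n permutes_image[OF p] by (metis atLeastLessThan_iff imageE zero_le)
        let ?t = "\<lambda>i. ?w i ^ (if p i = n then p i + s else p i)"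
        have "(\<Prod>i = 0..<k. ?t i) = Var i ^ (2 * (n + s)) * (\<Prod>i\<in>{0..<k} - {i}. ?t i)"
          using i by (subst prod.remove[of _ i]) (simp_all flip: power_mult)
        then have "signof p * (\<Prod>i = 0..<k. ?t i) * ?F = Var i ^ (2 * (n + s)) * (signof p * (\<Prod>i\<in>{0..<k} - {i}. ?t i) * ?F)"
          by (simp only: ac_simps)
        then show "lookup (signof p * (\<Prod>i = 0..<k. ?t i) * ?F) (top_exp k) = 0"
          using False i by (simp only:) (rule lookup_Var_power_mult, simp add: lookup_top_exp)
      qed
    qed
  qed
  finally show ?thesis .
qed

section \<open>The normalising constant\<close>

lemma euler_power: "euler i (P ^ n) = of_nat n * P ^ (n - 1) * euler i P"
proof (induction n)
  case 0
  show ?case using euler_mult[of i 1 1] by simp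
next
  case (Suc n)
  then show ?case by (cases n) (auto simp: euler_mult algebra_simps)
qed

lemma euler_sum: "euler i (sum f S) = (\<Sum>j\<in>S. euler i (f j))"
  by (induction S rule: infinite_finite_induct) (auto simp: euler_add)

text \<open>A multinomial coefficient, found by applying the Euler operator in a variable that
  occurs: both sides satisfy the same recursion when that exponent is lowered by one.\<close>

lemma lookup_exp_term:
  "(\<Sum>i<k. \<gamma> i) = n \<Longrightarrow> lookup (Const (1 / (2 ^ n * fact n)) * (\<Sum>i<k. Var i) ^ n) (\<Sum>i<k. single i (\<gamma> i))
     = (\<Prod>i<k. (1/2) ^ \<gamma> i / fact (\<gamma> i))"
proof (induction n arbitrary: \<gamma>)
  case 0
  then show ?case by (simp add: Const_def)
next
  case (Suc n)
  let ?S = "\<Sum>i<k. Var i"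
  obtain i where i: "i < k" "\<gamma> i > 0"
    using Suc.prems by (metis lessThan_iff nat.distinct(1) not_gr_zero sum.neutral)
  define \<delta> where "\<delta> = \<gamma>(i := \<gamma> i - 1)"
  have m: "(\<Sum>j<k. single j (\<gamma> j)) = single i 1 + (\<Sum>j<k. single j (\<delta> j))"
    by (rule poly_mapping_eqI) (use i in \<open>auto simp: lookup_add lookup_sum_single lookup_single \<delta>_def when_def\<close>)
  have "(\<Sum>j<k. \<gamma> j) = Suc (\<Sum>j<k. \<delta> j)"
    using i by (simp add: sum.remove[of "{..<k}" i] \<delta>_def)
  then have IH: "lookup (Const (1 / (2 ^ n * fact n)) * ?S ^ n) (\<Sum>j<k. single j (\<delta> j)) = (\<Prod>i<k. (1/2) ^ \<delta> i / fact (\<delta> i))"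
    using Suc by simp
  have "euler i ?S = Var i" unfolding euler_sum using i by (simp add: euler_Var)
  then have "euler i (Const (1 / (2 ^ Suc n * fact (Suc n))) * ?S ^ Suc n)
     = Const (1 / (2 ^ Suc n * fact (Suc n))) * of_nat (Suc n) * ?S ^ n * Var i"
    unfolding euler_mult euler_power by (simp add: Const_def euler_single)
  also have "Const (1 / (2 ^ Suc n * fact (Suc n))) * of_nat (Suc n) = Const (1/2) * Const (1 / (2 ^ n * fact n))"
    unfolding Const_of_nat[symmetric] Const_mult[symmetric]
    by (rule arg_cong[of _ _ Const]) (simp add: field_simps flip: of_nat_Suc)
  finally have "euler i (Const (1 / (2 ^ Suc n * fact (Suc n))) * ?S ^ Suc n) = single (single i 1) (1/2) * (Const (1 / (2 ^ n * fact n)) * ?S ^ n)"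
    by (simp add: Var_def Const_def mult_single algebra_simps)
  from arg_cong[OF this, of "\<lambda>P. lookup P (\<Sum>j<k. single j (\<gamma> j))"]
  have e1: "of_nat (\<gamma> i) * lookup (Const (1 / (2 ^ Suc n * fact (Suc n))) * ?S ^ Suc n) (\<Sum>j<k. single j (\<gamma> j))
     = 1/2 * (\<Prod>i<k. (1/2) ^ \<delta> i / fact (\<delta> i))"
    unfolding IH[symmetric] lookup_euler m lookup_single_mult
    by (simp add: lookup_add lookup_sum_single i \<delta>_def)
  have e2: "(\<Prod>j<k. (1/2) ^ \<gamma> j / fact (\<gamma> j)) = (1/2) / of_nat (\<gamma> i) * (\<Prod>i<k. (1/2) ^ \<delta> i / fact (\<delta> i) :: complex)"
  proof -
    have "(\<Prod>j\<in>{..<k} - {i}. (1/2) ^ \<gamma> j / fact (\<gamma> j)) = (\<Prod>j\<in>{..<k} - {i}. (1/2) ^ \<delta> j / fact (\<delta> j) :: complex)"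
      by (intro prod.cong) (auto simp: \<delta>_def)
    moreover have "(1/2) ^ \<gamma> i / fact (\<gamma> i) = (1/2) / of_nat (\<gamma> i) * ((1/2) ^ \<delta> i / fact (\<delta> i) :: complex)"
      using i(2) by (cases "\<gamma> i") (auto simp: \<delta>_def field_simps)
    ultimately show ?thesis using i(1) by (simp add: prod.remove[of "{..<k}" i])
  qed
  have nz: "of_nat (\<gamma> i) \<noteq> (0 :: complex)" using i(2) by simp
  show ?case using eq_divide_imp[OF nz e1[unfolded mult.commute[of "of_nat (\<gamma> i)"]]] unfolding e2 by simp
qed

lemma lookup_trunc_exp:
  assumes "(\<Sum>i<k. \<gamma> i) \<le> B"
  shows "lookup (trunc_exp k B) (\<Sum>i<k. single i (\<gamma> i)) = (\<Prod>i<k. (1/2) ^ \<gamma> i / fact (\<gamma> i))"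
proof -
  let ?d = "\<Sum>i<k. \<gamma> i" let ?m = "\<Sum>i<k. single i (\<gamma> i)"
  have "lookup (Const (1 / (2 ^ n * fact n)) * (\<Sum>i<k. Var i) ^ n) ?m =
     (if n = ?d then (\<Prod>i<k. (1/2) ^ \<gamma> i / fact (\<gamma> i)) else 0)" for n
  proof -
    have "homogeneous (0 + n * 1) (Const (1 / (2 ^ n * fact n)) * (\<Sum>i<k. Var i) ^ n)"
      by (intro homogeneous_mult homogeneous_Const homogeneous_power homogeneous_sum homogeneous_Var)
    moreover have "total_degree ?m = ?d" by (simp add: total_degree_sum)
    ultimately show ?thesis using lookup_exp_term[of \<gamma> k n] unfolding homogeneous_def by auto
  qed
  then show ?thesis using assms by (simp add: trunc_exp_def lookup_sum)
qed

text \<open>The coefficient of \<open>z^(2k-1-e)\<close> in \<open>exp (z/2)\<close>. The case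
  \<open>e > 2 * k - 1\<close> is separate because truncated subtraction would give \<open>1\<close>
  there instead of \<open>0\<close>.\<close>

definition inv_fact_entry :: "nat \<Rightarrow> nat \<Rightarrow> complex" where
  "inv_fact_entry k e = (if e \<le> 2 * k - 1 then (1/2) ^ (2 * k - 1 - e) / fact (2 * k - 1 - e) else 0)"

lemma lookup_monomial_mult_trunc_exp:
  "lookup ((\<Prod>i<k. Var i ^ e i) * trunc_exp k (k * (2 * k - 1))) (top_exp k) = (\<Prod>i<k. inv_fact_entry k (e i))"
proof (cases "\<forall>i<k. e i \<le> 2 * k - 1")
  case True
  have "top_exp k = (\<Sum>i<k. single i (e i)) + (\<Sum>i<k. single i (2 * k - 1 - e i))"
    unfolding top_exp_def sum.distrib[symmetric] using True by (intro sum.cong) (auto simp flip: single_add)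
  moreover have "(\<Sum>i<k. 2 * k - 1 - e i) \<le> k * (2 * k - 1)"
    using sum_bounded_above[of "{..<k}" "\<lambda>i. 2 * k - 1 - e i" "2 * k - 1"] by simp
  ultimately show ?thesis using True
    unfolding prod_Var_power lookup_single_mult by (simp add: lookup_trunc_exp lookup_single_mult inv_fact_entry_def)
next
  case False
  then obtain i where i: "i < k" "\<not> e i \<le> 2 * k - 1" by auto
  have "lookup (Var i ^ e i * ((\<Prod>i\<in>{..<k} - {i}. Var i ^ e i) * trunc_exp k (k * (2 * k - 1)))) (top_exp k) = 0"
    by (rule lookup_Var_power_mult) (use i in \<open>simp add: lookup_top_exp\<close>)
  moreover have "(\<Prod>i<k. inv_fact_entry k (e i)) = 0"
    using i by (auto simp: inv_fact_entry_def)
  ultimately show ?thesis using i by (simp add: prod.remove[of _ i] mult.assoc)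
qed

lemma prod_falling:
  "(\<Prod>l<j. of_nat x - of_nat l :: complex) = (if j \<le> x then fact x / fact (x - j) else 0)"
proof (cases "j \<le> x")
  case True
  then show ?thesis
  proof (induction j)
    case (Suc j)
    then have "fact (x - j) = (of_nat x - of_nat j) * (fact (x - Suc j) :: complex)"
      by (simp add: Suc_diff_Suc[symmetric] fact_reduce of_nat_diff)
    moreover have "(of_nat x - of_nat j :: complex) \<noteq> 0" using Suc by simp
    ultimately show ?case using Suc by simp
  qed simp
qed auto

text \<open>A discrete form of Andreief's identity. With both alternants expanded, the inner sum for
  a fixed \<open>q\<close> is a determinant whose rows are permuted by \<open>q\<close>; the two
  signs of \<open>q\<close> cancel and leave \<open>k!\<close> equal terms.\<close>

lemma L_1_det: "L k 1 = fact k * Determinant.det (mat k k (\<lambda>(i, j). inv_fact_entry k (2 * i + j)))"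
proof -
  let ?P = "{p. p permutes {0..<k}}" let ?E = "trunc_exp k (k * (2 * k - 1))"
  let ?g = "mat k k (\<lambda>(i, j). inv_fact_entry k (2 * i + j))"
  have sgn: "(signof p :: mpoly) = Const (signof p)" for p :: "nat \<Rightarrow> nat"
    by (simp add: Const_def)
  have "weight k = (\<Sum>q\<in>?P. \<Sum>p\<in>?P. Const (signof q) * (Const (signof p) * ((\<Prod>i<k. Var i ^ (2 * q i + p i)) * ?E)))"
    unfolding weight_def power_det_id[symmetric] power_det_def sum_product
    unfolding sum_distrib_right
    by (subst sum.swap, intro sum.cong refl)
       (simp add: sgn power_add prod.distrib atLeast0LessThan algebra_simps flip: power_mult)
  then have "L k 1 = (\<Sum>q\<in>?P. signof q * (\<Sum>p\<in>?P. signof p * (\<Prod>i<k. inv_fact_entry k (2 * q i + p i))))"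
    unfolding L_def
    by (simp only: mult_1 lookup_sum Const_mult_lookup lookup_monomial_mult_trunc_exp sum_distrib_left)
  also have "\<dots> = (\<Sum>q\<in>?P. Determinant.det ?g)"
  proof (rule sum.cong[OF refl])
    fix q assume "q \<in> ?P"
    then have q: "q permutes {0..<k}" by simp
    have "(\<Sum>p\<in>?P. signof p * (\<Prod>i<k. inv_fact_entry k (2 * q i + p i)))
       = Determinant.det (mat k k (\<lambda>(i, j). ?g $$ (q i, j)))"
      using q by (subst det_def'[of _ k]) (auto intro!: sum.cong prod.cong simp: permutes_in_image atLeast0LessThan)
    also have "\<dots> = signof q * Determinant.det ?g"
      by (rule det_permute_rows[OF _ q]) simp
    finally show "signof q * (\<Sum>p\<in>?P. signof p * (\<Prod>i<k. inv_fact_entry k (2 * q i + p i))) = Determinant.det ?g"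
      by (simp add: sign_def)
  qed
  also have "\<dots> = fact k * Determinant.det ?g"
    by (simp add: card_permutations)
  finally show ?thesis .
qed

text \<open>The reciprocal factorial of \<open>x - j\<close> is that of \<open>x\<close> times a
  falling factorial of degree \<open>j\<close> in \<open>x\<close>. Scaling rows and columns thus
  leaves monic polynomials evaluated at the nodes \<open>2k - 1 - 2i\<close>, a Vandermonde
  determinant. For \<open>j > x\<close> the falling factorial vanishes, in agreement with the zero
  entries.\<close>

lemma det_inv_fact_entry:
  "Determinant.det (mat k k (\<lambda>(i, j). inv_fact_entry k (2 * i + j)))
     = (\<Prod>i<k. 2 ^ i * ((- 2) ^ i * fact i) / (2 ^ (2 * i + 1) * fact (2 * i + 1)))"
proof -
  define x where "x i = 2 * k - 1 - 2 * i" for i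
  let ?f = "\<lambda>j. \<Prod>l<j. [:- (of_nat l :: complex), 1:]"
  let ?P = "{p. p permutes {0..<k}}"
  have entry: "inv_fact_entry k (2 * i + j) = 1 / (2 ^ x i * fact (x i)) * (2 ^ j * poly (?f j) (of_nat (x i)))" if "i < k" for i j
  proof (cases "j \<le> x i")
    case True
    then have "(1/2 :: complex) ^ (x i - j) = 2 ^ j / 2 ^ x i"
      by (simp add: power_diff field_simps power_divide)
    moreover have "2 * i + j \<le> 2 * k - 1" "2 * k - 1 - (2 * i + j) = x i - j" using True that unfolding x_def by auto
    ultimately show ?thesis using True by (simp add: inv_fact_entry_def poly_prod prod_falling)
  next
    case False
    then have "\<not> 2 * i + j \<le> 2 * k - 1" using that unfolding x_def by auto
    with False show ?thesis by (simp add: inv_fact_entry_def poly_prod prod_falling)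
  qed
  have "Determinant.det (mat k k (\<lambda>(i, j). inv_fact_entry k (2 * i + j)))
     = (\<Sum>p\<in>?P. signof p * (\<Prod>i<k. 1 / (2 ^ x i * fact (x i)) * (2 ^ p i * poly (?f (p i)) (of_nat (x i)))))"
    by (subst det_def'[of _ k]) (auto intro!: sum.cong prod.cong simp: permutes_in_image atLeast0LessThan entry)
  also have "\<dots> = (\<Sum>p\<in>?P. (\<Prod>i<k. 1 / (2 ^ x i * fact (x i))) * (\<Prod>i<k. 2 ^ i) * (signof p * (\<Prod>i<k. poly (?f (p i)) (of_nat (x i)))))"
  proof (intro sum.cong refl)
    fix p assume "p \<in> ?P"
    then have "(\<Prod>i<k. 2 ^ p i :: complex) = (\<Prod>i<k. 2 ^ i)"
      by (intro prod.reindex_bij_betw[of p]) (auto dest!: permutes_imp_bij simp: atLeast0LessThan)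
    then show "signof p * (\<Prod>i<k. 1 / (2 ^ x i * fact (x i)) * (2 ^ p i * poly (?f (p i)) (of_nat (x i))))
      = (\<Prod>i<k. 1 / (2 ^ x i * fact (x i))) * (\<Prod>i<k. 2 ^ i) * (signof p * (\<Prod>i<k. poly (?f (p i)) (of_nat (x i))))"
      unfolding prod.distrib by simp
  qed
  also have "\<dots> = (\<Prod>i<k. 1 / (2 ^ x i * fact (x i))) * (\<Prod>i<k. 2 ^ i) * Determinant.det (mat k k (\<lambda>(i, j). poly (?f j) (of_nat (x i))))"
    unfolding sum_distrib_left[symmetric]
    by (subst det_def'[of _ k]) (auto intro!: sum.cong prod.cong simp: permutes_in_image atLeast0LessThan)
  also have "Determinant.det (mat k k (\<lambda>(i, j). poly (?f j) (of_nat (x i)))) = Delta k (\<lambda>i. of_nat (x i))"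
    by (rule det_monic_polys_eq_Delta[OF monic_prod_linear])
  \<comment> \<open>The nodes are equally spaced: \<open>x j - x i = - 2 * (j - i)\<close>.\<close>
  also have "Delta k (\<lambda>i. of_nat (x i)) = (\<Prod>j<k. (- 2) ^ j * (fact j :: complex))"
    unfolding Delta_altdef
  proof (intro prod.cong refl)
    fix j assume "j \<in> {..<k}"
    then have "(\<Prod>i<j. of_nat (x j) - of_nat (x i)) = (\<Prod>i<j. (-2) * (of_nat (j - i) :: complex))"
      by (intro prod.cong) (auto simp: x_def of_nat_diff)
    also have "\<dots> = (-2) ^ j * (\<Prod>i<j. of_nat (j - i))" by (simp only: prod.distrib prod_constant card_lessThan)
    also have "(\<Prod>i<j. of_nat (j - i) :: complex) = fact j"
      by (simp add: fact_prod_rev flip: atLeast0LessThan)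
    finally show "(\<Prod>i<j. of_nat (x j) - of_nat (x i)) = (- 2) ^ j * (fact j :: complex)" .
  qed
  \<comment> \<open>\<open>x\<close> runs through the odd numbers below \<open>2 * k\<close> in
    decreasing order.\<close>
  also have "(\<Prod>i<k. 1 / (2 ^ x i * fact (x i))) = (\<Prod>i<k. 1 / (2 ^ (2 * i + 1) * fact (2 * i + 1) :: complex))"
    by (subst prod.nat_diff_reindex[symmetric]) (auto intro!: prod.cong simp: x_def Suc_diff_Suc diff_mult_distrib2 algebra_simps)
  finally show ?thesis by (simp only: prod.distrib[symmetric]) simp
qed

text \<open>Both sides are the product of all \<open>fact j\<close> with \<open>j < 2 * k\<close>,
  split once at \<open>k\<close> and once by parity.\<close>

lemma prod_fact_split: "(\<Prod>j<k. fact (k + j) * fact j :: complex) = (\<Prod>j<k. fact (2 * j) * fact (2 * j + 1))"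
proof -
  have "(\<Prod>j<k. fact (k + j) * fact j :: complex) = (\<Prod>j<2 * k. fact j)"
  proof -
    have "(\<Prod>j<k + n. fact j :: complex) = (\<Prod>j<k. fact j) * (\<Prod>j<n. fact (k + j))" for n
      by (induction n) auto
    from this[of k] show ?thesis unfolding mult_2 prod.distrib by (simp add: mult.commute)
  qed
  also have "\<dots> = (\<Prod>j<k. fact (2 * j) * fact (2 * j + 1))" by (induction k) auto
  finally show ?thesis .
qed

text \<open>The prefactor of \<open>N\<close>, which turns out to be the inverse of
  \<open>L k 1\<close>.\<close>

definition norm_const :: "nat \<Rightarrow> complex" where
  "norm_const k = (- 1) ^ (k * (k - 1) div 2) * 2 ^ k / fact k * (\<Prod>j<k. fact (k + j) / fact (2 * j))"

lemma norm_const_mult_L_1: "norm_const k * L k 1 = 1"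
proof -
  have sgn: "(\<Prod>j<k. (-1) ^ j :: complex) = (- 1) ^ (k * (k - 1) div 2)"
    by (simp add: gauss_sum_nat power_sum[symmetric] Sum_Ico_nat[of 0 k, simplified atLeast0LessThan])
  have "norm_const k * L k 1 = (- 1) ^ (k * (k - 1) div 2) * 2 ^ k *
     (\<Prod>i<k. fact (k + i) / fact (2 * i) * (2 ^ i * ((- 2) ^ i * fact i) / (2 ^ (2 * i + 1) * fact (2 * i + 1))))"
    unfolding norm_const_def L_1_det det_inv_fact_entry prod.distrib by simp
  also have "(\<Prod>i<k. fact (k + i) / fact (2 * i) * (2 ^ i * ((- 2) ^ i * fact i) / (2 ^ (2 * i + 1) * fact (2 * i + 1))))
     = (\<Prod>i<k. (-1) ^ i * (1/2) * ((fact (k + i) * fact i) / (fact (2 * i) * fact (2 * i + 1))) :: complex)"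
  proof (intro prod.cong refl)
    fix i
    have "(-2 :: complex) ^ i = (-1) ^ i * 2 ^ i" by (metis mult_minus1 power_mult_distrib)
    then show "fact (k + i) / fact (2 * i) * (2 ^ i * ((- 2) ^ i * fact i) / (2 ^ (2 * i + 1) * fact (2 * i + 1)))
       = (-1) ^ i * (1/2) * ((fact (k + i) * fact i) / (fact (2 * i) * fact (2 * i + 1)) :: complex)"
      by (simp add: power_mult power2_eq_square power_mult_distrib field_simps del: fact_Suc)
  qed
  also have "\<dots> = (- 1) ^ (k * (k - 1) div 2) * (1/2) ^ k *
      ((\<Prod>i<k. fact (k + i) * fact i) / (\<Prod>i<k. fact (2 * i) * fact (2 * i + 1)))"
    unfolding prod.distrib sgn prod_dividef by (simp add: power_divide del: fact_Suc)
  also have "(\<Prod>i<k. fact (k + i) * fact i) / (\<Prod>i<k. fact (2 * i) * fact (2 * i + 1)) = (1 :: complex)"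
    unfolding prod_fact_split by (simp del: fact_Suc)
  finally show ?thesis by (simp add: power_divide flip: power_mult_distrib)
qed

section \<open>Polynomial dependence on \<open>k\<close>\<close>

text \<open>Values are prescribed for \<open>k \<ge> 1\<close> only: at \<open>k = 0\<close> the
  exponent \<open>2 * k - 1\<close> is a truncated subtraction, and the loop equation is not
  claimed.\<close>

definition poly_on_pos :: "nat \<Rightarrow> (nat \<Rightarrow> complex) \<Rightarrow> bool" where
  "poly_on_pos d g \<longleftrightarrow> (\<exists>P. degree P \<le> d \<and> (\<forall>k\<ge>1. poly P (of_nat k) = g k))"

lemma poly_on_pos_cong: "poly_on_pos d f \<Longrightarrow> (\<And>k. k \<ge> 1 \<Longrightarrow> f k = g k) \<Longrightarrow> poly_on_pos d g"
  unfolding poly_on_pos_def by metis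

lemma poly_on_pos_mono: "poly_on_pos d g \<Longrightarrow> d \<le> e \<Longrightarrow> poly_on_pos e g"
  unfolding poly_on_pos_def by (meson order.trans)

lemma poly_on_pos_const [simp]: "poly_on_pos d (\<lambda>k. c)"
  unfolding poly_on_pos_def by (intro exI[of _ "[:c:]"]) auto

lemma poly_on_pos_add:
  assumes "poly_on_pos d f" "poly_on_pos d g" shows "poly_on_pos d (\<lambda>k. f k + g k)"
proof -
  from assms obtain p q where "degree p \<le> d" "\<forall>k\<ge>1. poly p (of_nat k) = f k"
    "degree q \<le> d" "\<forall>k\<ge>1. poly q (of_nat k) = g k" unfolding poly_on_pos_def by blast
  then show ?thesis unfolding poly_on_pos_def by (intro exI[of _ "p + q"]) (auto intro: degree_add_le)
qed

lemma poly_on_pos_mult: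
  assumes "poly_on_pos d f" "poly_on_pos e g" shows "poly_on_pos (d + e) (\<lambda>k. f k * g k)"
proof -
  from assms obtain p q where "degree p \<le> d" "\<forall>k\<ge>1. poly p (of_nat k) = f k"
    "degree q \<le> e" "\<forall>k\<ge>1. poly q (of_nat k) = g k" unfolding poly_on_pos_def by blast
  then show ?thesis unfolding poly_on_pos_def
    by (intro exI[of _ "p * q"]) (auto intro: order.trans[OF degree_mult_le])
qed

lemma poly_on_pos_cmult: "poly_on_pos d f \<Longrightarrow> poly_on_pos d (\<lambda>k. c * f k)"
  using poly_on_pos_mult[of 0 "\<lambda>k. c" d f] by simp

lemma poly_on_pos_diff: "poly_on_pos d f \<Longrightarrow> poly_on_pos d g \<Longrightarrow> poly_on_pos d (\<lambda>k. f k - g k)"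
  using poly_on_pos_add[of d f "\<lambda>k. (-1) * g k"] poly_on_pos_cmult[of d g "-1"] by simp

lemma poly_on_pos_sum: "(\<And>i. i \<in> S \<Longrightarrow> poly_on_pos d (f i)) \<Longrightarrow> poly_on_pos d (\<lambda>k. \<Sum>i\<in>S. f i k)"
  by (induction S rule: infinite_finite_induct) (auto intro: poly_on_pos_add)

definition psums :: "nat \<Rightarrow> nat list \<Rightarrow> mpoly" where
  "psums k \<mu> = (\<Prod>a\<leftarrow>\<mu>. psum k a)"

lemma psums_simps [simp]: "psums k [] = 1" "psums k (a # \<mu>) = psum k a * psums k \<mu>"
  by (simp_all add: psums_def)

lemma psums_append: "psums k (\<mu> @ \<nu>) = psums k \<mu> * psums k \<nu>"
  by (simp add: psums_def)

lemma witt_psums: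
  "witt k r (psums k \<mu>) = (\<Sum>i<length \<mu>. of_nat (\<mu> ! i) * psums k (\<mu>[i := \<mu> ! i + r]))"
proof (induction \<mu>)
  case (Cons a \<mu>)
  show ?case unfolding psums_simps witt_mult Cons.IH witt_psum
    by (simp add: sum.lessThan_Suc_shift sum_distrib_left algebra_simps del: sum.lessThan_Suc)
qed simp

lemma L_even_mem:
  assumes "2 * s \<in> set \<mu>" "s \<ge> 1" shows "L k (psums k \<mu>) = 0"
proof -
  obtain xs ys where "\<mu> = xs @ 2 * s # ys" using assms(1) by (meson split_list)
  then have "psums k \<mu> = psum k (2 * s) * psums k (xs @ ys)" by (simp add: psums_append)
  then show ?thesis using L_even_psum[OF assms(2)] by simp
qed

lemma sum_list_update_add:
  "i < length \<mu> \<Longrightarrow> sum_list (\<mu>[i := \<mu> ! i + r]) = sum_list \<mu> + (r :: nat)"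
  by (simp add: sum_list_update elem_le_sum_list)

text \<open>For \<open>s = 0\<close> the vector field is the total Euler operator, so the loop
  equation merely counts degrees. The contributions \<open>2 k (2k - 1)\<close>,
  \<open>- 3 k (k - 1)\<close> and \<open>- 2 * sum_list \<mu>\<close> add up to the factor.\<close>

lemma L_psum_1:
  assumes "k \<ge> 1"
  shows "L k (psum k 1 * psums k \<mu>) = (of_nat k * (of_nat k + 1) - 2 * of_nat (sum_list \<mu>)) * L k (psums k \<mu>)"
proof -
  let ?f = "psums k \<mu>"
  have w: "L k (witt k 0 ?f) = of_nat (sum_list \<mu>) * L k ?f"
    unfolding witt_psums by (simp add: L_sum L_of_nat sum_list_sum_nth atLeast0LessThan sum_distrib_right)
  have "2 * (\<Sum>(i, j)\<in>lpairs k. hsum 0 (x j) (x i)) = (of_nat k * of_nat k - of_nat k :: mpoly)" for x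
    unfolding sum_lpairs_hsum by simp
  from this[of Var] this[of "\<lambda>i. Var i ^ 2"]
  have h: "(\<Sum>(i, j)\<in>lpairs k. hsum 0 (Var j) (Var i)) = (\<Sum>(i, j)\<in>lpairs k. hsum 0 (Var j ^ 2) (Var i ^ 2))"
     "2 * (\<Sum>(i, j)\<in>lpairs k. hsum 0 (Var j ^ 2) (Var i ^ 2)) = (of_nat k * of_nat k - of_nat k :: mpoly)"
    by (simp_all add: hsum_def)
  let ?y = "L k ((\<Sum>(i, j)\<in>lpairs k. hsum 0 (Var j ^ 2) (Var i ^ 2)) * ?f)"
  have y: "L k (2 * (\<Sum>(i, j)\<in>lpairs k. hsum 0 (Var j ^ 2) (Var i ^ 2)) * ?f) = 2 * ?y"
    using L_of_nat[of k 2] by (simp add: mult.assoc)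
  have y2: "2 * ?y = (of_nat k * of_nat k - of_nat k) * L k ?f"
    unfolding y[symmetric] h(2) by (simp add: left_diff_distrib L_diff L_of_nat mult.assoc)
  have p0: "L k (psum k 0 * ?f) = of_nat k * L k ?f" by (simp add: psum_0 L_of_nat)
  have "L k (psum k 1 * ?f) / 2 = (2 * of_nat k - 1) * (of_nat k * L k ?f) - of_nat (sum_list \<mu>) * L k ?f - ?y - 2 * ?y"
    using loop_equation[OF assms, of 0 ?f] unfolding mult_0_right w h(1) y p0 by simp
  then have "L k (psum k 1 * ?f) = 2 * (2 * of_nat k - 1) * (of_nat k * L k ?f) - 2 * of_nat (sum_list \<mu>) * L k ?f - 3 * (2 * ?y)"
    by (simp add: field_simps)
  then show ?thesis unfolding y2 by (simp add: algebra_simps)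
qed

text \<open>The summands \<open>p = 0\<close> and \<open>p = 2 * s\<close> of the quadratic term
  carry the factor \<open>psum k (2 * s)\<close> and drop out, together with the diagonal. The term
  coming from \<open>Delta k (\<lambda>i. Var i ^ 2)\<close> consists of products of even power sums
  and disappears entirely.\<close>

lemma L_odd_psum:
  assumes "k \<ge> 1" "s \<ge> 1"
  shows "L k (psum k (Suc (2 * s)) * psums k \<mu>) =
     - 2 * (\<Sum>i<length \<mu>. of_nat (\<mu> ! i) * L k (psums k (\<mu>[i := \<mu> ! i + 2 * s])))
     - (\<Sum>p\<in>{1..<2 * s}. L k (psums k (p # (2 * s - p) # \<mu>)))"
proof -
  let ?f = "psums k \<mu>"
  let ?h = "\<Sum>(i, j)\<in>lpairs k. hsum (2 * s) (Var j) (Var i)"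
  let ?g = "2 * (\<Sum>(i, j)\<in>lpairs k. hsum s (Var j ^ 2) (Var i ^ 2))"
  have ev: "L k (psum k (2 * s) * g) = 0" for g by (rule L_even_psum[OF assms(2)])
  have w: "L k (witt k (2 * s) ?f) = (\<Sum>i<length \<mu>. of_nat (\<mu> ! i) * L k (psums k (\<mu>[i := \<mu> ! i + 2 * s])))"
    unfolding witt_psums by (simp add: L_sum L_of_nat)
  have h: "2 * L k (?h * ?f) = (\<Sum>p\<in>{1..<2 * s}. L k (psums k (p # (2 * s - p) # \<mu>)))"
  proof -
    have "2 * L k (?h * ?f) = L k ((2 * ?h) * ?f)" using L_of_nat[of k 2] by (simp add: mult.assoc)
    also have "2 * ?h = (\<Sum>p<Suc (2 * s). psum k p * psum k (2 * s - p)) - of_nat (Suc (2 * s)) * psum k (2 * s)"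
      unfolding sum_lpairs_hsum psum_def ..
    also have "L k (\<dots> * ?f) = (\<Sum>p<Suc (2 * s). L k (psum k p * (psum k (2 * s - p) * ?f)))"
      by (simp only: left_diff_distrib L_diff mult.assoc L_of_nat ev sum_distrib_right L_sum) simp
    also have "\<dots> = (\<Sum>p\<in>{1..<2 * s}. L k (psum k p * (psum k (2 * s - p) * ?f)))"
    proof (rule sum.mono_neutral_right)
      show "\<forall>p\<in>{..<Suc (2 * s)} - {1..<2 * s}. L k (psum k p * (psum k (2 * s - p) * ?f)) = 0"
      proof
        fix p assume "p \<in> {..<Suc (2 * s)} - {1..<2 * s}"
        then have "p = 0 \<or> p = 2 * s" by auto
        then show "L k (psum k p * (psum k (2 * s - p) * ?f)) = 0"
          using ev by (auto simp: psum_0 L_of_nat)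
      qed
    qed auto
    finally show ?thesis by simp
  qed
  have g: "L k (?g * ?f) = 0"
  proof -
    have "?g = (\<Sum>p<Suc s. psum k (2 * p) * psum k (2 * (s - p))) - of_nat (Suc s) * psum k (2 * s)"
      unfolding sum_lpairs_hsum psum_def by (simp only: power_mult)
    then have "L k (?g * ?f) = (\<Sum>p<Suc s. L k (psum k (2 * p) * (psum k (2 * (s - p)) * ?f)))"
      by (simp only: left_diff_distrib L_diff mult.assoc L_of_nat ev sum_distrib_right L_sum) simp
    also have "\<dots> = 0"
    proof (rule sum.neutral, rule ballI)
      fix p
      show "L k (psum k (2 * p) * (psum k (2 * (s - p)) * ?f)) = 0"
        using ev L_even_psum[of p k] by (cases "p = 0") (auto simp: psum_0 L_of_nat)
    qed
    finally show ?thesis .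
  qed
  show ?thesis using loop_equation[OF assms(1), of s ?f] unfolding w g ev h[symmetric] by (simp add: field_simps)
qed

text \<open>Each rule strictly lowers \<open>sum_list \<mu>\<close>, the induction variable. Parts
  equal to \<open>0\<close> are excluded because \<open>psum k 0 = k\<close> would raise the degree
  in \<open>k\<close> while adding nothing to \<open>sum_list \<mu>\<close>.\<close>

lemma poly_on_pos_L_psums:
  "0 \<notin> set \<mu> \<Longrightarrow> poly_on_pos (2 * sum_list \<mu>) (\<lambda>k. norm_const k * L k (psums k \<mu>))"
proof (induction "sum_list \<mu>" arbitrary: \<mu> rule: less_induct)
  case less
  show ?case
  proof (cases "\<exists>a\<in>set \<mu>. even a")
    case True
    then obtain s where "2 * s \<in> set \<mu>" by (auto elim!: evenE)
    moreover from this less.prems have "s \<ge> 1" by (cases s) auto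
    ultimately show ?thesis by (simp add: L_even_mem)
  next
    case False
    show ?thesis
    proof (cases \<mu>)
      case Nil
      then show ?thesis by (simp add: norm_const_mult_L_1)
    next
      case (Cons a \<nu>)
      from False Cons obtain s where a: "a = Suc (2 * s)" by (auto elim!: oddE)
      show ?thesis
      proof (cases "s = 0")
        case True
        have "poly_on_pos (2 * sum_list \<nu>) (\<lambda>k. norm_const k * L k (psums k \<nu>))"
          using less Cons a by auto
        moreover have "poly_on_pos 2 (\<lambda>k. of_nat k * (of_nat k + 1) - 2 * of_nat (sum_list \<nu>))"
          unfolding poly_on_pos_def
          by (intro exI[of _ "[:- 2 * of_nat (sum_list \<nu>), 1, 1:]"]) (auto simp: algebra_simps)
        ultimately have "poly_on_pos (2 + 2 * sum_list \<nu>)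
           (\<lambda>k. (of_nat k * (of_nat k + 1) - 2 * of_nat (sum_list \<nu>)) * (norm_const k * L k (psums k \<nu>)))"
          by (rule poly_on_pos_mult[rotated])
        moreover have "2 * sum_list \<mu> = 2 + 2 * sum_list \<nu>" using Cons a True by simp
        ultimately show ?thesis
          by (simp only:, elim poly_on_pos_cong) (use L_psum_1[of _ \<nu>] Cons a True in simp)
      next
        case False
        let ?d = "2 * (sum_list \<nu> + 2 * s)"
        have 1: "poly_on_pos ?d (\<lambda>k. norm_const k * L k (psums k (\<nu>[i := \<nu> ! i + 2 * s])))" if "i < length \<nu>" for i
        proof -
          have "set (\<nu>[i := \<nu> ! i + 2 * s]) \<subseteq> insert (\<nu> ! i + 2 * s) (set \<nu>)" by (rule set_update_subset_insert)
          then have "0 \<notin> set (\<nu>[i := \<nu> ! i + 2 * s])" using less.prems Cons False by auto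
          moreover have "sum_list (\<nu>[i := \<nu> ! i + 2 * s]) = sum_list \<nu> + 2 * s"
            by (rule sum_list_update_add[OF that])
          ultimately show ?thesis using less.hyps[of "\<nu>[i := \<nu> ! i + 2 * s]"] Cons a by simp
        qed
        have 2: "poly_on_pos ?d (\<lambda>k. norm_const k * L k (psums k (p # (2 * s - p) # \<nu>)))" if "p \<in> {1..<2 * s}" for p
          using less.hyps[of "p # (2 * s - p) # \<nu>"] less.prems that Cons a by (auto simp: add.commute)
        have "poly_on_pos ?d (\<lambda>k. -2 * (\<Sum>i<length \<nu>. of_nat (\<nu> ! i) * (norm_const k * L k (psums k (\<nu>[i := \<nu> ! i + 2 * s]))))
           - (\<Sum>p\<in>{1..<2 * s}. norm_const k * L k (psums k (p # (2 * s - p) # \<nu>))))"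
          by (intro poly_on_pos_diff poly_on_pos_cmult poly_on_pos_sum 1 2) auto
        then have "poly_on_pos ?d (\<lambda>k. norm_const k * L k (psums k \<mu>))"
        proof (rule poly_on_pos_cong)
          fix k :: nat assume k: "k \<ge> 1"
          have s: "s \<ge> 1" using False by simp
          show "-2 * (\<Sum>i<length \<nu>. of_nat (\<nu> ! i) * (norm_const k * L k (psums k (\<nu>[i := \<nu> ! i + 2 * s]))))
           - (\<Sum>p\<in>{1..<2 * s}. norm_const k * L k (psums k (p # (2 * s - p) # \<nu>))) = norm_const k * L k (psums k \<mu>)"
            unfolding Cons a psums_simps(2)[of k "Suc (2 * s)"] L_odd_psum[OF k s]
            by (simp only: right_diff_distrib sum_distrib_left mult.left_commute)
        qed
        then show ?thesis by (rule poly_on_pos_mono) (simp add: Cons a)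
      qed
    qed
  qed
qed

section \<open>Monomial symmetric functions\<close>

definition inj_lists :: "nat \<Rightarrow> nat \<Rightarrow> nat list set" where
  "inj_lists k l = {f. length f = l \<and> distinct f \<and> set f \<subseteq> {..<k}}"

lemma finite_inj_lists [simp]: "finite (inj_lists k l)"
  by (rule finite_subset[OF _ finite_lists_length_eq[of "{..<k}" l]]) (auto simp: inj_lists_def)

text \<open>The augmented monomial symmetric function: unlike the monomial one, it satisfies a
  Pieri-type rule without multiplicities.\<close>

definition aug_msym :: "nat list \<Rightarrow> nat \<Rightarrow> (nat \<Rightarrow> 'a::comm_semiring_1) \<Rightarrow> 'a" where
  "aug_msym l k z = (\<Sum>f\<in>inj_lists k (length l). \<Prod>i<length l. z (f ! i) ^ (l ! i))"

text \<open>The index \<open>j\<close> of the power sum either is new, and becomes the place of an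
  additional part \<open>a\<close>, or equals some \<open>f ! i\<close>, and then \<open>a\<close>
  is added to the part placed there.\<close>

lemma power_sum_mult_aug_msym:
  "(\<Sum>j<k. z j ^ a) * aug_msym l k z = aug_msym (a # l) k z + (\<Sum>i<length l. aug_msym (l[i := l ! i + a]) k z)"
proof -
  let ?mon = "\<lambda>f. \<Prod>i<length l. z (f ! i) ^ (l ! i)"
  let ?I = "inj_lists k (length l)"
  have "(\<Sum>j<k. z j ^ a) * aug_msym l k z = (\<Sum>f\<in>?I. \<Sum>j<k. z j ^ a * ?mon f)"
    unfolding aug_msym_def sum_product by (rule sum.swap)
  also have "\<dots> = (\<Sum>f\<in>?I. (\<Sum>j\<in>{..<k} - set f. z j ^ a * ?mon f) + (\<Sum>i<length l. z (f ! i) ^ a * ?mon f))"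
  proof (rule sum.cong[OF refl])
    fix f assume f: "f \<in> ?I"
    then have "(\<Sum>j<k. z j ^ a * ?mon f) = (\<Sum>j\<in>{..<k} - set f. z j ^ a * ?mon f) + (\<Sum>j\<in>set f. z j ^ a * ?mon f)"
      by (intro sum.subset_diff) (auto simp: inj_lists_def)
    also have "(\<Sum>j\<in>set f. z j ^ a * ?mon f) = (\<Sum>i<length l. z (f ! i) ^ a * ?mon f)"
      using f by (intro sum.reindex_bij_betw[symmetric] bij_betw_nth) (auto simp: inj_lists_def)
    finally show "(\<Sum>j<k. z j ^ a * ?mon f) = (\<Sum>j\<in>{..<k} - set f. z j ^ a * ?mon f) + (\<Sum>i<length l. z (f ! i) ^ a * ?mon f)" .
  qed
  also have "\<dots> = (\<Sum>f\<in>?I. \<Sum>j\<in>{..<k} - set f. z j ^ a * ?mon f) + (\<Sum>i<length l. \<Sum>f\<in>?I. z (f ! i) ^ a * ?mon f)"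
    unfolding sum.distrib by (subst (2) sum.swap) simp
  also have "(\<Sum>i<length l. \<Sum>f\<in>?I. z (f ! i) ^ a * ?mon f) = (\<Sum>i<length l. aug_msym (l[i := l ! i + a]) k z)"
    unfolding aug_msym_def length_list_update
  proof (intro sum.cong refl)
    fix i f assume i: "i \<in> {..<length l}"
    have "(\<Prod>j<length l. z (f ! j) ^ (l[i := l ! i + a] ! j)) = (\<Prod>j<length l. (if j = i then z (f ! i) ^ a else 1) * z (f ! j) ^ (l ! j))"
      by (intro prod.cong) (auto simp: power_add nth_list_update mult.commute)
    also have "\<dots> = z (f ! i) ^ a * ?mon f" using i unfolding prod.distrib by simp
    finally show "z (f ! i) ^ a * ?mon f = (\<Prod>j<length l. z (f ! j) ^ (l[i := l ! i + a] ! j))" ..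
  qed
  \<comment> \<open>An index outside \<open>f\<close> is put in front as the place of the new
    part.\<close>
  also have "(\<Sum>f\<in>?I. \<Sum>j\<in>{..<k} - set f. z j ^ a * ?mon f) = aug_msym (a # l) k z"
    unfolding aug_msym_def
    by (subst sum.Sigma, simp, simp, rule sum.reindex_bij_witness[where i = "\<lambda>g. (tl g, hd g)" and j = "\<lambda>(f, j). j # f"])
       (auto simp: inj_lists_def length_Suc_conv prod.lessThan_Suc_shift simp del: prod.lessThan_Suc)
  finally show ?thesis .
qed

text \<open>The product rule is solved for the longest function, which shortens \<open>l\<close> at
  the price of one more power sum. The factor \<open>psums k \<mu>\<close> collects these, so that
  the induction on the length closes.\<close>

lemma poly_on_pos_L_aug_msym:
  "0 \<notin> set l \<Longrightarrow> 0 \<notin> set \<mu> \<Longrightarrow>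
   poly_on_pos (2 * (sum_list \<mu> + sum_list l)) (\<lambda>k. norm_const k * L k (psums k \<mu> * aug_msym l k Var))"
proof (induction "length l" arbitrary: l \<mu>)
  case 0
  moreover have "inj_lists k 0 = {[]}" for k by (auto simp: inj_lists_def)
  ultimately have "aug_msym l k Var = 1" for k by (simp add: aug_msym_def)
  with 0 show ?case by (simp add: poly_on_pos_L_psums)
next
  case (Suc n)
  then obtain a m where l: "l = a # m" by (cases l) auto
  have 1: "poly_on_pos (2 * (sum_list \<mu> + sum_list l)) (\<lambda>k. norm_const k * L k (psums k (a # \<mu>) * aug_msym m k Var))"
    using Suc.hyps(1)[of m "a # \<mu>"] Suc.hyps(2) Suc.prems l by (auto simp: algebra_simps)
  have 2: "poly_on_pos (2 * (sum_list \<mu> + sum_list l)) (\<lambda>k. norm_const k * L k (psums k \<mu> * aug_msym (m[i := m ! i + a]) k Var))"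
    if "i < length m" for i
  proof -
    have "set (m[i := m ! i + a]) \<subseteq> insert (m ! i + a) (set m)" by (rule set_update_subset_insert)
    then have "0 \<notin> set (m[i := m ! i + a])" using Suc.prems l by auto
    moreover have "sum_list (m[i := m ! i + a]) = sum_list m + a" by (rule sum_list_update_add[OF that])
    ultimately show ?thesis using Suc.hyps(1)[of "m[i := m ! i + a]" \<mu>] Suc.hyps(2) Suc.prems l
      by (simp add: algebra_simps)
  qed
  have "poly_on_pos (2 * (sum_list \<mu> + sum_list l)) (\<lambda>k. norm_const k * L k (psums k (a # \<mu>) * aug_msym m k Var)
       - (\<Sum>i<length m. norm_const k * L k (psums k \<mu> * aug_msym (m[i := m ! i + a]) k Var)))"
    by (intro poly_on_pos_diff poly_on_pos_sum 1 2) auto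
  then show ?case
  proof (rule poly_on_pos_cong)
    fix k
    have "aug_msym l k Var = psum k a * aug_msym m k Var - (\<Sum>i<length m. aug_msym (m[i := m ! i + a]) k Var)"
      unfolding l psum_def power_sum_mult_aug_msym by simp
    then show "norm_const k * L k (psums k (a # \<mu>) * aug_msym m k Var)
       - (\<Sum>i<length m. norm_const k * L k (psums k \<mu> * aug_msym (m[i := m ! i + a]) k Var)) = norm_const k * L k (psums k \<mu> * aug_msym l k Var)"
      by (simp add: right_diff_distrib L_diff sum_distrib_left L_sum mult_ac)
  qed
qed

section \<open>From augmented to ordinary monomial symmetric functions\<close>

definition padded_perms :: "nat list \<Rightarrow> nat \<Rightarrow> nat list set" where
  "padded_perms l k = {\<alpha>. length \<alpha> = k \<and> mset \<alpha> = mset (l @ replicate (k - length l) 0)}"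

lemma msym_altdef: "msym l k z = (\<Sum>\<alpha>\<in>padded_perms l k. \<Prod>i<k. z i ^ (\<alpha> ! i))"
  by (simp add: msym_def padded_perms_def)

lemma finite_padded_perms [simp]: "finite (padded_perms l k)"
proof -
  have "padded_perms l k \<subseteq> {\<alpha>. mset \<alpha> = mset (l @ replicate (k - length l) 0)}"
    by (auto simp: padded_perms_def)
  then show ?thesis by (rule finite_subset) (rule mset_eq_finite)
qed

lemma padded_perms_length: assumes "\<alpha> \<in> padded_perms l k" shows "length l \<le> k"
proof -
  have k: "length \<alpha> = k" and e: "mset \<alpha> = mset (l @ replicate (k - length l) 0)"
    using assms unfolding padded_perms_def mem_Collect_eq by (rule conjunct1, rule conjunct2)
  have "length \<alpha> = length l + (k - length l)" using arg_cong[OF e, of size] by simp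
  then show ?thesis using k by linarith
qed

lemma mset_split_positions:
  assumes "distinct f" "set f \<subseteq> {..<length \<alpha>}"
  shows "mset \<alpha> = mset (map ((!) \<alpha>) f) + image_mset ((!) \<alpha>) (mset_set ({..<length \<alpha>} - set f))"
proof -
  have "mset \<alpha> = mset (map ((!) \<alpha>) [0..<length \<alpha>])" by (simp only: map_nth)
  also have "\<dots> = image_mset ((!) \<alpha>) (mset_set {..<length \<alpha>})"
    by (simp only: mset_map mset_upt atLeast0LessThan)
  also have "mset_set {..<length \<alpha>} = mset_set (set f) + mset_set ({..<length \<alpha>} - set f)"
    using assms by (subst mset_set_Union[symmetric]) (auto simp: Un_absorb1)
  finally show ?thesis using assms by (simp add: mset_set_set)
qed

text \<open>The positions listed in \<open>f\<close> already use up all parts of \<open>l\<close>,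
  so only padding is left elsewhere.\<close>

lemma padded_perm_zero:
  assumes "\<alpha> \<in> padded_perms l k" "f \<in> inj_lists k (length l)" "map ((!) \<alpha>) f = l" "j < k" "j \<notin> set f"
  shows "\<alpha> ! j = 0"
proof -
  have "image_mset ((!) \<alpha>) (mset_set ({..<k} - set f)) = replicate_mset (k - length l) 0"
    using mset_split_positions[of f \<alpha>] assms by (auto simp: padded_perms_def inj_lists_def)
  moreover have "\<alpha> ! j \<in># image_mset ((!) \<alpha>) (mset_set ({..<k} - set f))" using assms by auto
  ultimately show ?thesis by (auto split: if_splits)
qed

lemma padded_perm_monomial:
  assumes "\<alpha> \<in> padded_perms l k" "f \<in> inj_lists k (length l)" "map ((!) \<alpha>) f = l"
  shows "(\<Prod>i<length l. z (f ! i) ^ (l ! i)) = (\<Prod>i<k. z i ^ (\<alpha> ! i) :: 'a::comm_semiring_1)"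
proof -
  have "(\<Prod>i<length l. z (f ! i) ^ (l ! i)) = (\<Prod>i<length l. z (f ! i) ^ (\<alpha> ! (f ! i)))"
  proof (intro prod.cong refl arg_cong2[of _ _ _ _ "(^)"])
    fix i assume "i \<in> {..<length l}"
    then have "map ((!) \<alpha>) f ! i = \<alpha> ! (f ! i)" using assms(2) by (intro nth_map) (simp add: inj_lists_def)
    then show "l ! i = \<alpha> ! (f ! i)" using assms(3) by simp
  qed
  also have "\<dots> = (\<Prod>j\<in>set f. z j ^ (\<alpha> ! j))"
    using assms(2) by (intro prod.reindex_bij_betw bij_betw_nth) (auto simp: inj_lists_def)
  also have "\<dots> = (\<Prod>i<k. z i ^ (\<alpha> ! i))"
    using assms padded_perm_zero[OF assms] by (intro prod.mono_neutral_left) (auto simp: inj_lists_def)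
  finally show ?thesis .
qed

text \<open>The entry at \<open>f ! i\<close> has to be \<open>l ! i\<close>, and all other entries
  are padding; \<open>map_of\<close> builds exactly this vector.\<close>

lemma ex1_padded_perm:
  assumes "f \<in> inj_lists k (length l)"
  shows "\<exists>!\<alpha>. \<alpha> \<in> padded_perms l k \<and> map ((!) \<alpha>) f = l"
proof -
  define g where "g j = (case map_of (zip f l) j of None \<Rightarrow> 0 | Some v \<Rightarrow> v)" for j
  define \<alpha> where "\<alpha> = map g [0..<k]"
  from assms have f: "length f = length l" "distinct f" "set f \<subseteq> {..<k}" by (auto simp: inj_lists_def)
  have nth: "\<alpha> ! j = g j" if "j < k" for j using that by (simp add: \<alpha>_def)
  have len: "length \<alpha> = k" by (simp add: \<alpha>_def)
  have m: "map ((!) \<alpha>) f = l"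
  proof (rule nth_equalityI)
    fix i assume "i < length (map ((!) \<alpha>) f)"
    then have i: "i < length f" by simp
    then have "f ! i < k" using f(3) nth_mem[OF i] by blast
    moreover have "map_of (zip f l) (f ! i) = Some (l ! i)" by (rule map_of_zip_nth) (use f i in auto)
    ultimately show "map ((!) \<alpha>) f ! i = l ! i" using i by (simp add: nth g_def)
  qed (use f in simp)
  have z: "\<alpha> ! j = 0" if "j < k" "j \<notin> set f" for j
  proof -
    have "map_of (zip f l) j = None" using that f by (simp add: map_of_zip_is_None)
    then show ?thesis using that by (simp add: nth g_def)
  qed
  have "card ({..<k} - set f) = k - length l" using f by (simp add: card_Diff_subset distinct_card)
  moreover have "image_mset ((!) \<alpha>) (mset_set ({..<k} - set f)) = image_mset (\<lambda>_. 0) (mset_set ({..<k} - set f))"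
    using z by (intro image_mset_cong) auto
  moreover have "mset \<alpha> = mset l + image_mset ((!) \<alpha>) (mset_set ({..<k} - set f))"
    using mset_split_positions[of f \<alpha>] f m len by simp
  ultimately have "mset \<alpha> = mset l + replicate_mset (k - length l) 0"
    by (simp add: image_mset_const_eq)
  then have \<alpha>: "\<alpha> \<in> padded_perms l k" using len by (simp add: padded_perms_def)
  show ?thesis
  proof (rule ex1I[of _ \<alpha>])
    show "\<alpha> \<in> padded_perms l k \<and> map ((!) \<alpha>) f = l" using \<alpha> m by blast
    fix \<beta> assume b: "\<beta> \<in> padded_perms l k \<and> map ((!) \<beta>) f = l"
    show "\<beta> = \<alpha>"
    proof (rule nth_equalityI)
      show "length \<beta> = length \<alpha>" using b len by (simp add: padded_perms_def)
      fix j assume "j < length \<beta>"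
      then have j: "j < k" using b by (simp add: padded_perms_def)
      show "\<beta> ! j = \<alpha> ! j"
      proof (cases "j \<in> set f")
        case True
        have "map ((!) \<beta>) f = map ((!) \<alpha>) f" by (rule trans[OF conjunct2[OF b] m[symmetric]])
        then show ?thesis using True unfolding map_eq_conv by (rule bspec)
      next
        case False
        then show ?thesis using padded_perm_zero[OF conjunct1[OF b] assms conjunct2[OF b] j] z[OF j] by simp
      qed
    qed
  qed
qed

text \<open>The order of the stabiliser of \<open>l\<close> under permutations of positions, that
  is, the product of the factorials of the multiplicities. Permutations are written as lists to
  match \<open>inj_lists\<close>.\<close>

definition aut_count :: "nat list \<Rightarrow> nat" where
  "aut_count l = card {q. distinct q \<and> set q = {..<length l} \<and> map ((!) l) q = l}"

lemma aut_count_pos: "aut_count l > 0"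
proof -
  have "{q. distinct q \<and> set q = {..<length l} \<and> map ((!) l) q = l} \<subseteq> {q. set q \<subseteq> {..<length l} \<and> length q = length l}"
  proof (rule subsetI, unfold mem_Collect_eq, elim conjE, intro conjI)
    fix q assume q: "distinct q" "set q = {..<length l}"
    show "set q \<subseteq> {..<length l}" unfolding q(2) ..
    show "length q = length l" unfolding distinct_card[OF q(1), symmetric] q(2) by simp
  qed
  then have "finite {q. distinct q \<and> set q = {..<length l} \<and> map ((!) l) q = l}"
    by (rule finite_subset) (simp add: finite_lists_length_eq)
  moreover have "[0..<length l] \<in> {q. distinct q \<and> set q = {..<length l} \<and> map ((!) l) q = l}"
    by (auto simp: map_nth)
  ultimately show ?thesis unfolding aut_count_def card_gt_0_iff by blast
qed

text \<open>Since no part is zero, every placement of \<open>l\<close> in \<open>\<alpha>\<close>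
  covers exactly the support of \<open>\<alpha>\<close>. Two placements therefore differ by a
  permutation of positions that fixes \<open>l\<close>.\<close>

lemma card_position_lists:
  assumes \<alpha>: "\<alpha> \<in> padded_perms l k" and l: "0 \<notin> set l"
  shows "card {f \<in> inj_lists k (length l). map ((!) \<alpha>) f = l} = aut_count l"
proof -
  let ?S = "{f \<in> inj_lists k (length l). map ((!) \<alpha>) f = l}"
  have set_eq: "set f = {j. j < k \<and> \<alpha> ! j > 0}" if "f \<in> ?S" for f
  proof -
    have "\<alpha> ! j > 0" if "j \<in> set f" for j
    proof -
      have eq: "map ((!) \<alpha>) f = l" using \<open>f \<in> ?S\<close> by simp
      have "\<alpha> ! j \<in> set (map ((!) \<alpha>) f)" using that by simp
      then show ?thesis unfolding eq using l by (metis gr0I)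
    qed
    moreover have "j \<in> set f" if "j < k" "\<alpha> ! j > 0" for j
      using that \<open>f \<in> ?S\<close> padded_perm_zero[OF \<alpha>, of f j] by fastforce
    moreover have "set f \<subseteq> {..<k}" using \<open>f \<in> ?S\<close> by (simp add: inj_lists_def)
    ultimately show ?thesis by blast
  qed
  have lk: "length l \<le> k" using padded_perms_length[OF \<alpha>] .
  have len: "length \<alpha> = k" using \<alpha> by (simp add: padded_perms_def)
  have "mset (l @ replicate (k - length l) 0) = mset \<alpha>" using \<alpha> by (simp add: padded_perms_def)
  \<comment> \<open>Rearranging \<open>\<alpha>\<close> into \<open>l\<close> followed by zeros
    yields one placement \<open>f0\<close>, with which all others are compared.\<close>
  then obtain p where p: "p permutes {..<length \<alpha>}" "permute_list p \<alpha> = l @ replicate (k - length l) 0"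
    by (rule mset_eq_permutation)
  define f0 where "f0 = map p [0..<length l]"
  have "inj p" using p(1) by (rule permutes_inj)
  have f0: "f0 \<in> inj_lists k (length l)"
    using permutes_in_image[OF p(1)] \<open>inj p\<close> lk len unfolding inj_lists_def f0_def
    by (auto simp: distinct_map inj_on_def)
  have m0: "\<alpha> ! (f0 ! i) = l ! i" if "i < length l" for i
  proof -
    have "permute_list p \<alpha> ! i = \<alpha> ! p i" using that lk len by (simp add: permute_list_def)
    then show ?thesis using that p(2) by (simp add: f0_def nth_append)
  qed
  have lf0: "length f0 = length l" "distinct f0" using f0 by (auto simp: inj_lists_def)
  have "map ((!) \<alpha>) f0 = l" by (rule nth_equalityI) (auto simp: lf0 m0)
  with f0 have f0S: "f0 \<in> ?S" by simp
  have bij: "bij_betw ((!) f0) {..<length l} (set f0)" using lf0 by (intro bij_betw_nth) auto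
  let ?T = "{q. distinct q \<and> set q = {..<length l} \<and> map ((!) l) q = l}"
  let ?g = "inv_into {..<length l} ((!) f0)"
  have "bij_betw (map ((!) f0)) ?T ?S"
  proof (rule bij_betw_byWitness[where f' = "map ?g"])
    show "\<forall>q\<in>?T. map ?g (map ((!) f0) q) = q"
      using bij by (auto simp: bij_betw_def intro!: map_idI)
    show "\<forall>f\<in>?S. map ((!) f0) (map ?g f) = f"
    proof
      fix f assume "f \<in> ?S"
      then have "set f = (!) f0 ` {..<length l}" using set_eq f0S bij by (simp add: bij_betw_def)
      then show "map ((!) f0) (map ?g f) = f" unfolding map_map by (intro map_idI) (simp add: f_inv_into_f)
    qed
    show "map ((!) f0) ` ?T \<subseteq> ?S"
    proof (clarify, intro conjI)
      fix q assume q: "distinct q" "set q = {..<length l}" "map ((!) l) q = l"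
      have inj: "inj_on ((!) f0) (set q)" and img: "(!) f0 ` set q = set f0"
        unfolding q(2) using bij by (simp_all only: bij_betw_def)
      have "length q = length l" unfolding distinct_card[OF q(1), symmetric] q(2) by simp
      moreover have "distinct (map ((!) f0) q)" unfolding distinct_map using q(1) inj by blast
      moreover have "set (map ((!) f0) q) \<subseteq> {..<k}" unfolding set_map img using f0 by (simp add: inj_lists_def)
      ultimately show "map ((!) f0) q \<in> inj_lists k (length l)" by (simp only: inj_lists_def mem_Collect_eq length_map)
      have "map ((!) \<alpha>) (map ((!) f0) q) = map ((!) l) q"
        unfolding map_map by (rule map_cong[OF refl]) (simp add: q(2) m0)
      then show "map ((!) \<alpha>) (map ((!) f0) q) = l" unfolding q(3) .
    qed
    show "map ?g ` ?S \<subseteq> ?T"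
    proof
      fix q assume "q \<in> map ?g ` ?S"
      then obtain f where f: "f \<in> ?S" "q = map ?g f" by blast
      have sf: "set f = set f0" using set_eq f(1) f0S by simp
      have bi: "bij_betw ?g (set f0) {..<length l}" using bij by (rule bij_betw_inv_into)
      have "distinct f" using f(1) by (simp add: inj_lists_def)
      then have "distinct q" unfolding f(2) distinct_map sf using bi by (simp add: bij_betw_def)
      moreover have "set q = {..<length l}" unfolding f(2) set_map sf using bi by (simp add: bij_betw_def)
      moreover have "map ((!) l) q = l"
      proof -
        have "map ((!) l) q = map ((!) \<alpha>) f"
          unfolding f(2) map_map
        proof (rule map_cong[OF refl])
          fix j assume j: "j \<in> set f"
          then have "?g j \<in> {..<length l}" "f0 ! ?g j = j"
            using bi bij sf by (auto simp: bij_betw_def intro!: f_inv_into_f)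
          then show "((!) l \<circ> ?g) j = \<alpha> ! j" using m0[of "?g j"] by simp
        qed
        also have "\<dots> = l" using f(1) by blast
        finally show ?thesis .
      qed
      ultimately show "q \<in> ?T" by blast
    qed
  qed
  from bij_betw_same_card[OF this] show ?thesis by (simp add: aut_count_def)
qed

text \<open>Pairs of a placement \<open>f\<close> and a rearrangement \<open>\<alpha>\<close>
  carrying \<open>l\<close> along \<open>f\<close> are counted twice: each \<open>f\<close> has one
  \<open>\<alpha>\<close>, each \<open>\<alpha>\<close> has \<open>aut_count l\<close>
  placements.\<close>

lemma aug_msym_eq:
  assumes "0 \<notin> set l" shows "aug_msym l k z = of_nat (aut_count l) * msym l k z"
proof -
  let ?I = "inj_lists k (length l)" let ?O = "padded_perms l k"
  let ?mon = "\<lambda>f. \<Prod>i<length l. z (f ! i) ^ (l ! i)"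
  have "aug_msym l k z = (\<Sum>f\<in>?I. \<Sum>\<alpha>\<in>{\<alpha>\<in>?O. map ((!) \<alpha>) f = l}. ?mon f)"
    unfolding aug_msym_def
  proof (rule sum.cong[OF refl])
    fix f assume "f \<in> ?I"
    from ex1_padded_perm[OF this] obtain \<alpha> where "{\<alpha>\<in>?O. map ((!) \<alpha>) f = l} = {\<alpha>}" by blast
    then show "?mon f = (\<Sum>\<alpha>\<in>{\<alpha>\<in>?O. map ((!) \<alpha>) f = l}. ?mon f)" by simp
  qed
  also have "\<dots> = (\<Sum>\<alpha>\<in>?O. \<Sum>f\<in>{f\<in>?I. map ((!) \<alpha>) f = l}. ?mon f)"
    by (rule sum.swap_restrict) auto
  also have "\<dots> = (\<Sum>\<alpha>\<in>?O. of_nat (aut_count l) * (\<Prod>i<k. z i ^ (\<alpha> ! i)))"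
  proof (rule sum.cong[OF refl])
    fix \<alpha> assume \<alpha>: "\<alpha> \<in> ?O"
    have "(\<Sum>f\<in>{f\<in>?I. map ((!) \<alpha>) f = l}. ?mon f) = (\<Sum>f\<in>{f\<in>?I. map ((!) \<alpha>) f = l}. (\<Prod>i<k. z i ^ (\<alpha> ! i)))"
    proof (rule sum.cong[OF refl])
      fix f assume "f \<in> {f\<in>?I. map ((!) \<alpha>) f = l}"
      then show "?mon f = (\<Prod>i<k. z i ^ (\<alpha> ! i))" by (intro padded_perm_monomial[OF \<alpha>]) auto
    qed
    then show "(\<Sum>f\<in>{f\<in>?I. map ((!) \<alpha>) f = l}. ?mon f) = of_nat (aut_count l) * (\<Prod>i<k. z i ^ (\<alpha> ! i))"
      by (simp add: card_position_lists[OF \<alpha> assms])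
  qed
  finally show ?thesis by (simp add: msym_altdef sum_distrib_left)
qed

section \<open>Degree count and the number \<open>N\<close> as a value of the functional
  \<open>L\<close>\<close>

lemma homogeneous_msym: "homogeneous (sum_list l) (msym l k Var)"
  unfolding msym_altdef
proof (rule homogeneous_sum)
  fix \<alpha> assume "\<alpha> \<in> padded_perms l k"
  then have \<alpha>: "length \<alpha> = k" "mset \<alpha> = mset (l @ replicate (k - length l) 0)" by (auto simp: padded_perms_def)
  have "(\<Sum>i<k. \<alpha> ! i) = sum_list \<alpha>" using \<alpha> by (simp add: sum_list_sum_nth atLeast0LessThan)
  also have "\<dots> = sum_list l" using arg_cong[OF \<alpha>(2), of sum_mset] by (simp add: sum_mset_sum_list)
  finally show "homogeneous (sum_list l) (\<Prod>i<k. Var i ^ (\<alpha> ! i))"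
    using homogeneous_prod[of "{..<k}" "\<lambda>i. \<alpha> ! i * 1" "\<lambda>i. Var i ^ (\<alpha> ! i)"] homogeneous_power[OF homogeneous_Var] by simp
qed

lemma homogeneous_Deltas:
  "homogeneous (3 * (k * (k - 1) div 2)) (Delta k Var * Delta k (\<lambda>i. Var i ^ 2))"
proof -
  have "homogeneous (\<Sum>p\<in>lpairs k. 1) (Delta k Var)" "homogeneous (\<Sum>p\<in>lpairs k. 2 * 1) (Delta k (\<lambda>i. Var i ^ 2))"
    unfolding Delta_def case_prod_unfold
    by (intro homogeneous_prod homogeneous_diff homogeneous_power homogeneous_Var)+
  from homogeneous_mult[OF this] show ?thesis by (simp add: card_lpairs)
qed

text \<open>The two \<open>Delta\<close> factors have degree \<open>3 k (k - 1) / 2\<close>, and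
  \<open>k (2k - 1) - 3 k (k - 1) / 2 = k (k + 1) / 2\<close> is what remains for
  \<open>msym\<close> and the linear form.\<close>

lemma lookup_msym_Deltas_power:
  assumes "sum_list l + n \<noteq> k * (k + 1) div 2"
  shows "lookup (msym l k Var * (Delta k Var * Delta k (\<lambda>i. Var i ^ 2)) * (Const c * (\<Sum>i<k. Var i) ^ n)) (top_exp k) = 0"
proof -
  have "homogeneous (sum_list l + 3 * (k * (k - 1) div 2) + (0 + n * 1))
    (msym l k Var * (Delta k Var * Delta k (\<lambda>i. Var i ^ 2)) * (Const c * (\<Sum>i<k. Var i) ^ n))"
    by (intro homogeneous_mult homogeneous_msym homogeneous_Deltas homogeneous_Const homogeneous_power homogeneous_sum homogeneous_Var)
  moreover have "sum_list l + 3 * (k * (k - 1) div 2) + (0 + n * 1) \<noteq> total_degree (top_exp k)"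
  proof -
    have "k * (k + 1) div 2 + 3 * (k * (k - 1) div 2) = k * (2 * k - 1)"
    proof (cases k)
      case (Suc m)
      have "even (m * Suc m)" by simp
      then obtain c where "m * Suc m = 2 * c" by (elim evenE)
      then show ?thesis using Suc by (simp add: algebra_simps)
    qed simp
    then show ?thesis using assms by (simp add: total_degree_top_exp)
  qed
  ultimately show ?thesis unfolding homogeneous_def by metis
qed

text \<open>By degree, at most one power of the linear form contributes, so the single power in
  \<open>N\<close> may be replaced by the exponential. The case distinction of \<open>N\<close>
  disappears as well: for large \<open>sum_list l\<close> no power contributes.\<close>

lemma N_eq_L: "N l k = norm_const k * L k (msym l k Var)"
proof -
  let ?K = "k * (k + 1) div 2" let ?B = "k * (2 * k - 1)"
  let ?t = "\<lambda>n. lookup (msym l k Var * (Delta k Var * Delta k (\<lambda>i. Var i ^ 2)) * (Const (1 / (2 ^ n * fact n)) * (\<Sum>i<k. Var i) ^ n)) (top_exp k)"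
  have "L k (msym l k Var) = (\<Sum>n\<le>?B. ?t n)"
    unfolding L_def weight_def trunc_exp_def by (simp add: sum_distrib_left lookup_sum mult.assoc)
  also have "\<dots> = (if sum_list l > ?K then 0 else ?t (?K - sum_list l))"
  proof (cases "sum_list l > ?K")
    case True
    then show ?thesis by (auto intro!: sum.neutral lookup_msym_Deltas_power)
  next
    case False
    \<comment> \<open>The contributing power lies below the truncation.\<close>
    have "?K \<le> ?B" by (cases k) auto
    have "(\<Sum>n\<le>?B. ?t n) = (\<Sum>n\<in>{?K - sum_list l}. ?t n)"
      using False \<open>?K \<le> ?B\<close> by (intro sum.mono_neutral_right) (auto intro!: lookup_msym_Deltas_power)
    then show ?thesis using False by simp
  qed
  finally show ?thesis unfolding N_def norm_const_def Let_def top_exp_def by (auto simp: mult.assoc)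
qed

text \<open>Dividing by \<open>aut_count l\<close> preserves polynomiality because it does not
  involve \<open>k\<close>.\<close>

lemma poly_on_pos_N:
  assumes "is_partition l" shows "poly_on_pos (2 * sum_list l) (N l)"
proof -
  have l: "0 \<notin> set l" using assms by (auto simp: is_partition_def)
  have "poly_on_pos (2 * sum_list l) (\<lambda>k. (1 / of_nat (aut_count l)) * (norm_const k * L k (aug_msym l k Var)))"
    using poly_on_pos_L_aug_msym[OF l, of "[]"] by (intro poly_on_pos_cmult) simp
  then show ?thesis
    by (rule poly_on_pos_cong) (use aut_count_pos[of l] in \<open>simp add: N_eq_L aug_msym_eq[OF l] L_of_nat\<close>)
qed

lemma padded_perms_Nil: "padded_perms [] k = {replicate k 0}"
proof -
  have "\<alpha> = replicate k 0" if "\<alpha> \<in> padded_perms [] k" for \<alpha>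
  proof (rule replicate_eqI)
    show "length \<alpha> = k" using that by (simp add: padded_perms_def)
    fix x assume "x \<in> set \<alpha>"
    then have "x \<in># mset \<alpha>" by simp
    also have "mset \<alpha> = replicate_mset k 0" using that by (simp add: padded_perms_def)
    finally show "x = 0" by (simp split: if_splits)
  qed
  then show ?thesis by (auto simp: padded_perms_def)
qed

lemma N_Nil: "N [] k = 1"
proof -
  have "msym [] k Var = 1" by (simp add: msym_altdef padded_perms_Nil)
  then show ?thesis by (simp add: N_eq_L norm_const_mult_L_1)
qed

section \<open>The zeta function near its pole\<close>

text \<open>With \<open>m = Suc n\<close> this is \<open>(s - 1)\<close> times the integral of
  \<open>m^(-s) - t^(-s)\<close> over \<open>t\<close> from \<open>m\<close> to
  \<open>m + 1\<close>. It compares the Dirichlet series with its integral.\<close>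

definition eta_term :: "nat \<Rightarrow> complex \<Rightarrow> complex" where
  "eta_term n s = (s - 1) * of_nat (Suc n) powr (- s) + of_nat (Suc (Suc n)) powr (1 - s) - of_nat (Suc n) powr (1 - s)"

lemma norm_powr_of_real: "x > 0 \<Longrightarrow> norm (complex_of_real x powr s) = x powr Re s"
  by (subst norm_powr_real_powr) auto

lemma norm_powr_diff_le:
  fixes s :: complex and x y :: real
  assumes "0 < x" "x \<le> y" "y \<le> x + 1" "Re s > 0"
  shows "norm (of_real y powr (- s) - of_real x powr (- s)) \<le> norm s * x powr (- Re s - 1)"
proof -
  let ?S = "of_real ` {x..y} :: complex set"
  have "norm (of_real y powr (- s) - of_real x powr (- s)) \<le> norm s * x powr (- Re s - 1) * norm (of_real y - of_real x :: complex)"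
  proof (rule field_differentiable_bound[where S = ?S and f' = "\<lambda>z. - s * z powr (- s - 1)"])
    show "convex ?S" by (intro convex_linear_image) (auto simp: bounded_linear_of_real bounded_linear.linear)
    fix z assume "z \<in> ?S"
    then obtain u where u: "z = of_real u" "x \<le> u" "u \<le> y" by auto
    have "z \<notin> \<real>\<^sub>\<le>\<^sub>0" using u assms by (auto simp: complex_nonpos_Reals_iff)
    then show "((\<lambda>z. z powr (- s)) has_field_derivative - s * z powr (- s - 1)) (at z within ?S)"
      by (intro has_field_derivative_at_within[OF has_field_derivative_powr])
    have "u powr (- Re s - 1) \<le> x powr (- Re s - 1)"
      using u assms by (intro powr_mono2') auto
    then show "norm (- s * z powr (- s - 1)) \<le> norm s * x powr (- Re s - 1)"
      using u assms by (simp add: norm_mult norm_powr_of_real mult_left_mono)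
  qed (use assms in auto)
  also have "norm (of_real y - of_real x :: complex) = y - x"
    using assms unfolding of_real_diff[symmetric] norm_of_real by simp
  also have "norm s * x powr (- Re s - 1) * (y - x) \<le> norm s * x powr (- Re s - 1)"
    using assms by (intro mult_left_le) auto
  finally show ?thesis .
qed

text \<open>The integrand \<open>m^(-s) - t^(-s)\<close> is itself a difference, so two applications
  of the mean value bound gain one power of \<open>m\<close>. This is what extends convergence from
  \<open>Re s > 1\<close> to \<open>Re s > 0\<close>.\<close>

lemma norm_eta_term_le:
  assumes "Re s > 0"
  shows "norm (eta_term n s) \<le> norm (s - 1) * norm s * real (Suc n) powr (- Re s - 1)"
proof -
  let ?m = "real (Suc n)"
  let ?S = "of_real ` {?m..?m + 1} :: complex set"
  \<comment> \<open>A primitive of \<open>(s - 1) * (m^(-s) - z^(-s))\<close>; its increment from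
    \<open>m\<close> to \<open>m + 1\<close> is \<open>eta_term n s\<close>.\<close>
  let ?f = "\<lambda>z. (s - 1) * z * of_real ?m powr (- s) + z powr (1 - s)"
  have "norm (?f (of_real (?m + 1)) - ?f (of_real ?m)) \<le> (norm (s - 1) * (norm s * ?m powr (- Re s - 1))) * norm (of_real (?m + 1) - of_real ?m :: complex)"
  proof (rule field_differentiable_bound[where S = ?S and f' = "\<lambda>z. (s - 1) * of_real ?m powr (- s) + (1 - s) * z powr (1 - s - 1)"])
    show "convex ?S" by (intro convex_linear_image) (auto simp: bounded_linear_of_real bounded_linear.linear)
    fix z assume "z \<in> ?S"
    then obtain u where u: "z = of_real u" "?m \<le> u" "u \<le> ?m + 1" by auto
    have "z \<notin> \<real>\<^sub>\<le>\<^sub>0" using u by (auto simp: complex_nonpos_Reals_iff)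
    then show "(?f has_field_derivative (s - 1) * of_real ?m powr (- s) + (1 - s) * z powr (1 - s - 1)) (at z within ?S)"
      by (auto intro!: derivative_eq_intros has_field_derivative_at_within[OF has_field_derivative_powr])
    have "(s - 1) * of_real ?m powr (- s) + (1 - s) * z powr (1 - s - 1) = - (s - 1) * (of_real u powr (- s) - of_real ?m powr (- s))"
      using u by (simp add: algebra_simps)
    also have "norm \<dots> \<le> norm (s - 1) * (norm s * ?m powr (- Re s - 1))"
      unfolding norm_mult norm_minus_cancel using u assms
      by (intro mult_left_mono norm_powr_diff_le) auto
    finally show "norm ((s - 1) * of_real ?m powr (- s) + (1 - s) * z powr (1 - s - 1)) \<le> norm (s - 1) * (norm s * ?m powr (- Re s - 1))" .
  qed (rule imageI, simp)+
  also have "norm (of_real (?m + 1) - of_real ?m :: complex) = 1" by simp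
  also have "?f (of_real (?m + 1)) - ?f (of_real ?m) = eta_term n s"
    by (simp add: eta_term_def algebra_simps)
  finally show ?thesis by (simp add: mult.assoc)
qed

lemma summable_Suc_powr: "e > 0 \<Longrightarrow> summable (\<lambda>n. real (Suc n) powr (- e - 1))"
  by (subst summable_Suc_iff[where f = "\<lambda>n. real n powr (- e - 1)"]) (auto simp: summable_real_powr_iff)

lemma summable_eta_term: "Re s > 0 \<Longrightarrow> summable (\<lambda>n. eta_term n s)"
  by (rule summable_comparison_test'[OF summable_mult[OF summable_Suc_powr[of "Re s"]], of 0])
     (use norm_eta_term_le in auto)

text \<open>The continuation of \<open>(s - 1) * zeta s\<close>. The \<open>1\<close> compensates
  the telescoping part of the series, which for \<open>Re s > 1\<close> sums to
  \<open>- 1\<close>.\<close>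

definition zeta_numer :: "complex \<Rightarrow> complex" where
  "zeta_numer s = 1 + suminf (\<lambda>n. eta_term n s)"

lemma zeta_numer_1: "zeta_numer 1 = 1"
proof -
  have "eta_term n 1 = 0" for n by (simp add: eta_term_def del: of_nat_Suc)
  then show ?thesis by (simp add: zeta_numer_def)
qed

lemma eta_term_holomorphic: "eta_term n holomorphic_on S"
  unfolding eta_term_def by (intro holomorphic_intros)

lemma zeta_numer_holomorphic: "zeta_numer holomorphic_on {s. Re s > 0}"
proof (rule holomorphic_uniform_sequence[where f = "\<lambda>n s. 1 + (\<Sum>i<n. eta_term i s)"])
  show "open {s :: complex. Re s > 0}" by (simp add: open_halfspace_Re_gt)
  show "(\<lambda>s. 1 + (\<Sum>i<n. eta_term i s)) holomorphic_on {s. Re s > 0}" for n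
    by (intro holomorphic_intros eta_term_holomorphic)
  fix x :: complex assume "x \<in> {s. Re s > 0}"
  then have x: "Re x > 0" by simp
  \<comment> \<open>On the disc of radius \<open>?d\<close> real parts stay at least
    \<open>?d\<close>, so a single exponent dominates the series.\<close>
  let ?d = "Re x / 2" let ?M = "norm x + ?d"
  have re: "Re s \<ge> ?d" "norm s \<le> ?M" if "s \<in> cball x ?d" for s
  proof -
    have d: "norm (s - x) \<le> ?d" using that by (simp add: dist_norm norm_minus_commute)
    show "Re s \<ge> ?d" using abs_Re_le_cmod[of "s - x"] d by auto
    show "norm s \<le> ?M" using norm_triangle_sub[of s x] d by linarith
  qed
  have sub: "cball x ?d \<subseteq> {s. Re s > 0}" using re(1) x by fastforce
  have "uniform_limit (cball x ?d) (\<lambda>n s. \<Sum>i<n. eta_term i s) (\<lambda>s. suminf (\<lambda>n. eta_term n s)) sequentially"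
  proof (rule Weierstrass_m_test)
    show "summable (\<lambda>n. (?M + 1) * ?M * real (Suc n) powr (- ?d - 1))"
      using x by (intro summable_mult summable_Suc_powr) auto
    fix n s assume s: "s \<in> cball x ?d"
    then have "Re s > 0" using re x by fastforce
    then have "norm (eta_term n s) \<le> norm (s - 1) * norm s * real (Suc n) powr (- Re s - 1)"
      by (rule norm_eta_term_le)
    also have "\<dots> \<le> (?M + 1) * ?M * real (Suc n) powr (- ?d - 1)"
      using re[OF s] norm_triangle_ineq4[of s 1] x by (intro mult_mono powr_mono mult_nonneg_nonneg add_nonneg_nonneg) auto
    finally show "norm (eta_term n s) \<le> (?M + 1) * ?M * real (Suc n) powr (- ?d - 1)" .
  qed
  then have "uniform_limit (cball x ?d) (\<lambda>n s. 1 + (\<Sum>i<n. eta_term i s)) zeta_numer sequentially"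
    unfolding zeta_numer_def by (intro uniform_limit_intros)
  with sub show "\<exists>d>0. cball x d \<subseteq> {s. Re s > 0} \<and>
      uniform_limit (cball x d) (\<lambda>n s. 1 + (\<Sum>i<n. eta_term i s)) zeta_numer sequentially"
    using x by (intro exI[of _ ?d]) auto
qed

lemma zeta_numer_sums:
  assumes "Re s > 1"
  shows "(\<lambda>n. 1 / of_nat (Suc n) powr s) sums (zeta_numer s / (s - 1))"
proof -
  have s: "s - 1 \<noteq> 0" "Re s > 0" using assms by auto
  have "(\<lambda>n. of_nat (Suc n) powr (1 - s)) \<longlonglongrightarrow> (0 :: complex)"
  proof (rule tendsto_norm_zero_cancel)
    have "(\<lambda>n. real (Suc n) powr (1 - Re s)) \<longlonglongrightarrow> 0"
      using assms by (intro tendsto_neg_powr filterlim_compose[OF filterlim_real_sequentially filterlim_Suc]) auto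
    then show "(\<lambda>n. norm (of_nat (Suc n) powr (1 - s))) \<longlonglongrightarrow> 0"
      using norm_powr_of_real[of "real (Suc _)" "1 - s"] by simp
  qed
  from telescope_sums[OF this]
  have "(\<lambda>n. of_nat (Suc (Suc n)) powr (1 - s) - of_nat (Suc n) powr (1 - s)) sums (- 1)" by simp
  from sums_diff[OF summable_sums[OF summable_eta_term[OF s(2)]] this]
  have "(\<lambda>n. (s - 1) * of_nat (Suc n) powr (- s)) sums zeta_numer s"
    by (simp add: eta_term_def zeta_numer_def add.commute)
  from sums_divide[OF this, of "s - 1"] show ?thesis using s(1) unfolding nonzero_mult_div_cancel_left[OF s(1)] by (simp only: powr_minus_divide)
qed

text \<open>The explicit continuation shows that the description defining \<open>zeta\<close> can be
  met, and the identity theorem, applied from \<open>Re s > 1\<close>, pins down the function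
  chosen.\<close>

lemma zeta_eq:
  assumes "Re s > 0" "s \<noteq> 1" shows "zeta s = zeta_numer s / (s - 1)"
proof -
  let ?S = "{s. Re s > 0} - {1 :: complex}"
  have hol: "(\<lambda>s. zeta_numer s / (s - 1)) holomorphic_on ?S"
    by (intro holomorphic_intros holomorphic_on_subset[OF zeta_numer_holomorphic]) auto
  then have "\<exists>f. f holomorphic_on ?S \<and> (\<forall>s. Re s > 1 \<longrightarrow> (\<lambda>n. 1 / of_nat (Suc n) powr s) sums f s)"
    using zeta_numer_sums by blast
  from someI_ex[OF this] have z: "zeta holomorphic_on ?S" "\<And>s. Re s > 1 \<Longrightarrow> (\<lambda>n. 1 / of_nat (Suc n) powr s) sums zeta s"
    unfolding zeta_def by blast+
  show ?thesis
  proof (rule analytic_continuation_open[where s = "{s. Re s > 1}" and s' = ?S and f = zeta])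
    show "open {s :: complex. Re s > 1}" "open ?S" by (auto simp: open_halfspace_Re_gt intro!: open_delete)
    show "{s :: complex. Re s > 1} \<noteq> {}" by (auto intro!: exI[of _ 2])
    show "connected ?S"
      by (intro connected_open_delete convex_connected convex_halfspace_Re_gt open_halfspace_Re_gt) auto
    show "zeta z = zeta_numer z / (z - 1)" if "z \<in> {s. Re s > 1}" for z
      using z(2) zeta_numer_sums that sums_unique2 by blast
  qed (use assms z hol in auto)
qed

lemma zeta_reg_eq:
  assumes "norm w < 1" shows "zeta_reg w = zeta_numer (1 + w)"
proof -
  have "Re (1 + w) > 0" using abs_Re_le_cmod[of w] assms by auto
  then show ?thesis using zeta_eq[of "1 + w"] by (auto simp: zeta_reg_def zeta_numer_1)
qed

lemma zeta_reg_holomorphic: "zeta_reg holomorphic_on ball 0 1"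
proof -
  have "(\<lambda>w. zeta_numer (1 + w)) holomorphic_on ball 0 1"
  proof (intro holomorphic_on_compose_gen[OF _ zeta_numer_holomorphic, unfolded o_def] holomorphic_intros)
    have "Re w > 0" if "norm (1 - w) < 1" for w using abs_Re_le_cmod[of "1 - w"] that by auto
    then show "(+) 1 ` ball 0 1 \<subseteq> {s. Re s > 0}" by (auto simp: dist_norm)
  qed
  then show ?thesis by (rule holomorphic_transform) (simp add: zeta_reg_eq dist_norm)
qed

section \<open>The Euler product\<close>

text \<open>A first-order expansion whose constant depends on \<open>S\<close> alone, so that it
  serves all primes and all points at once.\<close>

lemma prod_one_minus_approx:
  assumes "finite S"
  shows "\<exists>C\<ge>0. \<forall>(x :: 'a \<Rightarrow> complex) \<epsilon>. 0 \<le> \<epsilon> \<and> \<epsilon> \<le> 1 \<and> (\<forall>s\<in>S. norm (x s) \<le> \<epsilon>) \<longrightarrow>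
     norm ((\<Prod>s\<in>S. 1 - x s) - 1 + (\<Sum>s\<in>S. x s)) \<le> C * \<epsilon> ^ 2"
  using assms
proof (induction S rule: finite_induct)
  case empty
  show ?case by (intro exI[of _ 0]) auto
next
  case (insert a S)
  then obtain C where C: "C \<ge> 0" "\<And>(x :: 'a \<Rightarrow> complex) \<epsilon>. 0 \<le> \<epsilon> \<Longrightarrow> \<epsilon> \<le> 1 \<Longrightarrow> (\<forall>s\<in>S. norm (x s) \<le> \<epsilon>) \<Longrightarrow>
     norm ((\<Prod>s\<in>S. 1 - x s) - 1 + (\<Sum>s\<in>S. x s)) \<le> C * \<epsilon> ^ 2" by blast
  show ?case
  proof (intro exI[of _ "2 * C + real (card S)"] conjI allI impI; (elim conjE)?)
    fix x :: "'a \<Rightarrow> complex" and \<epsilon> :: real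
    assume e: "0 \<le> \<epsilon>" "\<epsilon> \<le> 1" "\<forall>s\<in>insert a S. norm (x s) \<le> \<epsilon>"
    let ?P = "\<Prod>s\<in>S. 1 - x s" let ?s = "\<Sum>s\<in>S. x s"
    have 1: "norm (?P - 1 + ?s) \<le> C * \<epsilon> ^ 2" using C(2) e by auto
    have 2: "norm ?s \<le> real (card S) * \<epsilon>" using e by (intro sum_norm_bound) auto
    have "norm (?P - 1) \<le> norm (?P - 1 + ?s) + norm ?s" using norm_triangle_ineq4[of "?P - 1 + ?s" ?s] by simp
    also have "\<dots> \<le> C * \<epsilon> + real (card S) * \<epsilon>"
      using 1 2 C(1) e by (intro add_mono) (auto intro!: order.trans[OF 1] mult_left_mono simp: power2_eq_square mult_left_le)
    finally have 3: "norm (x a * (?P - 1)) \<le> \<epsilon> * (C * \<epsilon> + real (card S) * \<epsilon>)"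
      unfolding norm_mult using e by (intro mult_mono) auto
    have "(\<Prod>s\<in>insert a S. 1 - x s) - 1 + (\<Sum>s\<in>insert a S. x s) = (?P - 1 + ?s) - x a * (?P - 1)"
      using insert by (simp add: algebra_simps)
    also have "norm \<dots> \<le> C * \<epsilon> ^ 2 + \<epsilon> * (C * \<epsilon> + real (card S) * \<epsilon>)"
      by (rule order.trans[OF norm_triangle_ineq4 add_mono[OF 1 3]])
    also have "\<dots> = (2 * C + real (card S)) * \<epsilon> ^ 2" by (simp add: algebra_simps power2_eq_square)
    finally show "norm ((\<Prod>s\<in>insert a S. 1 - x s) - 1 + (\<Sum>s\<in>insert a S. x s)) \<le> (2 * C + real (card S)) * \<epsilon> ^ 2" .
  qed (use C in auto)
qed

lemma sum_lpairs_altdef: "(\<Sum>(i, j)\<in>lpairs k. f i j) = (\<Sum>j<k. \<Sum>i<j. f i j)"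
proof -
  have "(\<Sum>(i, j)\<in>lpairs k. f i j) = (\<Sum>(j, i)\<in>(SIGMA j:{..<k}. {..<j}). f i j)"
    by (rule sum.reindex_bij_witness[of _ prod.swap prod.swap]) auto
  then show ?thesis by (simp add: sum.Sigma)
qed

lemma norm_sum_lpairs_le:
  assumes "\<And>j. j < k \<Longrightarrow> norm (u j :: complex) \<le> q"
  shows "norm (\<Sum>(i, j)\<in>lpairs k. u i * u j) \<le> real (k * (k - 1) div 2) * q ^ 2"
proof -
  have "norm (\<Sum>(i, j)\<in>lpairs k. u i * u j) \<le> real (card (lpairs k)) * q ^ 2"
  proof (intro sum_norm_bound, clarify)
    fix i j assume "i < j" "j < k"
    then show "norm (u i * u j) \<le> q ^ 2"
      using assms[of i] assms[of j] order.trans[OF norm_ge_zero assms[of j]] unfolding norm_mult power2_eq_square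
      by (intro mult_mono) auto
  qed
  then show ?thesis by (simp add: card_lpairs)
qed

text \<open>The two averages are the even and odd parts of \<open>\<Prod> (1 - u_j)\<close> under
  \<open>u \<mapsto> - u\<close>. Adjoining a variable replaces the even part by even minus
  \<open>u k\<close> times odd, and the odd part by odd minus \<open>u k\<close> times even, so they
  are estimated together. Parity lets the errors skip one order.\<close>

lemma even_part_approx:
  "\<exists>C\<ge>0. \<forall>(u :: nat \<Rightarrow> complex) q. 0 \<le> q \<and> q \<le> 1 \<and> (\<forall>j<k. norm (u j) \<le> q) \<longrightarrow>
     norm (((\<Prod>j<k. 1 - u j) + (\<Prod>j<k. 1 + u j)) / 2 - 1 - (\<Sum>(i, j)\<in>lpairs k. u i * u j)) \<le> C * q ^ 4 \<and>
     norm (((\<Prod>j<k. 1 - u j) - (\<Prod>j<k. 1 + u j)) / 2 + (\<Sum>j<k. u j)) \<le> C * q ^ 3"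
proof (induction k)
  case 0
  show ?case by (intro exI[of _ 0]) auto
next
  case (Suc k)
  then obtain C where C: "C \<ge> 0" "\<And>(u :: nat \<Rightarrow> complex) q. 0 \<le> q \<Longrightarrow> q \<le> 1 \<Longrightarrow> (\<forall>j<k. norm (u j) \<le> q) \<Longrightarrow>
     norm (((\<Prod>j<k. 1 - u j) + (\<Prod>j<k. 1 + u j)) / 2 - 1 - (\<Sum>(i, j)\<in>lpairs k. u i * u j)) \<le> C * q ^ 4 \<and>
     norm (((\<Prod>j<k. 1 - u j) - (\<Prod>j<k. 1 + u j)) / 2 + (\<Sum>j<k. u j)) \<le> C * q ^ 3" by blast
  let ?D = "2 * C + real (k * (k - 1) div 2)"
  show ?case
  proof (intro exI[of _ ?D] conjI[of "?D \<ge> 0"] allI impI; (elim conjE)?)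
    show "?D \<ge> 0" using C by auto
    fix u :: "nat \<Rightarrow> complex" and q :: real
    assume q: "0 \<le> q" "q \<le> 1" "\<forall>j<Suc k. norm (u j) \<le> q"
    let ?P = "\<Prod>j<k. 1 - u j" let ?M = "\<Prod>j<k. 1 + u j"
    let ?e2 = "\<Sum>(i, j)\<in>lpairs k. u i * u j" let ?e1 = "\<Sum>j<k. u j"
    have 1: "norm ((?P + ?M) / 2 - 1 - ?e2) \<le> C * q ^ 4" and 2: "norm ((?P - ?M) / 2 + ?e1) \<le> C * q ^ 3"
      using C(2)[of q u] q by auto
    have e2: "norm ?e2 \<le> real (k * (k - 1) div 2) * q ^ 2" using q by (intro norm_sum_lpairs_le) auto
    have e2': "(\<Sum>(i, j)\<in>lpairs (Suc k). u i * u j) = ?e2 + u k * ?e1"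
      by (simp add: sum_lpairs_altdef sum_distrib_left mult.commute)
    have "norm (u k * ((?P - ?M) / 2 + ?e1)) \<le> q * (C * q ^ 3)"
      unfolding norm_mult using q 2 by (intro mult_mono) auto
    then have 3: "norm (u k * ((?P - ?M) / 2 + ?e1)) \<le> C * q ^ 4" by (simp add: algebra_simps eval_nat_numeral)
    have "((\<Prod>j<Suc k. 1 - u j) + (\<Prod>j<Suc k. 1 + u j)) / 2 - 1 - (\<Sum>(i, j)\<in>lpairs (Suc k). u i * u j)
      = ((?P + ?M) / 2 - 1 - ?e2) - u k * ((?P - ?M) / 2 + ?e1)"
      unfolding e2' by (simp add: field_simps)
    also have "norm \<dots> \<le> C * q ^ 4 + C * q ^ 4"
      by (rule order.trans[OF norm_triangle_ineq4 add_mono[OF 1 3]])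
    also have "\<dots> \<le> ?D * q ^ 4" using q by (simp add: algebra_simps)
    finally have A: "norm (((\<Prod>j<Suc k. 1 - u j) + (\<Prod>j<Suc k. 1 + u j)) / 2 - 1 - (\<Sum>(i, j)\<in>lpairs (Suc k). u i * u j)) \<le> ?D * q ^ 4" .
    have "norm ((?P + ?M) / 2 - 1) \<le> C * q ^ 4 + real (k * (k - 1) div 2) * q ^ 2"
      using norm_triangle_ineq[of "(?P + ?M) / 2 - 1 - ?e2" ?e2] 1 e2 by simp
    also have "\<dots> \<le> C * q ^ 2 + real (k * (k - 1) div 2) * q ^ 2"
      using q C power_decreasing[of 2 4 q] by (intro add_right_mono mult_left_mono) auto
    finally have "norm (u k * ((?P + ?M) / 2 - 1)) \<le> q * (C * q ^ 2 + real (k * (k - 1) div 2) * q ^ 2)"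
      unfolding norm_mult using q by (intro mult_mono) auto
    then have 4: "norm (u k * ((?P + ?M) / 2 - 1)) \<le> (C + real (k * (k - 1) div 2)) * q ^ 3"
      by (simp add: algebra_simps eval_nat_numeral)
    have "((\<Prod>j<Suc k. 1 - u j) - (\<Prod>j<Suc k. 1 + u j)) / 2 + (\<Sum>j<Suc k. u j)
      = ((?P - ?M) / 2 + ?e1) - u k * ((?P + ?M) / 2 - 1)" by (simp add: field_simps)
    also have "norm \<dots> \<le> C * q ^ 3 + (C + real (k * (k - 1) div 2)) * q ^ 3"
      by (rule order.trans[OF norm_triangle_ineq4 add_mono[OF 2 4]])
    also have "\<dots> = ?D * q ^ 3" by (simp add: algebra_simps)
    finally show "norm (((\<Prod>j<Suc k. 1 - u j) + (\<Prod>j<Suc k. 1 + u j)) / 2 - 1 - (\<Sum>(i, j)\<in>lpairs (Suc k). u i * u j)) \<le> ?D * q ^ 4 \<and>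
     norm (((\<Prod>j<Suc k. 1 - u j) - (\<Prod>j<Suc k. 1 + u j)) / 2 + (\<Sum>j<Suc k. u j)) \<le> ?D * q ^ 3"
      using A by blast
  qed
qed

text \<open>Up to \<open>O(q^4)\<close> the quotient is
  \<open>(1 - e) (1 + e + t) / (1 + t)\<close>, where \<open>e\<close> is the second elementary
  symmetric function of the \<open>u j\<close>. The terms linear in \<open>e\<close> cancel, and
  with them the part that would prevent convergence of the Euler product.\<close>

lemma local_factor_approx:
  "\<exists>C\<ge>0. \<forall>(u :: nat \<Rightarrow> complex) q t. 0 \<le> q \<and> q \<le> 1 \<and> (\<forall>j<k. norm (u j) \<le> q) \<and> 0 \<le> t \<and> t \<le> q ^ 2 \<longrightarrow>
     norm ((\<Prod>(i, j)\<in>lpairs k. 1 - u i * u j) *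
        (((\<Prod>j<k. 1 - u j) + (\<Prod>j<k. 1 + u j)) / 2 + (\<Prod>j<k. 1 - u j ^ 2) * of_real t) / (1 + of_real t) - 1) \<le> C * q ^ 4"
proof -
  obtain C1 where C1: "C1 \<ge> 0" "\<And>(u :: nat \<Rightarrow> complex) q. 0 \<le> q \<Longrightarrow> q \<le> 1 \<Longrightarrow> (\<forall>j<k. norm (u j) \<le> q) \<Longrightarrow>
     norm (((\<Prod>j<k. 1 - u j) + (\<Prod>j<k. 1 + u j)) / 2 - 1 - (\<Sum>(i, j)\<in>lpairs k. u i * u j)) \<le> C1 * q ^ 4"
    using even_part_approx[of k] by blast
  obtain C2 where C2: "C2 \<ge> 0" "\<And>(x :: nat \<times> nat \<Rightarrow> complex) \<epsilon>. 0 \<le> \<epsilon> \<Longrightarrow> \<epsilon> \<le> 1 \<Longrightarrow> (\<forall>s\<in>lpairs k. norm (x s) \<le> \<epsilon>) \<Longrightarrow>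
     norm ((\<Prod>s\<in>lpairs k. 1 - x s) - 1 + (\<Sum>s\<in>lpairs k. x s)) \<le> C2 * \<epsilon> ^ 2"
    using prod_one_minus_approx[OF finite_lpairs[of k]] by blast
  obtain C3 where C3: "C3 \<ge> 0" "\<And>(x :: nat \<Rightarrow> complex) \<epsilon>. 0 \<le> \<epsilon> \<Longrightarrow> \<epsilon> \<le> 1 \<Longrightarrow> (\<forall>s\<in>{..<k}. norm (x s) \<le> \<epsilon>) \<Longrightarrow>
     norm ((\<Prod>s<k. 1 - x s) - 1 + (\<Sum>s<k. x s)) \<le> C3 * \<epsilon> ^ 2"
    using prod_one_minus_approx[of "{..<k}"] by blast
  define K where "K = real (k * (k - 1) div 2)"
  \<comment> \<open>One summand for each of the error terms \<open>T1\<close> to \<open>T5\<close>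
    below, in this order.\<close>
  define C where "C = K ^ 2 + (1 + K) * C1 + K + (1 + K) * (C3 + k) + C2 * (1 + K + C1 + 1 + C3 + k)"
  have K: "K \<ge> 0" by (simp add: K_def)
  show ?thesis
  proof (intro exI[of _ C] conjI allI impI; (elim conjE)?)
    show "C \<ge> 0" using C1 C2 C3 K by (simp add: C_def)
    fix u :: "nat \<Rightarrow> complex" and q t :: real
    assume q: "0 \<le> q" "q \<le> 1" "\<forall>j<k. norm (u j) \<le> q" "0 \<le> t" "t \<le> q ^ 2"
    define e where "e = (\<Sum>(i, j)\<in>lpairs k. u i * u j)"
    define a where "a = (\<Prod>(i, j)\<in>lpairs k. 1 - u i * u j)"
    define c where "c = ((\<Prod>j<k. 1 - u j) + (\<Prod>j<k. 1 + u j)) / 2"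
    define d where "d = (\<Prod>j<k. 1 - u j ^ 2)"
    have q2: "q ^ 2 \<le> 1" "0 \<le> q ^ 2" using q by (auto simp: power_le_one)
    have t1: "t \<le> 1" using q q2 by linarith
    have e: "norm e \<le> K * q ^ 2" unfolding e_def K_def using q by (intro norm_sum_lpairs_le) auto
    then have e1: "norm e \<le> K" using mult_left_le[OF q2(1) K] by linarith
    have n1e: "norm (1 - e) \<le> 1 + K" using norm_triangle_ineq4[of 1 e] e1 by simp
    have cb: "norm (c - 1 - e) \<le> C1 * q ^ 4" unfolding c_def e_def using C1(2) q by blast
    have "\<forall>s\<in>lpairs k. norm (case s of (i, j) \<Rightarrow> u i * u j) \<le> q ^ 2"
      using q by (auto simp: norm_mult power2_eq_square intro!: mult_mono)
    from C2(2)[OF q2(2,1) this] have ab: "norm (a - 1 + e) \<le> C2 * q ^ 4"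
      unfolding a_def e_def by (simp add: case_prod_unfold flip: power_mult)
    have u2: "\<forall>s\<in>{..<k}. norm (u s ^ 2) \<le> q ^ 2"
      using q by (auto simp: norm_power intro!: power_mono)
    from C3(2)[OF q2(2,1) this] have d1: "norm (d - 1 + (\<Sum>s<k. u s ^ 2)) \<le> C3 * q ^ 4"
      unfolding d_def by (simp flip: power_mult)
    have "norm (\<Sum>s<k. u s ^ 2) \<le> real k * q ^ 2" using u2 sum_norm_bound[of "{..<k}" "\<lambda>s. u s ^ 2" "q ^ 2"] by simp
    moreover have "C3 * q ^ 4 \<le> C3 * q ^ 2" using q C3 power_decreasing[of 2 4 q] by (intro mult_left_mono) auto
    ultimately have db: "norm (d - 1) \<le> (C3 + k) * q ^ 2"
      using norm_triangle_ineq4[of "d - 1 + (\<Sum>s<k. u s ^ 2)" "\<Sum>s<k. u s ^ 2"] d1 by (simp add: algebra_simps)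
    then have db1: "norm (d - 1) \<le> C3 + k" using mult_left_le[OF q2(1), of "C3 + k"] C3 by simp
    have "norm (c + d * of_real t) \<le> 1 + K + C1 + 1 + C3 + k"
    proof -
      have "C1 * q ^ 4 \<le> C1" using q C1 by (intro mult_left_le) (auto simp: power_le_one)
      then have "norm c \<le> 1 + K + C1"
        using norm_triangle_ineq[of "c - 1 - e" "1 + e"] norm_triangle_ineq[of 1 e] cb e1 by simp
      moreover have "norm (d * of_real t) \<le> norm d" using t1 q by (simp add: norm_mult mult_left_le)
      moreover have "norm d \<le> 1 + C3 + k" using norm_triangle_ineq[of "d - 1" 1] db1 by simp
      ultimately show ?thesis using norm_triangle_ineq[of c "d * of_real t"] by linarith
    qed
    then have T5: "norm ((a - 1 + e) * (c + d * of_real t)) \<le> C2 * q ^ 4 * (1 + K + C1 + 1 + C3 + k)"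
      unfolding norm_mult using ab C2 by (intro mult_mono) auto
    have T1: "norm (e ^ 2) \<le> (K * q ^ 2) ^ 2" unfolding norm_power using e by (intro power_mono) auto
    have T2: "norm ((1 - e) * (c - 1 - e)) \<le> (1 + K) * (C1 * q ^ 4)"
      unfolding norm_mult using n1e cb K by (intro mult_mono) auto
    have tn: "norm (of_real t :: complex) \<le> q ^ 2" using q by simp
    have T3: "norm (e * of_real t) \<le> (K * q ^ 2) * q ^ 2"
      unfolding norm_mult using e tn K q2 by (intro mult_mono) auto
    have T4: "norm ((1 - e) * ((d - 1) * of_real t)) \<le> (1 + K) * ((C3 + k) * q ^ 2 * q ^ 2)"
      unfolding norm_mult using n1e db tn K q2 C3 by (intro mult_mono mult_nonneg_nonneg) auto
    \<comment> \<open>Each of the five terms is \<open>O(q^4)\<close>, because \<open>e\<close> and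
      \<open>t\<close> are \<open>O(q^2)\<close>.\<close>
    have "a * (c + d * of_real t) - (1 + of_real t)
      = - (e ^ 2) + (1 - e) * (c - 1 - e) - e * of_real t + (1 - e) * ((d - 1) * of_real t) + (a - 1 + e) * (c + d * of_real t)"
      by (simp add: algebra_simps power2_eq_square)
    also have "norm \<dots> \<le> (K * q ^ 2) ^ 2 + (1 + K) * (C1 * q ^ 4) + (K * q ^ 2) * q ^ 2
       + (1 + K) * ((C3 + k) * q ^ 2 * q ^ 2) + C2 * q ^ 4 * (1 + K + C1 + 1 + C3 + k)"
      using T1 T2 T3 T4 T5
      by (intro order.trans[OF norm_triangle_ineq] order.trans[OF norm_triangle_ineq4] add_mono) auto
    also have "\<dots> = C * q ^ 4"
      unfolding C_def by (simp add: power_mult_distrib algebra_simps eval_nat_numeral)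
    finally have main: "norm (a * (c + d * of_real t) - (1 + of_real t)) \<le> C * q ^ 4" .
    have n1: "norm (1 + of_real t :: complex) \<ge> 1"
      using q by (metis abs_of_nonneg add_increasing le_add_same_cancel1 norm_of_real of_real_1 of_real_add zero_le_one)
    then have "1 + of_real t \<noteq> (0 :: complex)" by auto
    then have "a * (c + d * of_real t) / (1 + of_real t) - 1 = (a * (c + d * of_real t) - (1 + of_real t)) / (1 + of_real t)"
      by (simp add: field_simps)
    also have "norm \<dots> \<le> norm (a * (c + d * of_real t) - (1 + of_real t))"
      unfolding norm_divide using n1 by (simp add: divide_le_eq mult_left_le_one_le mult_left_le) (metis mult_left_mono mult.right_neutral norm_ge_zero)
    finally show "norm ((\<Prod>(i, j)\<in>lpairs k. 1 - u i * u j) *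
        (((\<Prod>j<k. 1 - u j) + (\<Prod>j<k. 1 + u j)) / 2 + (\<Prod>j<k. 1 - u j ^ 2) * of_real t) / (1 + of_real t) - 1) \<le> C * q ^ 4"
      using main unfolding a_def c_def d_def by linarith
  qed
qed

section \<open>Bounded separately holomorphic functions on polydiscs\<close>

definition polydisc :: "nat \<Rightarrow> real \<Rightarrow> (nat \<Rightarrow> complex) set" where
  "polydisc k R = {z. \<forall>j<k. norm (z j) < R}"

text \<open>Functions of the first \<open>k\<close> coordinates that are bounded and separately holomorphic; joint
  continuity is not needed for the power series expansion.\<close>

definition bounded_hol :: "nat \<Rightarrow> real \<Rightarrow> ((nat \<Rightarrow> complex) \<Rightarrow> complex) \<Rightarrow> bool" where
  "bounded_hol k R F \<longleftrightarrow>
     (\<forall>z z'. (\<forall>j<k. z j = z' j) \<longrightarrow> F z = F z') \<and>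
     (\<exists>M. \<forall>z\<in>polydisc k R. norm (F z) \<le> M) \<and>
     (\<forall>z\<in>polydisc k R. \<forall>i<k. (\<lambda>w. F (z(i := w))) holomorphic_on ball 0 R)"

lemma polydisc_mono: "R \<le> S \<Longrightarrow> polydisc k R \<subseteq> polydisc k S"
  by (auto simp: polydisc_def intro: less_le_trans)

lemma bounded_holD:
  assumes "bounded_hol k R F"
  shows "(\<And>j. j < k \<Longrightarrow> z j = z' j) \<Longrightarrow> F z = F z'"
    and "\<exists>M. \<forall>z\<in>polydisc k R. norm (F z) \<le> M"
    and "z \<in> polydisc k R \<Longrightarrow> i < k \<Longrightarrow> (\<lambda>w. F (z(i := w))) holomorphic_on ball 0 R"
  using assms unfolding bounded_hol_def by simp_all

lemma bounded_holI:
  assumes "\<And>z z'. (\<And>j. j < k \<Longrightarrow> z j = z' j) \<Longrightarrow> F z = F z'"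
    and "\<And>z. z \<in> polydisc k R \<Longrightarrow> norm (F z) \<le> M"
    and "\<And>z i. z \<in> polydisc k R \<Longrightarrow> i < k \<Longrightarrow> (\<lambda>w. F (z(i := w))) holomorphic_on ball 0 R"
  shows "bounded_hol k R F"
  unfolding bounded_hol_def
proof (intro conjI)
  show "\<forall>z z'. (\<forall>j<k. z j = z' j) \<longrightarrow> F z = F z'" by (intro allI impI, rule assms(1)) blast
  show "\<exists>M. \<forall>z\<in>polydisc k R. norm (F z) \<le> M" by (intro exI[of _ M] ballI assms(2))
  show "\<forall>z\<in>polydisc k R. \<forall>i<k. (\<lambda>w. F (z(i := w))) holomorphic_on ball 0 R"
    by (intro ballI allI impI assms(3))
qed

lemma bounded_hol_mono:
  assumes "bounded_hol k S F" "R \<le> S" shows "bounded_hol k R F"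
proof -
  note sub = subsetD[OF polydisc_mono[OF assms(2), of k]]
  obtain M where "\<forall>z\<in>polydisc k S. norm (F z) \<le> M" using bounded_holD(2)[OF assms(1)] ..
  then show ?thesis
    by (intro bounded_holI[of k F R M] bounded_holD(1)[OF assms(1)]
          holomorphic_on_subset[OF bounded_holD(3)[OF assms(1) sub] subset_ball[OF assms(2)]])
       (auto dest: sub)
qed

lemma bounded_hol_const [simp]: "bounded_hol k R (\<lambda>_. c)"
  by (rule bounded_holI[where M = "norm c"]) auto

lemma bounded_hol_mult:
  assumes "bounded_hol k R F" "bounded_hol k R F'"
  shows "bounded_hol k R (\<lambda>z. F z * F' z)"
proof -
  obtain M M' where M: "\<forall>z\<in>polydisc k R. norm (F z) \<le> M" "\<forall>z\<in>polydisc k R. norm (F' z) \<le> M'"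
    using bounded_holD(2)[OF assms(1)] bounded_holD(2)[OF assms(2)] by auto
  show ?thesis
  proof (rule bounded_holI[where M = "M * M'"])
    fix z assume z: "z \<in> polydisc k R"
    show "norm (F z * F' z) \<le> M * M'"
      unfolding norm_mult using M z order.trans[OF norm_ge_zero bspec[OF M(1) z]] by (intro mult_mono) auto
  qed (auto intro!: holomorphic_intros arg_cong2[of _ _ _ _ "(*)"] bounded_holD(3) assms
        intro: bounded_holD(1)[OF assms(1)] bounded_holD(1)[OF assms(2)])
qed

lemma bounded_hol_prod:
  "(\<And>i. i \<in> S \<Longrightarrow> bounded_hol k R (f i)) \<Longrightarrow> bounded_hol k R (\<lambda>z. \<Prod>i\<in>S. f i z)"
  by (induction S rule: infinite_finite_induct) (auto intro: bounded_hol_mult)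

lemma bounded_on_ball:
  assumes "f holomorphic_on ball 0 S" "R < S" "0 < R"
  shows "\<exists>M. \<forall>w. norm w < R \<longrightarrow> norm (f w :: complex) \<le> M"
proof -
  have "continuous_on (cball 0 R) f"
    using assms by (intro holomorphic_on_imp_continuous_on holomorphic_on_subset[OF assms(1)]) auto
  then have "compact (f ` cball 0 R)" by (intro compact_continuous_image) auto
  then obtain M where "\<forall>x\<in>f ` cball 0 R. norm x \<le> M" using compact_imp_bounded bounded_iff by metis
  then have "norm (f w) \<le> M" if "norm w < R" for w using that by simp
  then show ?thesis by blast
qed

lemma bounded_hol_coord:
  assumes "f holomorphic_on ball 0 S" "R < S" "0 < R" "j < k"
  shows "bounded_hol k R (\<lambda>z. f (z j))"
proof -
  obtain M where M: "\<forall>w. norm w < R \<longrightarrow> norm (f w) \<le> M" using bounded_on_ball[OF assms(1-3)] ..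
  have f: "f holomorphic_on ball 0 R" using assms by (intro holomorphic_on_subset[OF assms(1)]) auto
  have "(\<lambda>w. f ((z(i := w)) j)) holomorphic_on ball 0 R" for z i
    using f by (cases "i = j") auto
  with M show ?thesis using assms(4) by (intro bounded_holI[of k _ R M]) (auto simp: polydisc_def)
qed

lemma bounded_hol_coord_add:
  assumes "f holomorphic_on ball 0 S" "2 * R < S" "0 < R" "i < k" "j < k"
  shows "bounded_hol k R (\<lambda>z. f (z i + z j))"
proof -
  have "0 < 2 * R" using assms(3) by simp
  then obtain M where M: "\<forall>w. norm w < 2 * R \<longrightarrow> norm (f w) \<le> M" using bounded_on_ball[OF assms(1-2)] by blast
  have b: "norm (x + y) < 2 * R" if "norm x < R" "norm y < R" for x y :: complex
    using norm_triangle_ineq[of x y] that by linarith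
  have "(\<lambda>w. f ((z(l := w)) i + (z(l := w)) j)) holomorphic_on ball 0 R" if z: "z \<in> polydisc k R" for z l
  proof (rule holomorphic_on_compose_gen[OF _ assms(1), unfolded o_def])
    show "(\<lambda>w. (z(l := w)) i + (z(l := w)) j) holomorphic_on ball 0 R"
      by (cases "l = i"; cases "l = j") (simp_all add: holomorphic_on_add holomorphic_on_ident)
    show "(\<lambda>w. (z(l := w)) i + (z(l := w)) j) ` ball 0 R \<subseteq> ball 0 S"
    proof clarify
      fix w :: complex assume "w \<in> ball 0 R"
      then have "norm ((z(l := w)) i) < R" "norm ((z(l := w)) j) < R" using z assms by (auto simp: polydisc_def)
      from b[OF this] show "(z(l := w)) i + (z(l := w)) j \<in> ball 0 S" using assms(2) unfolding mem_ball_0 by linarith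
    qed
  qed
  moreover have "norm (f (z i + z j)) \<le> M" if "z \<in> polydisc k R" for z
    using M b that assms by (auto simp: polydisc_def)
  ultimately show ?thesis using assms(4,5) by (intro bounded_holI[of k _ R M]) auto
qed

text \<open>In the variables \<open>u j = prime_root p (z j)\<close> the Euler factor becomes
  rational, because \<open>p^(-1-z_i-z_j)\<close> is \<open>u i * u j\<close>.\<close>

definition prime_root :: "nat \<Rightarrow> complex \<Rightarrow> complex" where
  "prime_root p w = of_nat p powr (- 1/2 - w)"

lemma norm_prime_root:
  assumes "prime p" shows "norm (prime_root p w) = real p powr (- 1/2 - Re w)"
  using norm_powr_of_real[of "real p" "- 1/2 - w"] assms by (simp add: prime_root_def prime_gt_0_nat)

text \<open>The radius \<open>1/10\<close> gives the exponent \<open>- 1/2 + 1/10 = - 2/5\<close>,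
  and four times this is \<open>- 8/5 < - 1\<close>, which makes the fourth-order errors summable
  over the primes.\<close>

lemma norm_prime_root_le:
  assumes "prime p" "norm w < 1/10" shows "norm (prime_root p w) \<le> real p powr (- 2/5)"
proof -
  have "1 \<le> real p" using assms prime_ge_1_nat[of p] by simp
  moreover have "- 1/2 - Re w \<le> - 2/5" using abs_Re_le_cmod[of w] assms(2) by linarith
  ultimately show ?thesis unfolding norm_prime_root[OF assms(1)] by (intro powr_mono)
qed

lemma norm_prime_root_less_1:
  assumes "prime p" "norm w < 1/10" shows "norm (prime_root p w) < 1"
proof -
  have "real p powr (- 2/5) < 1" using prime_gt_1_nat[OF assms(1)] by (intro powr_less_one) auto
  then show ?thesis using norm_prime_root_le[OF assms] by linarith
qed

lemma prod_upairs: "(\<Prod>(i, j)\<in>upairs k. f i j) = (\<Prod>(i, j)\<in>lpairs k. f i j) * (\<Prod>i<k. f i i)"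
proof -
  have "upairs k = lpairs k \<union> (\<lambda>i. (i, i)) ` {..<k}" by (auto simp: upairs_def)
  then have "(\<Prod>(i, j)\<in>upairs k. f i j) = (\<Prod>(i, j)\<in>lpairs k. f i j) * (\<Prod>(i, j)\<in>(\<lambda>i. (i, i)) ` {..<k}. f i j)"
    by (simp only:) (subst prod.union_disjoint, auto)
  also have "(\<Prod>(i, j)\<in>(\<lambda>i. (i, i)) ` {..<k}. f i j) = (\<Prod>i<k. f i i)"
    by (subst prod.reindex) (auto simp: inj_on_def)
  finally show ?thesis .
qed

text \<open>The diagonal factors are \<open>1 - u j ^ 2 = (1 - u j) * (1 + u j)\<close>. Their
  product clears both denominators of the average, which are nonzero because \<open>u j\<close> has
  norm below \<open>1\<close>.\<close>

lemma A_factor_eq: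
  assumes p: "prime p" and z: "z \<in> polydisc k (1/10)"
  defines "u \<equiv> \<lambda>j. prime_root p (z j)"
  shows "A_factor k z p = (\<Prod>(i, j)\<in>lpairs k. 1 - u i * u j) *
        (((\<Prod>j<k. 1 - u j) + (\<Prod>j<k. 1 + u j)) / 2 + (\<Prod>j<k. 1 - u j ^ 2) * of_real (1 / real p)) / (1 + of_real (1 / real p))"
proof -
  have p0: "of_nat p \<noteq> (0 :: complex)" using p by auto
  have uu: "1 - 1 / of_nat p powr (1 + z i + z j) = 1 - u i * u j" for i j
  proof -
    have "u i * u j = of_nat p powr (- (1 + z i + z j))"
      unfolding u_def prime_root_def powr_add[symmetric] by (rule arg_cong[of _ _ "\<lambda>e. _ powr e"]) (simp add: field_simps)
    then show ?thesis by (simp only: powr_minus_divide)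
  qed
  have u1: "norm (u j) < 1" if "j < k" for j
    using norm_prime_root_less_1[OF p] z that by (simp add: u_def polydisc_def)
  have "1 - u j \<noteq> 0 \<and> 1 + u j \<noteq> 0" if "j < k" for j
  proof -
    have "u j \<noteq> 1" "u j \<noteq> - 1" using u1[OF that] by auto
    then show ?thesis by (simp add: add_eq_0_iff)
  qed
  then have nz: "(\<Prod>j<k. 1 - u j) \<noteq> 0" "(\<Prod>j<k. 1 + u j) \<noteq> 0" by auto
  have sq: "(\<Prod>j<k. 1 - u j * u j) = (\<Prod>j<k. 1 - u j) * (\<Prod>j<k. 1 + u j)"
    unfolding prod.distrib[symmetric] by (intro prod.cong) (auto simp: algebra_simps)
  have ni: "(\<Prod>j<k. inverse (1 - of_nat p powr (- 1/2 - z j))) = inverse (\<Prod>j<k. 1 - u j)"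
    "(\<Prod>j<k. inverse (1 + of_nat p powr (- 1/2 - z j))) = inverse (\<Prod>j<k. 1 + u j)"
    unfolding u_def prime_root_def by (rule prod_inversef[unfolded o_def])+
  have key: "a * (P * M) * (1/2 * (inverse P + inverse M) + t) * inverse (1 + t) = a * ((P + M) / 2 + P * M * t) / (1 + t)"
    if "P \<noteq> 0" "M \<noteq> 0" for a P M t :: complex
  proof -
    have "P * M * (1/2 * (inverse P + inverse M) + t) = (P + M) / 2 + P * M * t"
      using that by (simp add: field_simps)
    then show ?thesis by (simp only: divide_inverse mult.assoc)
  qed
  have t: "1 / of_nat p = (of_real (1 / real p) :: complex)" by simp
  show ?thesis
    unfolding A_factor_def uu ni prod_upairs sq power2_eq_square t by (rule key[OF nz])
qed

definition A_term :: "nat \<Rightarrow> (nat \<Rightarrow> complex) \<Rightarrow> nat \<Rightarrow> complex" where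
  "A_term k z p = (if prime p then A_factor k z p else 1)"

lemma A_term_bound:
  obtains C where "C \<ge> 0" "\<And>z p. z \<in> polydisc k (1/10) \<Longrightarrow> norm (A_term k z p - 1) \<le> C * real p powr (- 8/5)"
proof -
  obtain C where C: "C \<ge> 0" "\<And>(u :: nat \<Rightarrow> complex) q t. 0 \<le> q \<Longrightarrow> q \<le> 1 \<Longrightarrow> (\<forall>j<k. norm (u j) \<le> q) \<Longrightarrow> 0 \<le> t \<Longrightarrow> t \<le> q ^ 2 \<Longrightarrow>
     norm ((\<Prod>(i, j)\<in>lpairs k. 1 - u i * u j) *
        (((\<Prod>j<k. 1 - u j) + (\<Prod>j<k. 1 + u j)) / 2 + (\<Prod>j<k. 1 - u j ^ 2) * of_real t) / (1 + of_real t) - 1) \<le> C * q ^ 4"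
    using local_factor_approx[of k] by blast
  show thesis
  proof (rule that[OF C(1)])
    fix z p assume z: "z \<in> polydisc k (1/10)"
    show "norm (A_term k z p - 1) \<le> C * real p powr (- 8/5)"
    proof (cases "prime p")
      case p: True
      let ?q = "real p powr (- 2/5)"
      have p1: "1 \<le> real p" using p prime_ge_1_nat[of p] by simp
      have q4: "?q ^ 4 = real p powr (- 8/5)" "?q ^ 2 = real p powr (- 4/5)"
        using p1 by (simp_all add: powr_power)
      have "norm (A_factor k z p - 1) \<le> C * ?q ^ 4"
        unfolding A_factor_eq[OF p z]
      proof (rule C(2))
        have "1 / real p = real p powr (- 1)" using p1 by (simp add: powr_minus_divide)
        also have "\<dots> \<le> ?q ^ 2" unfolding q4 using p1 by (intro powr_mono) auto
        finally show "1 / real p \<le> ?q ^ 2" .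
        show "?q \<le> 1" using powr_mono[of "-2/5" 0 "real p"] p1 by simp
        show "\<forall>j<k. norm (prime_root p (z j)) \<le> ?q"
          using norm_prime_root_le[OF p] z by (auto simp: polydisc_def)
      qed auto
      then show ?thesis using p unfolding A_term_def q4(1) by simp
    qed (use C in \<open>simp add: A_term_def\<close>)
  qed
qed

lemma summable_prime_powr: "summable (\<lambda>p. C * real p powr (- 8/5))"
  by (intro summable_mult) (simp add: summable_real_powr_iff)

lemma A_altdef: "A k z = prodinf (A_term k z)"
  unfolding A_def A_term_def[abs_def] ..

lemma A_term_convergent:
  assumes "z \<in> polydisc k (1/10)"
  shows "convergent_prod (A_term k z)" "(\<lambda>n. \<Prod>p\<le>n. A_term k z p) \<longlonglongrightarrow> A k z"
proof -
  obtain C where C: "C \<ge> 0" "\<And>z p. z \<in> polydisc k (1/10) \<Longrightarrow> norm (A_term k z p - 1) \<le> C * real p powr (- 8/5)"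
    using A_term_bound[of k] by blast
  have "summable (\<lambda>p. norm (A_term k z p - 1))"
    by (rule summable_comparison_test'[OF summable_prime_powr[of C], of 0]) (use C(2)[OF assms] in auto)
  then have "abs_convergent_prod (A_term k z)" by (rule summable_imp_abs_convergent_prod)
  then show c: "convergent_prod (A_term k z)" by (rule abs_convergent_prod_imp_convergent_prod)
  show "(\<lambda>n. \<Prod>p\<le>n. A_term k z p) \<longlonglongrightarrow> A k z"
    using convergent_prod_LIMSEQ[OF c] unfolding A_altdef .
qed

lemma A_term_holomorphic:
  assumes "z \<in> polydisc k (1/10)" "i < k"
  shows "(\<lambda>w. A_term k (z(i := w)) p) holomorphic_on ball 0 (1/10)"
proof (cases "prime p")
  case p: True
  have zi: "z(i := w) \<in> polydisc k (1/10)" if "w \<in> ball 0 (1/10)" for w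
    using assms that by (auto simp: polydisc_def)
  have u: "(\<lambda>w. prime_root p ((z(i := w)) j)) holomorphic_on ball 0 (1/10)" for j
    unfolding prime_root_def by (cases "j = i") (use p in \<open>auto intro!: holomorphic_intros\<close>)
  have p1: "1 + of_real (1 / real p) \<noteq> (0 :: complex)"
  proof -
    have "1 + 1 / real p > 0" by (intro add_pos_nonneg) auto
    moreover have "1 + of_real (1 / real p) = (of_real (1 + 1 / real p) :: complex)"
      by (simp only: of_real_add of_real_1)
    ultimately show ?thesis by (simp only: of_real_eq_0_iff)
  qed
  have "(\<lambda>w. A_factor k (z(i := w)) p) holomorphic_on ball 0 (1/10)"
    by (rule holomorphic_transform[rotated, OF A_factor_eq[OF p zi, symmetric]], assumption)
       (unfold case_prod_unfold, intro holomorphic_intros u p1, simp)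
  then show ?thesis using p by (simp add: A_term_def)
qed (simp add: A_term_def)

text \<open>All parts rest on the bound \<open>C * p powr (- 8/5)\<close> for
  \<open>A_term k z p - 1\<close>, uniform in \<open>z\<close>: partial products stay below the
  exponential of its sum, and along each coordinate they converge uniformly on small discs.\<close>

lemma bounded_hol_A: "bounded_hol k (1/10) (A k)"
proof -
  obtain C where C: "C \<ge> 0" "\<And>z p. z \<in> polydisc k (1/10) \<Longrightarrow> norm (A_term k z p - 1) \<le> C * real p powr (- 8/5)"
    using A_term_bound[of k] by blast
  let ?S = "suminf (\<lambda>p. C * real p powr (- 8/5))"
  have bd: "norm (A k z) \<le> exp ?S" if z: "z \<in> polydisc k (1/10)" for z
  proof (rule LIMSEQ_le_const2[OF tendsto_norm[OF A_term_convergent(2)[OF z]]], intro exI allI impI)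
    fix n
    have "norm (\<Prod>p\<le>n. A_term k z p) = (\<Prod>p\<le>n. norm (1 + (A_term k z p - 1)))" by (simp add: prod_norm)
    also have "\<dots> \<le> (\<Prod>p\<le>n. 1 + norm (A_term k z p - 1))"
    proof (intro prod_mono conjI)
      fix p show "norm (1 + (A_term k z p - 1)) \<le> 1 + norm (A_term k z p - 1)"
        using norm_triangle_ineq[of 1 "A_term k z p - 1"] by simp
    qed simp
    also have "\<dots> \<le> exp (\<Sum>p\<le>n. norm (A_term k z p - 1))" by (rule prod_le_exp_sum) auto
    also have "\<dots> \<le> exp (\<Sum>p\<le>n. C * real p powr (- 8/5))" using C(2)[OF z] by (simp add: sum_mono)
    also have "\<dots> \<le> exp ?S" using C(1) by (intro exp_le_cancel_iff[THEN iffD2] sum_le_suminf summable_prime_powr) auto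
    finally show "norm (\<Prod>p\<le>n. A_term k z p) \<le> exp ?S" .
  qed
  have dep: "A k z = A k z'" if "\<forall>j<k. z j = z' j" for z z'
  proof -
    have "A_factor k z p = A_factor k z' p" for p
      unfolding A_factor_def using that
      by (intro arg_cong2[of _ _ _ _ "(*)"] arg_cong2[of _ _ _ _ "(+)"] prod.cong refl) (auto simp: upairs_def)
    then have "A_term k z = A_term k z'" by (intro ext) (simp add: A_term_def)
    then show ?thesis by (simp add: A_altdef)
  qed
  have hol: "(\<lambda>w. A k (z(i := w))) holomorphic_on ball 0 (1/10)" if z: "z \<in> polydisc k (1/10)" and i: "i < k" for z i
  proof (rule holomorphic_uniform_sequence[where f = "\<lambda>n w. \<Prod>p<n. A_term k (z(i := w)) p"])
    have zi: "z(i := w) \<in> polydisc k (1/10)" if "w \<in> ball 0 (1/10)" for w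
      using z that by (auto simp: polydisc_def)
    show "(\<lambda>w. \<Prod>p<n. A_term k (z(i := w)) p) holomorphic_on ball 0 (1/10)" for n
      by (intro holomorphic_on_prod A_term_holomorphic z i)
    fix x :: complex assume "x \<in> ball 0 (1/10)"
    then obtain d where d: "d > 0" "cball x d \<subseteq> ball 0 (1/10)" by (meson open_ball open_contains_cball)
    have "uniformly_convergent_on (cball x d) (\<lambda>n w. \<Prod>p<n. A_term k (z(i := w)) p)"
    proof (rule uniformly_convergent_on_prod')
      show "continuous_on (cball x d) (\<lambda>w. A_term k (z(i := w)) n)" for n
        by (rule holomorphic_on_imp_continuous_on[OF holomorphic_on_subset[OF A_term_holomorphic[OF z i] d(2)]])
      show "uniformly_convergent_on (cball x d) (\<lambda>N w. \<Sum>p<N. norm (A_term k (z(i := w)) p - 1))"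
        by (rule Weierstrass_m_test'[OF _ summable_prime_powr[of C]]) (use C(2)[OF zi] d in auto)
    qed simp
    then have ul: "uniform_limit (cball x d) (\<lambda>n w. \<Prod>p<n. A_term k (z(i := w)) p) (\<lambda>w. lim (\<lambda>n. \<Prod>p<n. A_term k (z(i := w)) p)) sequentially"
      by (simp add: uniformly_convergent_uniform_limit_iff)
    have "lim (\<lambda>n. \<Prod>p<n. A_term k (z(i := w)) p) = A k (z(i := w))" if "w \<in> cball x d" for w
    proof (rule limI)
      have "(\<lambda>n. \<Prod>p<Suc n. A_term k (z(i := w)) p) \<longlonglongrightarrow> A k (z(i := w))"
        unfolding lessThan_Suc_atMost using that d zi by (intro A_term_convergent) auto
      then show "(\<lambda>n. \<Prod>p<n. A_term k (z(i := w)) p) \<longlonglongrightarrow> A k (z(i := w))"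
        by (rule LIMSEQ_imp_Suc)
    qed
    then have "uniform_limit (cball x d) (\<lambda>n w. \<Prod>p<n. A_term k (z(i := w)) p) (\<lambda>w. A k (z(i := w))) sequentially"
      using ul by (subst uniform_limit_cong'[where g = "\<lambda>n w. \<Prod>p<n. A_term k (z(i := w)) p"]) auto
    then show "\<exists>d>0. cball x d \<subseteq> ball 0 (1/10) \<and> uniform_limit (cball x d) (\<lambda>n w. \<Prod>p<n. A_term k (z(i := w)) p) (\<lambda>w. A k (z(i := w))) sequentially"
      using d by blast
  qed simp
  show ?thesis by (rule bounded_holI[OF dep bd hol]) auto
qed

text \<open>At the origin every local factor is a positive real number, and an absolutely convergent
  product without zero factors does not vanish. The division in \<open>H\<close> is therefore
  genuine.\<close>

lemma a_const_nonzero: "a_const k \<noteq> 0"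
proof -
  have z: "(\<lambda>_. 0) \<in> polydisc k (1/10)" by (simp add: polydisc_def)
  have "A_term k (\<lambda>_. 0) p \<noteq> 0" for p
  proof (cases "prime p")
    case p: True
    let ?r = "real p powr (- 1/2)"
    have p1: "real p > 1" using prime_gt_1_nat[OF p] by simp
    have r: "0 < ?r" "?r < 1" using p1 by (auto intro: powr_less_one)
    have u: "prime_root p 0 = of_real ?r"
      using powr_of_real[of "real p" "-1/2"] p1 by (simp add: prime_root_def)
    define x where "x = (\<Prod>(i, j)\<in>lpairs k. 1 - ?r * ?r) *
        (((\<Prod>j<k. 1 - ?r) + (\<Prod>j<k. 1 + ?r)) / 2 + (\<Prod>j<k. 1 - ?r ^ 2) * (1 / real p)) / (1 + (1 / real p))"
    have "A_factor k (\<lambda>_. 0) p = of_real x"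
      unfolding A_factor_eq[OF p z] u x_def by (simp add: case_prod_unfold)
    moreover have "x > 0"
    proof -
      have "?r * ?r < 1" using r mult_strict_mono[of ?r 1 ?r 1] by simp
      moreover have "?r ^ 2 < 1" using r by (simp add: power_less_one_iff)
      ultimately show ?thesis using r p1 unfolding x_def
        by (intro divide_pos_pos mult_pos_pos add_pos_pos prod_pos) (auto simp: case_prod_unfold)
    qed
    ultimately show ?thesis using p by (simp add: A_term_def)
  qed (simp add: A_term_def)
  from prodinf_nonzero[OF A_term_convergent(1)[OF z] this] show ?thesis
    by (simp add: a_const_def A_altdef)
qed

section \<open>The gamma factor and the symmetric function \<open>H\<close>\<close>

lemma X_half_holomorphic: "(\<lambda>w. X (1/2 + w) a) holomorphic_on ball 0 (1/2)"
proof -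
  have re: "\<bar>Re w\<bar> < 1/2" if "w \<in> ball 0 (1/2)" for w :: complex
    using that abs_Re_le_cmod[of w] by simp
  have "(1 - (1/2 + w) + of_nat a) / 2 \<notin> \<int>\<^sub>\<le>\<^sub>0" "((1/2 + w) + of_nat a) / 2 \<notin> \<int>\<^sub>\<le>\<^sub>0" if "w \<in> ball 0 (1/2)" for w :: complex
    using re[OF that] by (auto elim!: nonpos_Ints_cases simp: complex_eq_iff abs_less_iff)
  then show ?thesis unfolding X_def
    by (intro holomorphic_intros) (auto simp: Gamma_eq_zero_iff)
qed

lemma X_half: "X (1/2 + 0) a = 1"
proof -
  have "(1/2 + of_nat a) / 2 \<notin> (\<int>\<^sub>\<le>\<^sub>0 :: complex set)"
  proof
    assume "(1/2 + of_nat a) / 2 \<in> (\<int>\<^sub>\<le>\<^sub>0 :: complex set)"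
    then obtain n where n: "n \<le> 0" "(1/2 + of_nat a) / 2 = (of_int n :: complex)" by (auto elim!: nonpos_Ints_cases)
    have "Re ((1/2 + of_nat a) / 2) = Re (of_int n)" unfolding n(2) ..
    then have "1/2 + real a = 2 * of_int n" by simp
    with n(1) show False by linarith
  qed
  then have "Gamma ((1/2 + of_nat a) / 2 :: complex) \<noteq> 0" by (simp add: Gamma_eq_zero_iff)
  then show ?thesis by (simp add: X_def)
qed

text \<open>Near \<open>w = 0\<close> the base stays within distance \<open>1\<close> of its value
  \<open>1\<close>, hence off the branch cut of the power.\<close>

lemma X_half_powr_holomorphic:
  obtains r where "r > 0" "(\<lambda>w. X (1/2 + w) a powr (- 1/2)) holomorphic_on ball 0 r"
proof -
  let ?f = "\<lambda>w. X (1/2 + w) a"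
  have "isCont ?f 0"
    using holomorphic_on_imp_continuous_on[OF X_half_holomorphic[of a]] by (simp add: continuous_on_eq_continuous_at)
  then have "\<exists>d>0. \<forall>w. dist w 0 < d \<longrightarrow> dist (?f w) (?f 0) < 1"
    unfolding continuous_at_eps_delta by (elim allE[of _ 1]) simp
  then obtain d where d: "d > 0" "\<And>w. dist w 0 < d \<Longrightarrow> dist (?f w) (?f 0) < 1" by blast
  have "?f w \<notin> \<real>\<^sub>\<le>\<^sub>0" if "w \<in> ball 0 (min d (1/2))" for w
  proof -
    have "norm (?f w - 1) < 1" using d(2)[of w] that X_half[of a] by (simp add: dist_norm)
    then have "Re (?f w) > 0" using abs_Re_le_cmod[of "?f w - 1"] by auto
    then show ?thesis by (auto simp: complex_nonpos_Reals_iff)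
  qed
  moreover have "?f holomorphic_on ball 0 (min d (1/2))"
    by (rule holomorphic_on_subset[OF X_half_holomorphic]) auto
  ultimately have "(\<lambda>w. ?f w powr (- 1/2)) holomorphic_on ball 0 (min d (1/2))"
    by (intro holomorphic_intros) auto
  with d(1) show thesis by (intro that[of "min d (1/2)"]) auto
qed

lemma bounded_hol_H: "\<exists>R>0. bounded_hol k R (H k a)"
proof -
  obtain r where r: "r > 0" "(\<lambda>w. X (1/2 + w) a powr (- 1/2)) holomorphic_on ball 0 r"
    by (rule X_half_powr_holomorphic)
  \<comment> \<open>\<open>1/10\<close> serves the Euler product and \<open>r / 2\<close> the gamma
    factor; \<open>2 * R < 1\<close> keeps the sums \<open>z i + z j\<close> in the disc where
    \<open>zeta_reg\<close> is holomorphic.\<close>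
  define R where "R = min (1/10) (r / 2)"
  have R: "0 < R" "R \<le> 1/10" "R < r" "2 * R < 1" using r by (auto simp: R_def min_def)
  have "bounded_hol k R (\<lambda>z. 1 / a_const k * A k z * (\<Prod>j<k. X (1/2 + z j) a powr (- 1/2)) *
             (\<Prod>p\<in>upairs k. zeta_reg (z (fst p) + z (snd p))))"
    by (intro bounded_hol_mult bounded_hol_prod bounded_hol_const bounded_hol_mono[OF bounded_hol_A R(2)]
          bounded_hol_coord[OF r(2) R(3) R(1)] bounded_hol_coord_add[OF zeta_reg_holomorphic R(4) R(1)])
       (auto simp: upairs_def)
  moreover have "H k a = (\<lambda>z. 1 / a_const k * A k z * (\<Prod>j<k. X (1/2 + z j) a powr (- 1/2)) *
             (\<Prod>p\<in>upairs k. zeta_reg (z (fst p) + z (snd p))))"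
    unfolding H_def case_prod_unfold ..
  ultimately show ?thesis using R(1) by (intro exI[of _ R]) simp
qed

text \<open>A permutation may reverse the order inside a pair; \<open>s\<close> sorts the image
  back, and the symmetry of \<open>f\<close> makes this harmless.\<close>

lemma prod_upairs_permute:
  assumes \<pi>: "\<pi> permutes {..<k}" and f: "\<And>i j. f i j = f j i"
  shows "(\<Prod>(i, j)\<in>upairs k. f (\<pi> i) (\<pi> j)) = (\<Prod>(i, j)\<in>upairs k. f i j)"
proof -
  define s where "s p i j = (if p i \<le> p j then (p i, p j) else (p j, p i))" for p :: "nat \<Rightarrow> nat" and i j
  have in_up: "s p i j \<in> upairs k" if "p permutes {..<k}" "(i, j) \<in> upairs k" for p i j
    using that permutes_in_image[OF that(1)] by (fastforce simp: s_def upairs_def)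
  have inv: "(case s p i j of (i, j) \<Rightarrow> s (Hilbert_Choice.inv p) i j) = (i, j)" "(case s (Hilbert_Choice.inv p) i j of (i, j) \<Rightarrow> s p i j) = (i, j)"
    if "p permutes {..<k}" "(i, j) \<in> upairs k" for p i j
    using that permutes_inverses[OF that(1)] by (auto simp: s_def upairs_def)
  show ?thesis
  proof (rule prod.reindex_bij_witness[where i = "\<lambda>(i, j). s (Hilbert_Choice.inv \<pi>) i j" and j = "\<lambda>(i, j). s \<pi> i j"])
    fix x assume x: "x \<in> upairs k"
    obtain i j where ij: "x = (i, j)" by (cases x)
    note x' = x[unfolded ij]
    show "(case case x of (i, j) \<Rightarrow> s \<pi> i j of (i, j) \<Rightarrow> s (Hilbert_Choice.inv \<pi>) i j) = x" using inv(1)[OF \<pi> x'] ij by simp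
    show "(case x of (i, j) \<Rightarrow> s \<pi> i j) \<in> upairs k" using in_up[OF \<pi> x'] ij by simp
    show "(case case x of (i, j) \<Rightarrow> s (Hilbert_Choice.inv \<pi>) i j of (i, j) \<Rightarrow> s \<pi> i j) = x" using inv(2)[OF \<pi> x'] ij by simp
    show "(case x of (i, j) \<Rightarrow> s (Hilbert_Choice.inv \<pi>) i j) \<in> upairs k" using in_up[OF permutes_inv[OF \<pi>] x'] ij by simp
    show "(case case x of (i, j) \<Rightarrow> s \<pi> i j of (i, j) \<Rightarrow> f i j) = (case x of (i, j) \<Rightarrow> f (\<pi> i) (\<pi> j))"
      using f by (simp add: ij s_def)
  qed
qed

lemma prod_permute_lessThan: "\<pi> permutes {..<k} \<Longrightarrow> (\<Prod>j<k. f (\<pi> j)) = (\<Prod>j<k. f j)"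
  by (rule prod.reindex_bij_betw) (rule permutes_imp_bij)

lemma H_permute:
  assumes "\<pi> permutes {..<k}" shows "H k a (\<lambda>i. z (\<pi> i)) = H k a z"
proof -
  have "A_factor k (\<lambda>i. z (\<pi> i)) p = A_factor k z p" for p
    unfolding A_factor_def
    using prod_upairs_permute[OF assms, of "\<lambda>i j. 1 - 1 / of_nat p powr (1 + z i + z j)"]
      prod_permute_lessThan[OF assms, of "\<lambda>j. inverse (1 - of_nat p powr (- 1/2 - z j))"]
      prod_permute_lessThan[OF assms, of "\<lambda>j. inverse (1 + of_nat p powr (- 1/2 - z j))"]
    by (simp add: add_ac)
  then have "A_term k (\<lambda>i. z (\<pi> i)) = A_term k z" by (intro ext) (simp add: A_term_def)
  then have "A k (\<lambda>i. z (\<pi> i)) = A k z" by (simp add: A_altdef)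
  then show ?thesis
    unfolding H_def using prod_upairs_permute[OF assms, of "\<lambda>i j. zeta_reg (z i + z j)"]
      prod_permute_lessThan[OF assms, of "\<lambda>j. X (1/2 + z j) a powr (- 1/2)"]
    by (simp add: add_ac)
qed

lemma H_0: "H k a (\<lambda>_. 0) = 1"
proof -
  have "X (1/2) a = 1" using X_half[of a] by simp
  then show ?thesis using a_const_nonzero[of k]
    by (simp add: H_def a_const_def zeta_reg_def case_prod_unfold)
qed

section \<open>Power series of separately holomorphic functions\<close>

lemma bij_betw_snoc: "bij_betw (\<lambda>(\<beta>, n). \<beta> @ [n]) ({\<beta>. length \<beta> = k} \<times> UNIV) {\<alpha>. length \<alpha> = Suc k}"
proof (rule bij_betw_byWitness[where f' = "\<lambda>\<alpha>. (butlast \<alpha>, last \<alpha>)"])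
  show "\<forall>\<alpha>\<in>{\<alpha>. length \<alpha> = Suc k}. (\<lambda>(\<beta>, n). \<beta> @ [n]) (butlast \<alpha>, last \<alpha>) = \<alpha>"
    by (auto simp: length_Suc_conv_rev)
qed auto

lemma prod_snoc: "length \<beta> = k \<Longrightarrow> (\<Prod>i<Suc k. q i ^ ((\<beta> @ [n]) ! i)) = (\<Prod>i<k. q i ^ (\<beta> ! i)) * q k ^ n"
  by (simp add: nth_append)

lemma has_sum_geometric: "0 \<le> q \<Longrightarrow> q < 1 \<Longrightarrow> ((\<lambda>n. q ^ n) has_sum 1 / (1 - q)) UNIV" for q :: real
  using norm_summable_imp_has_sum[of "\<lambda>n. q ^ n"] geometric_sums[of q] by (simp add: norm_power)

lemma summable_on_geometric_lists:
  fixes q :: "nat \<Rightarrow> real"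
  assumes "\<And>i. i < k \<Longrightarrow> 0 \<le> q i \<and> q i < 1"
  shows "(\<lambda>\<alpha>. \<Prod>i<k. q i ^ (\<alpha> ! i)) summable_on {\<alpha>. length \<alpha> = k}"
  using assms
proof (induction k)
  case (Suc k)
  let ?L = "{\<beta> :: nat list. length \<beta> = k}"
  have "(\<lambda>(\<beta>, n). (\<Prod>i<k. q i ^ (\<beta> ! i)) * q k ^ n) summable_on Sigma ?L (\<lambda>_. UNIV)"
  proof (rule summable_on_SigmaI)
    fix \<beta> :: "nat list" assume "\<beta> \<in> ?L"
    show "((\<lambda>n. case (\<beta>, n) of (\<beta>, n) \<Rightarrow> (\<Prod>i<k. q i ^ (\<beta> ! i)) * q k ^ n) has_sum (\<Prod>i<k. q i ^ (\<beta> ! i)) * (1 / (1 - q k))) UNIV"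
      using Suc.prems[of k] by (simp only: prod.case) (intro has_sum_cmult_right has_sum_geometric, auto)
  next
    show "(\<lambda>\<beta>. (\<Prod>i<k. q i ^ (\<beta> ! i)) * (1 / (1 - q k))) summable_on ?L"
      using Suc by (intro summable_on_cmult_left) auto
  qed (use Suc.prems in \<open>auto intro!: mult_nonneg_nonneg prod_nonneg zero_le_power\<close>)
  then have "(\<lambda>x. (\<Prod>i<Suc k. q i ^ ((case x of (\<beta>, n) \<Rightarrow> \<beta> @ [n]) ! i))) summable_on ?L \<times> UNIV"
    by (rule summable_on_cong[THEN iffD1, rotated]) (auto simp: prod_snoc simp del: prod.lessThan_Suc)
  then show ?case
    by (subst summable_on_reindex_bij_betw[OF bij_betw_snoc, symmetric]) (simp add: case_prod_unfold)
qed simp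

lemma sums_tail_bound:
  fixes f :: "nat \<Rightarrow> complex"
  assumes "f sums s" "\<And>l. norm (f l) \<le> M * q ^ l" "0 \<le> q" "q \<le> 1/2"
  shows "norm (s - (\<Sum>l<n. f l)) \<le> 2 * M * q ^ n"
proof -
  have M: "M \<ge> 0" using order.trans[OF norm_ge_zero assms(2)[of 0]] by simp
  have "(\<lambda>l. f (l + n)) sums (s - (\<Sum>l<n. f l))"
    using sums_split_initial_segment[OF assms(1)] .
  then have "s - (\<Sum>l<n. f l) = suminf (\<lambda>l. f (l + n))" by (rule sums_unique)
  moreover have g: "(\<lambda>l. M * q ^ n * q ^ l) sums (M * q ^ n * (1 / (1 - q)))"
    using assms by (intro sums_mult geometric_sums) auto
  moreover have "norm (suminf (\<lambda>l. f (l + n))) \<le> suminf (\<lambda>l. M * q ^ n * q ^ l)"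
  proof (intro norm_suminf_le sums_summable[OF g])
    fix l show "norm (f (l + n)) \<le> M * q ^ n * q ^ l" using assms(2)[of "l + n"] by (simp add: power_add mult_ac)
  qed
  ultimately have "norm (s - (\<Sum>l<n. f l)) \<le> M * q ^ n * (1 / (1 - q))" by (simp only: sums_unique[OF g, symmetric])
  also have "\<dots> \<le> M * q ^ n * 2"
    using assms M by (intro mult_left_mono) (auto simp: field_simps)
  finally show ?thesis by simp
qed

definition last_coeff :: "nat \<Rightarrow> ((nat \<Rightarrow> complex) \<Rightarrow> complex) \<Rightarrow> nat \<Rightarrow> (nat \<Rightarrow> complex) \<Rightarrow> complex" where
  "last_coeff k F n z = (deriv ^^ n) (\<lambda>w. F (z(k := w))) 0 / fact n"

lemma
  assumes F: "bounded_hol (Suc k) S F" and z: "z \<in> polydisc k S"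
  shows last_coeff_sums: "norm w < S \<Longrightarrow> (\<lambda>n. last_coeff k F n z * w ^ n) sums F (z(k := w))"
    and last_coeff_bound: "0 < R \<Longrightarrow> R < S \<Longrightarrow> (\<And>z. z \<in> polydisc (Suc k) S \<Longrightarrow> norm (F z) \<le> M) \<Longrightarrow>
           norm (last_coeff k F n z) \<le> M / R ^ n"
proof -
  have hol: "(\<lambda>w. F (z(k := w))) holomorphic_on ball 0 S" if "S > 0"
    using bounded_holD(3)[OF F, of "z(k := 0)" k] z that by (auto simp: polydisc_def less_Suc_eq)
  show "(\<lambda>n. last_coeff k F n z * w ^ n) sums F (z(k := w))" if w: "norm w < S" for w
    using holomorphic_power_series[OF hol, of w] w order.strict_trans1[OF norm_ge_zero w]
    by (simp add: last_coeff_def)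
  assume R: "0 < R" "R < S" and M: "\<And>z. z \<in> polydisc (Suc k) S \<Longrightarrow> norm (F z) \<le> M"
  have "norm ((deriv ^^ n) (\<lambda>w. F (z(k := w))) 0) \<le> fact n * M / R ^ n"
  proof (rule Cauchy_inequality)
    have h: "(\<lambda>w. F (z(k := w))) holomorphic_on ball 0 S" using hol R by simp
    show "(\<lambda>w. F (z(k := w))) holomorphic_on ball 0 R" by (rule holomorphic_on_subset[OF h]) (use R in auto)
    show "continuous_on (cball 0 R) (\<lambda>w. F (z(k := w)))"
      by (rule holomorphic_on_imp_continuous_on, rule holomorphic_on_subset[OF h]) (use R in auto)
    show "norm (F (z(k := x))) \<le> M" if "norm (0 - x) = R" for x
      using that R z by (intro M) (auto simp: polydisc_def less_Suc_eq)
  qed (use R in auto)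
  then show "norm (last_coeff k F n z) \<le> M / R ^ n"
    by (simp add: last_coeff_def norm_divide field_simps)
qed

text \<open>Differentiating under a Cauchy integral would call for joint regularity. Instead the
  coefficient of order \<open>n\<close> is obtained as a uniform limit, for \<open>h\<close> tending
  to \<open>0\<close>, of \<open>F\<close> at last coordinate \<open>h\<close> minus its lower
  terms, divided by \<open>h^n\<close>. The lower coefficients are holomorphic by induction, and the
  bound on \<open>F\<close> makes the limit uniform.\<close>

lemma bounded_hol_last_coeff:
  assumes F: "bounded_hol (Suc k) S F" and S: "0 < S"
  shows "bounded_hol k S (last_coeff k F n)"
proof -
  obtain M where M: "\<And>z. z \<in> polydisc (Suc k) S \<Longrightarrow> norm (F z) \<le> M" using bounded_holD(2)[OF F] by blast
  define R where "R = S / 2"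
  have R: "0 < R" "R < S" using S by (auto simp: R_def)
  have M0: "M \<ge> 0"
    using order.trans[OF norm_ge_zero M[of "\<lambda>_. 0"]] S by (simp add: polydisc_def)
  have "\<forall>z\<in>polydisc k S. \<forall>i<k. (\<lambda>v. last_coeff k F n (z(i := v))) holomorphic_on ball 0 S"
  proof (induction n rule: less_induct)
    case (less n)
    show ?case
    proof (intro ballI allI impI)
      fix z i assume z: "z \<in> polydisc k S" and i: "i < k"
      \<comment> \<open>Any null sequence of positive numbers at most \<open>R / 2\<close> works;
        the bound keeps the ratio in the tail estimate at most \<open>1/2\<close>.\<close>
      define h where "h m = R / real (m + 2)" for m
      have h: "0 < h m" "h m \<le> R / 2" for m using R by (auto simp: h_def field_simps)
      have zi: "z(i := v) \<in> polydisc k S" if "v \<in> ball 0 S" for v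
        using z that by (auto simp: polydisc_def)
      let ?f = "\<lambda>m v. (F ((z(i := v))(k := of_real (h m))) - (\<Sum>l<n. last_coeff k F l (z(i := v)) * of_real (h m) ^ l)) / of_real (h m) ^ n"
      \<comment> \<open>The remainder after the term of order \<open>n\<close> is
        \<open>O(h^(n+1))\<close>, so division by \<open>h^n\<close> leaves
        \<open>O(h)\<close>.\<close>
      have bd: "norm (?f m v - last_coeff k F n (z(i := v))) \<le> 2 * M / R ^ Suc n * h m" if v: "v \<in> ball 0 S" for m v
      proof -
        let ?c = "\<lambda>l. last_coeff k F l (z(i := v))"
        have hS: "norm (of_real (h m) :: complex) < S" using h[of m] R by simp
        have "norm (F ((z(i := v))(k := of_real (h m))) - (\<Sum>l<Suc n. ?c l * of_real (h m) ^ l)) \<le> 2 * M * (h m / R) ^ Suc n"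
        proof (rule sums_tail_bound[OF last_coeff_sums[OF F zi[OF v] hS]])
          fix l
          have "norm (?c l) * h m ^ l \<le> M / R ^ l * h m ^ l"
            using h[of m] by (intro mult_right_mono last_coeff_bound[OF F zi[OF v] R M]) auto
          then show "norm (?c l * of_real (h m) ^ l) \<le> M * (h m / R) ^ l"
            using h[of m] by (simp add: norm_mult norm_power power_divide)
        qed (use h[of m] R in \<open>auto simp: field_simps\<close>)
        also have "2 * M * (h m / R) ^ Suc n = 2 * M / R ^ Suc n * h m * h m ^ n"
          by (simp add: power_divide)
        finally have "norm (F ((z(i := v))(k := of_real (h m))) - (\<Sum>l<Suc n. ?c l * of_real (h m) ^ l)) / h m ^ n \<le> 2 * M / R ^ Suc n * h m"
          using h[of m] by (simp add: divide_le_eq)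
        moreover have "?f m v - ?c n = (F ((z(i := v))(k := of_real (h m))) - (\<Sum>l<Suc n. ?c l * of_real (h m) ^ l)) / of_real (h m) ^ n"
          using h[of m] by (simp add: field_simps)
        ultimately show ?thesis using h[of m] by (simp add: norm_divide norm_power)
      qed
      have ul: "uniform_limit (ball 0 S) ?f (\<lambda>v. last_coeff k F n (z(i := v))) sequentially"
      proof (rule uniform_limitI)
        fix e :: real assume "e > 0"
        have "(\<lambda>m. 2 * M / R ^ Suc n * h m) \<longlonglongrightarrow> 2 * M / R ^ Suc n * 0"
          unfolding h_def by (intro tendsto_mult tendsto_const real_tendsto_divide_at_top[OF tendsto_const]
             filterlim_compose[OF filterlim_real_sequentially] filterlim_add_const_nat_at_top)
        then have "\<forall>\<^sub>F m in sequentially. 2 * M / R ^ Suc n * h m < e"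
          using \<open>e > 0\<close> by (intro order_tendstoD) auto
        then show "\<forall>\<^sub>F m in sequentially. \<forall>v\<in>ball 0 S. dist (?f m v) (last_coeff k F n (z(i := v))) < e"
          by eventually_elim (use bd in \<open>auto simp only: dist_norm intro: le_less_trans\<close>)
      qed
      show "(\<lambda>v. last_coeff k F n (z(i := v))) holomorphic_on ball 0 S"
      proof (rule holomorphic_uniform_sequence[where f = ?f])
        fix m
        have "(\<lambda>v. F ((z(k := of_real (h m)))(i := v))) holomorphic_on ball 0 S"
          using z h[of m] R i by (intro bounded_holD(3)[OF F]) (auto simp: polydisc_def less_Suc_eq)
        moreover have "(z(i := v))(k := of_real (h m)) = (z(k := of_real (h m)))(i := v)" for v
          using i by (auto simp: fun_eq_iff)
        ultimately have "(\<lambda>v. F ((z(i := v))(k := of_real (h m)))) holomorphic_on ball 0 S" by simp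
        moreover have "(\<lambda>v. last_coeff k F l (z(i := v))) holomorphic_on ball 0 S" if "l < n" for l
          using less.IH[OF that] z i by blast
        ultimately show "?f m holomorphic_on ball 0 S"
          using h(1)[of m] by (intro holomorphic_intros) (auto simp del: fun_upd_apply)
      next
        fix x :: complex assume "x \<in> ball 0 S"
        then obtain d where d: "d > 0" "cball x d \<subseteq> ball 0 S" by (meson open_ball open_contains_cball)
        then show "\<exists>d>0. cball x d \<subseteq> ball 0 S \<and> uniform_limit (cball x d) ?f (\<lambda>v. last_coeff k F n (z(i := v))) sequentially"
          using uniform_limit_on_subset[OF ul] by blast
      qed simp
    qed
  qed
  then show ?thesis
  proof (intro bounded_holI[where M = "M / R ^ n"])
    fix z z' :: "nat \<Rightarrow> complex" assume "\<And>j. j < k \<Longrightarrow> z j = z' j"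
    then have "F (z(k := w)) = F (z'(k := w))" for w
      by (intro bounded_holD(1)[OF F]) (auto simp: less_Suc_eq)
    then show "last_coeff k F n z = last_coeff k F n z'" by (simp add: last_coeff_def)
  qed (auto intro: last_coeff_bound[OF F _ R M])
qed

text \<open>\<open>F\<close> is expanded in its last variable and the induction hypothesis is
  applied to each coefficient. The Cauchy bounds are carried along because they turn the iterated
  sum into one unconditional sum.\<close>

lemma power_series_expansion:
  assumes "bounded_hol k S F" "\<And>z. z \<in> polydisc k S \<Longrightarrow> norm (F z) \<le> M" "0 < R" "R < S"
  shows "\<exists>c. (\<forall>\<alpha>. length \<alpha> = k \<longrightarrow> norm (c \<alpha>) \<le> M / R ^ sum_list \<alpha>) \<and>
     (\<forall>z\<in>polydisc k R. ((\<lambda>\<alpha>. c \<alpha> * (\<Prod>i<k. z i ^ (\<alpha> ! i))) has_sum F z) {\<alpha>. length \<alpha> = k})"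
  using assms
proof (induction k arbitrary: F M)
  case 0
  have "((\<lambda>\<alpha>. F (\<lambda>_. 0) * (\<Prod>i<0. z i ^ (\<alpha> ! i))) has_sum F z) {\<alpha>. length \<alpha> = 0}" for z :: "nat \<Rightarrow> complex"
  proof -
    have "F z = F (\<lambda>_. 0)" by (rule bounded_holD(1)[OF 0(1)]) auto
    then show ?thesis using has_sum_finite[of "{[]}" "\<lambda>_ :: nat list. F (\<lambda>_. 0)"] by simp
  qed
  moreover have "norm (F (\<lambda>_. 0)) \<le> M" using 0(2) by (simp add: polydisc_def)
  ultimately show ?case by (intro exI[of _ "\<lambda>_. F (\<lambda>_. 0)"]) auto
next
  case (Suc k)
  note F = Suc.prems(1) and M = Suc.prems(2) and R = Suc.prems(3,4)
  have "\<forall>n. \<exists>c. (\<forall>\<alpha>. length \<alpha> = k \<longrightarrow> norm (c \<alpha>) \<le> M / R ^ n / R ^ sum_list \<alpha>) \<and>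
     (\<forall>z\<in>polydisc k R. ((\<lambda>\<alpha>. c \<alpha> * (\<Prod>i<k. z i ^ (\<alpha> ! i))) has_sum last_coeff k F n z) {\<alpha>. length \<alpha> = k})"
    using R by (intro allI Suc.IH bounded_hol_last_coeff[OF F] last_coeff_bound[OF F _ R M]) auto
  from choice[OF this] obtain d where d: "\<And>n \<alpha>. length \<alpha> = k \<Longrightarrow> norm (d n \<alpha>) \<le> M / R ^ n / R ^ sum_list \<alpha>"
     "\<And>n z. z \<in> polydisc k R \<Longrightarrow> ((\<lambda>\<alpha>. d n \<alpha> * (\<Prod>i<k. z i ^ (\<alpha> ! i))) has_sum last_coeff k F n z) {\<alpha>. length \<alpha> = k}"
    by blast
  define c where "c \<alpha> = d (last \<alpha>) (butlast \<alpha>)" for \<alpha>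
  have c: "norm (c \<alpha>) \<le> M / R ^ sum_list \<alpha>" if "length \<alpha> = Suc k" for \<alpha>
  proof -
    obtain \<beta> n where "\<alpha> = \<beta> @ [n]" "length \<beta> = k" using \<open>length \<alpha> = Suc k\<close> by (auto simp: length_Suc_conv_rev)
    then show ?thesis using d(1)[of \<beta> n] by (simp add: c_def power_add mult.commute)
  qed
  have "((\<lambda>\<alpha>. c \<alpha> * (\<Prod>i<Suc k. z i ^ (\<alpha> ! i))) has_sum F z) {\<alpha>. length \<alpha> = Suc k}"
    if z: "z \<in> polydisc (Suc k) R" for z
  proof -
    let ?f = "\<lambda>\<alpha>. c \<alpha> * (\<Prod>i<Suc k. z i ^ (\<alpha> ! i))"
    let ?L = "{\<beta> :: nat list. length \<beta> = k}"
    have zk: "z \<in> polydisc k R" "norm (z k) < R" using z by (auto simp: polydisc_def)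
    then have zS: "z \<in> polydisc k S" using polydisc_mono[of R S k] R by auto
    define q where "q i = norm (z i) / R" for i
    have q: "0 \<le> q i \<and> q i < 1" if "i < Suc k" for i
      using z that R by (auto simp: q_def polydisc_def)
    have bound: "norm (?f \<alpha>) \<le> M * (\<Prod>i<Suc k. q i ^ (\<alpha> ! i))" if \<alpha>: "length \<alpha> = Suc k" for \<alpha>
    proof -
      have "(\<Prod>i<Suc k. q i ^ (\<alpha> ! i)) = (\<Prod>i<Suc k. norm (z i) ^ (\<alpha> ! i)) / (\<Prod>i<Suc k. R ^ (\<alpha> ! i))"
        unfolding q_def power_divide by (rule prod_dividef)
      also have "(\<Prod>i<Suc k. R ^ (\<alpha> ! i)) = R ^ sum_list \<alpha>"
        using \<alpha> by (simp only: power_sum[symmetric] sum_list_sum_nth atLeast0LessThan)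
      finally have e: "(\<Prod>i<Suc k. q i ^ (\<alpha> ! i)) = (\<Prod>i<Suc k. norm (z i) ^ (\<alpha> ! i)) / R ^ sum_list \<alpha>" .
      have "norm (?f \<alpha>) = norm (c \<alpha>) * (\<Prod>i<Suc k. norm (z i) ^ (\<alpha> ! i))"
        unfolding norm_mult prod_norm[symmetric] norm_power ..
      also have "\<dots> \<le> M / R ^ sum_list \<alpha> * (\<Prod>i<Suc k. norm (z i) ^ (\<alpha> ! i))"
        by (intro mult_right_mono c \<alpha> prod_nonneg) auto
      finally show ?thesis unfolding e by simp
    qed
    have "(\<lambda>\<alpha>. M * (\<Prod>i<Suc k. q i ^ (\<alpha> ! i))) summable_on {\<alpha>. length \<alpha> = Suc k}"
      using q by (intro summable_on_cmult_right summable_on_geometric_lists)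
    then have "(\<lambda>\<alpha>. norm (?f \<alpha>)) summable_on {\<alpha>. length \<alpha> = Suc k}"
      by (rule summable_on_comparison_test) (use bound in auto)
    then have sm: "?f summable_on {\<alpha>. length \<alpha> = Suc k}" by (rule abs_summable_summable)
    let ?s = "\<lambda>(n, \<beta>). \<beta> @ [n]"
    have bij: "bij_betw ?s (UNIV \<times> ?L) {\<alpha>. length \<alpha> = Suc k}"
    proof (rule bij_betw_byWitness[where f' = "\<lambda>\<alpha>. (last \<alpha>, butlast \<alpha>)"])
      show "\<forall>\<alpha>\<in>{\<alpha>. length \<alpha> = Suc k}. ?s (last \<alpha>, butlast \<alpha>) = \<alpha>"
        by (auto simp: length_Suc_conv_rev)
    qed auto
    \<comment> \<open>Summing over \<open>\<beta>\<close> first recovers the coefficient functions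
      of the last variable.\<close>
    have "((\<lambda>x. ?f (?s x)) has_sum F z) (Sigma UNIV (\<lambda>_. ?L))"
    proof (rule has_sum_SigmaI)
      show "((\<lambda>\<beta>. ?f (?s (n, \<beta>))) has_sum last_coeff k F n z * z k ^ n) ?L" for n
      proof (rule has_sum_cong[THEN iffD1, OF _ has_sum_cmult_left[OF d(2)[OF zk(1)]]])
        fix \<beta> assume "\<beta> \<in> ?L"
        then show "d n \<beta> * (\<Prod>i<k. z i ^ (\<beta> ! i)) * z k ^ n = ?f (?s (n, \<beta>))"
          by (simp add: prod_snoc c_def mult.assoc del: prod.lessThan_Suc)
      qed
      show "((\<lambda>n. last_coeff k F n z * z k ^ n) has_sum F z) UNIV"
      proof (rule norm_summable_imp_has_sum)
        show "summable (\<lambda>n. norm (last_coeff k F n z * z k ^ n))"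
        proof (rule summable_comparison_test')
          show "summable (\<lambda>n. M * q k ^ n)" using q[of k] by (intro summable_mult summable_geometric) auto
          show "norm (norm (last_coeff k F n z * z k ^ n)) \<le> M * q k ^ n" if "n \<ge> 0" for n
            using mult_right_mono[OF last_coeff_bound[OF F zS R M, of n], of "norm (z k) ^ n"]
            by (simp add: norm_mult norm_power q_def power_divide)
        qed
        show "(\<lambda>n. last_coeff k F n z * z k ^ n) sums F z"
          using last_coeff_sums[OF F zS, of "z k"] zk R by simp
      qed
      show "(\<lambda>x. ?f (?s x)) summable_on (Sigma UNIV (\<lambda>_. ?L))"
        using sm summable_on_reindex_bij_betw[OF bij, of ?f] by simp
    qed
    then show ?thesis using has_sum_reindex_bij_betw[OF bij, of ?f] by simp
  qed
  with c show ?case by (intro exI[of _ c]) auto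
qed

section \<open>Taylor coefficients of symmetric functions\<close>

definition parts :: "nat \<Rightarrow> nat list set" where
  "parts k = {l. is_partition l \<and> length l \<le> k}"

lemma bij_betw_permute_list:
  assumes "\<pi> permutes {..<k}"
  shows "bij_betw (permute_list \<pi>) {\<alpha>. length \<alpha> = k} {\<alpha>. length \<alpha> = k}"
proof (rule bij_betw_byWitness[where f' = "permute_list (Hilbert_Choice.inv \<pi>)"])
  note pinv = permutes_inv[OF assms]
  show "\<forall>\<alpha>\<in>{\<alpha>. length \<alpha> = k}. permute_list (Hilbert_Choice.inv \<pi>) (permute_list \<pi> \<alpha>) = \<alpha>"
    using pinv by (auto simp: permutes_inv_o[OF assms] simp flip: permute_list_compose)
  show "\<forall>\<alpha>\<in>{\<alpha>. length \<alpha> = k}. permute_list \<pi> (permute_list (Hilbert_Choice.inv \<pi>) \<alpha>) = \<alpha>"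
    using assms by (auto simp: permutes_inv_o[OF assms] simp flip: permute_list_compose)
qed auto

lemma has_sum_finite_sum:
  fixes f :: "'i \<Rightarrow> 'a \<Rightarrow> 'b::topological_comm_monoid_add"
  shows "(\<And>i. i \<in> I \<Longrightarrow> (f i has_sum s i) S) \<Longrightarrow> ((\<lambda>x. \<Sum>i\<in>I. f i x) has_sum (\<Sum>i\<in>I. s i)) S"
  by (induction I rule: infinite_finite_induct) (auto intro: has_sum_add has_sum_0)

text \<open>Averaging the coefficients over all permutations leaves the sum unchanged and makes them
  symmetric by construction, so no uniqueness of multivariate power series enters.\<close>

lemma symmetric_power_series:
  assumes sym: "\<And>\<pi> z. \<pi> permutes {..<k} \<Longrightarrow> F (\<lambda>i. z (\<pi> i)) = F z"
    and F: "\<And>z. z \<in> polydisc k R \<Longrightarrow> ((\<lambda>\<alpha>. c \<alpha> * (\<Prod>i<k. z i ^ (\<alpha> ! i))) has_sum F z) {\<alpha>. length \<alpha> = k}"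
  shows "\<exists>c'. (\<forall>\<alpha> \<beta>. length \<beta> = k \<longrightarrow> mset \<alpha> = mset \<beta> \<longrightarrow> c' \<alpha> = c' \<beta>) \<and>
     (\<forall>z\<in>polydisc k R. ((\<lambda>\<alpha>. c' \<alpha> * (\<Prod>i<k. z i ^ (\<alpha> ! i))) has_sum (F z :: complex)) {\<alpha>. length \<alpha> = k})"
proof -
  let ?P = "{\<pi>. \<pi> permutes {..<k}}"
  define c' where "c' \<alpha> = (\<Sum>\<pi>\<in>?P. c (permute_list \<pi> \<alpha>)) / fact k" for \<alpha>
  have "c' \<alpha> = c' \<beta>" if len: "length \<beta> = k" and ms: "mset \<alpha> = mset \<beta>" for \<alpha> \<beta>
  proof -
    obtain \<sigma> where \<sigma>: "\<sigma> permutes {..<length \<beta>}" "permute_list \<sigma> \<beta> = \<alpha>"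
      by (rule mset_eq_permutation[OF ms])
    note \<sigma>' = \<sigma>(1)[unfolded len]
    have bij: "bij_betw (\<lambda>\<pi>. \<sigma> \<circ> \<pi>) ?P ?P"
      by (rule bij_betw_byWitness[where f' = "\<lambda>\<pi>. Hilbert_Choice.inv \<sigma> \<circ> \<pi>"])
         (auto simp: o_assoc permutes_inv_o[OF \<sigma>'] permutes_compose permutes_inv \<sigma>')
    have "(\<Sum>\<pi>\<in>?P. c (permute_list \<pi> \<alpha>)) = (\<Sum>\<pi>\<in>?P. c (permute_list (\<sigma> \<circ> \<pi>) \<beta>))"
      using len by (intro sum.cong) (auto simp: permute_list_compose \<sigma>(2))
    also have "\<dots> = (\<Sum>\<pi>\<in>?P. c (permute_list \<pi> \<beta>))"
      by (rule sum.reindex_bij_betw[OF bij])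
    finally show ?thesis by (simp add: c'_def)
  qed
  moreover have "((\<lambda>\<alpha>. c' \<alpha> * (\<Prod>i<k. z i ^ (\<alpha> ! i))) has_sum F z) {\<alpha>. length \<alpha> = k}" if z: "z \<in> polydisc k R" for z
  proof -
    have h: "((\<lambda>\<alpha>. c (permute_list \<pi> \<alpha>) * (\<Prod>i<k. z i ^ (\<alpha> ! i))) has_sum F z) {\<alpha>. length \<alpha> = k}" if \<pi>: "\<pi> \<in> ?P" for \<pi>
    proof -
      have p: "\<pi> permutes {..<k}" using \<pi> by simp
      have "(\<lambda>i. z (\<pi> i)) \<in> polydisc k R" using z permutes_in_image[OF p] by (auto simp: polydisc_def)
      from F[OF this] have "((\<lambda>\<alpha>. c (permute_list \<pi> \<alpha>) * (\<Prod>i<k. z (\<pi> i) ^ (permute_list \<pi> \<alpha> ! i))) has_sum F z) {\<alpha>. length \<alpha> = k}"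
        unfolding sym[OF p] by (subst (asm) has_sum_reindex_bij_betw[OF bij_betw_permute_list[OF p], symmetric])
      moreover have "(\<Prod>i<k. z (\<pi> i) ^ (permute_list \<pi> \<alpha> ! i)) = (\<Prod>i<k. z i ^ (\<alpha> ! i))" if "length \<alpha> = k" for \<alpha>
      proof -
        have "(\<Prod>i<k. z (\<pi> i) ^ (permute_list \<pi> \<alpha> ! i)) = (\<Prod>i<k. z (\<pi> i) ^ (\<alpha> ! \<pi> i))"
          using that p by (intro prod.cong) (auto simp: permute_list_nth)
        also have "\<dots> = (\<Prod>i<k. z i ^ (\<alpha> ! i))" by (rule prod_permute_lessThan[OF p])
        finally show ?thesis .
      qed
      ultimately show ?thesis by (subst (asm) has_sum_cong) auto
    qed
    have "((\<lambda>\<alpha>. \<Sum>\<pi>\<in>?P. c (permute_list \<pi> \<alpha>) * (\<Prod>i<k. z i ^ (\<alpha> ! i))) has_sum (\<Sum>\<pi>\<in>?P. F z)) {\<alpha>. length \<alpha> = k}"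
      by (rule has_sum_finite_sum) (rule h)
    from has_sum_cmult_left[OF this, where c = "1 / fact k"]
    show ?thesis by (simp add: c'_def sum_distrib_right[symmetric] card_permutations)
  qed
  ultimately show ?thesis by (intro exI[of _ c']) blast
qed

lemma is_partition_iff: "is_partition l \<longleftrightarrow> sorted (rev l) \<and> 0 \<notin> set l"
proof -
  have "(\<forall>i\<in>set l. i > 0) \<longleftrightarrow> 0 \<notin> set l" by (metis gr0I less_irrefl)
  then show ?thesis unfolding is_partition_def sorted_wrt_rev by simp
qed

text \<open>Sorting the nonzero entries of an exponent vector finds the only partition that it
  rearranges. Grouping monomials by partition thus loses and repeats nothing.\<close>

lemma bij_betw_padded_perms:
  "bij_betw snd (Sigma (parts k) (\<lambda>l. padded_perms l k)) {\<alpha>. length \<alpha> = k}"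
proof -
  define f where "f \<alpha> = rev (sort (filter (\<lambda>x. x \<noteq> 0) \<alpha>))" for \<alpha> :: "nat list"
  show ?thesis
  proof (rule bij_betw_byWitness[where f' = "\<lambda>\<alpha>. (f \<alpha>, \<alpha>)"])
    show "\<forall>x\<in>Sigma (parts k) (\<lambda>l. padded_perms l k). (f (snd x), snd x) = x"
    proof
      fix x assume x: "x \<in> Sigma (parts k) (\<lambda>l. padded_perms l k)"
      obtain l \<alpha> where x_eq: "x = (l, \<alpha>)" by (cases x)
      with x have l: "l \<in> parts k" and \<alpha>: "\<alpha> \<in> padded_perms l k" by simp_all
      have part: "sorted (rev l)" "0 \<notin> set l" using l by (auto simp: parts_def is_partition_iff)
      have "y \<noteq> 0" if "y \<in> set l" for y using that part(2) by (cases "y = 0") auto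
      then have fl: "filter (\<lambda>x. x \<noteq> 0) l = l" by (intro filter_True) blast
      have "mset \<alpha> = mset (l @ replicate (k - length l) 0)" using \<alpha> unfolding padded_perms_def by blast
      then have "mset (filter (\<lambda>x. x \<noteq> 0) \<alpha>) = mset (filter (\<lambda>x. x \<noteq> 0) (l @ replicate (k - length l) 0))"
        by (simp only: mset_filter)
      also have "\<dots> = mset (rev l)" unfolding filter_append fl by simp
      finally have "mset (rev l) = mset (filter (\<lambda>x. x \<noteq> 0) \<alpha>)" ..
      from properties_for_sort[OF this part(1)] show "(f (snd x), snd x) = x"
        by (simp only: f_def x_eq snd_conv rev_rev_ident)
    qed
    show "(\<lambda>\<alpha>. (f \<alpha>, \<alpha>)) ` {\<alpha>. length \<alpha> = k} \<subseteq> Sigma (parts k) (\<lambda>l. padded_perms l k)"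
    proof (rule image_subsetI)
      fix \<alpha> :: "nat list" assume "\<alpha> \<in> {\<alpha>. length \<alpha> = k}"
      then have k: "k = length \<alpha>" by simp
      have "is_partition (f \<alpha>)" by (auto simp: is_partition_iff f_def)
      moreover have len: "length (f \<alpha>) = length (filter (\<lambda>x. x \<noteq> 0) \<alpha>)" by (simp add: f_def)
      moreover have "mset \<alpha> = mset (f \<alpha>) + replicate_mset (length \<alpha> - length (f \<alpha>)) 0"
      proof -
        have neg: "(\<lambda>x :: nat. \<not> x \<noteq> 0) = (\<lambda>x. 0 = x)" by auto
        have "length \<alpha> - length (filter (\<lambda>x. x \<noteq> 0) \<alpha>) = length (filter (\<lambda>x. 0 = x) \<alpha>)"
          using sum_length_filter_compl[of "\<lambda>x. x \<noteq> 0" \<alpha>] unfolding neg by linarith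
        then have "replicate_mset (length \<alpha> - length (f \<alpha>)) 0 = mset (filter (\<lambda>x. 0 = x) \<alpha>)"
          unfolding len by (subst replicate_length_filter[symmetric]) (simp only: mset_replicate)
        then show ?thesis using multiset_partition[of "mset \<alpha>" "\<lambda>x. x \<noteq> 0"] unfolding neg by (simp only: f_def mset_rev mset_sort mset_filter)
      qed
      moreover have "length (f \<alpha>) \<le> k" unfolding len k by (rule length_filter_le)
      ultimately show "(f \<alpha>, \<alpha>) \<in> Sigma (parts k) (\<lambda>l. padded_perms l k)"
        unfolding k by (intro SigmaI) (simp_all add: parts_def padded_perms_def)
    qed
  qed (auto simp: padded_perms_def)
qed

text \<open>Gives the choice in \<open>b\<close> its meaning: the averaged series of
  \<open>H\<close> is grouped by partitions.\<close>

lemma ex_taylor_coeffs: "\<exists>c. is_taylor_coeffs k a c"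
proof -
  obtain S where S: "S > 0" "bounded_hol k S (H k a)" using bounded_hol_H by blast
  obtain M where M: "\<forall>z\<in>polydisc k S. norm (H k a z) \<le> M" using bounded_holD(2)[OF S(2)] ..
  define R where "R = S / 2"
  have R: "0 < R" "R < S" using S(1) by (auto simp: R_def)
  obtain d where d: "\<forall>z\<in>polydisc k R. ((\<lambda>\<alpha>. d \<alpha> * (\<Prod>i<k. z i ^ (\<alpha> ! i))) has_sum H k a z) {\<alpha>. length \<alpha> = k}"
    using power_series_expansion[OF S(2) bspec[OF M] R] by blast
  obtain c where c: "\<forall>\<alpha> \<beta>. length \<beta> = k \<longrightarrow> mset \<alpha> = mset \<beta> \<longrightarrow> c \<alpha> = c \<beta>"
     "\<forall>z\<in>polydisc k R. ((\<lambda>\<alpha>. c \<alpha> * (\<Prod>i<k. z i ^ (\<alpha> ! i))) has_sum H k a z) {\<alpha>. length \<alpha> = k}"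
    using symmetric_power_series[of k "H k a" R d, OF H_permute bspec[OF d]] by blast
  define e where "e l = (if l \<in> parts k then c (l @ replicate (k - length l) 0) else 0)" for l
  have "((\<lambda>l. e l * msym l k z) has_sum H k a z) (parts k)" if z: "z \<in> polydisc k R" for z
  proof (rule has_sum_SigmaD)
    show "((\<lambda>x. c (snd x) * (\<Prod>i<k. z i ^ (snd x ! i))) has_sum H k a z) (Sigma (parts k) (\<lambda>l. padded_perms l k))"
      by (rule has_sum_reindex_bij_betw[OF bij_betw_padded_perms, THEN iffD2, OF bspec[OF c(2) z]])
    fix l assume l: "l \<in> parts k"
    have "e l * msym l k z = (\<Sum>\<alpha>\<in>padded_perms l k. c \<alpha> * (\<Prod>i<k. z i ^ (\<alpha> ! i)))"
      unfolding msym_altdef sum_distrib_left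
    proof (intro sum.cong refl arg_cong2[of _ _ _ _ "(*)"])
      fix \<alpha> assume "\<alpha> \<in> padded_perms l k"
      then show "e l = c \<alpha>" using l c(1) by (auto simp: e_def padded_perms_def parts_def)
    qed
    then show "((\<lambda>\<alpha>. c (snd (l, \<alpha>)) * (\<Prod>i<k. z i ^ (snd (l, \<alpha>) ! i))) has_sum (e l * msym l k z)) (padded_perms l k)"
      by (simp add: has_sum_finite)
  qed
  moreover have "e l = 0" if "\<not> (is_partition l \<and> length l \<le> k)" for l
    using that by (auto simp: e_def parts_def)
  ultimately show ?thesis using R(1)
    unfolding is_taylor_coeffs_def parts_def polydisc_def by (intro exI[of _ e] conjI exI[of _ R]) auto
qed

lemma taylor_coeffs_b: "is_taylor_coeffs k a (\<lambda>l. b a l k)"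
  unfolding b_def using someI_ex[OF ex_taylor_coeffs] .

text \<open>At the origin every monomial sum of a nonempty partition vanishes, while
  \<open>H\<close> is normalised to \<open>1\<close>. This identifies the leading coefficient of
  \<open>Q\<close>.\<close>

lemma b_Nil: "b a [] k = 1"
proof -
  obtain \<delta> where \<delta>: "\<delta> > 0" "\<And>z. (\<forall>i<k. norm (z i) < \<delta>) \<Longrightarrow>
        ((\<lambda>l. b a l k * msym l k z) has_sum H k a z) {l. is_partition l \<and> length l \<le> k}"
    using taylor_coeffs_b[of k a] unfolding is_taylor_coeffs_def by blast
  have "((\<lambda>l. b a l k * msym l k (\<lambda>_. 0)) has_sum 1) (parts k)"
    using \<delta>(2)[of "\<lambda>_. 0"] \<delta>(1) by (simp add: H_0 parts_def)
  moreover have "((\<lambda>l. b a l k * msym l k (\<lambda>_. 0)) has_sum b a [] k) (parts k)"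
  proof -
    have nil: "padded_perms [] k = {replicate k 0}" by (rule padded_perms_Nil)
    have "msym l k (\<lambda>_. 0 :: complex) = 0" if l: "l \<in> parts k" "l \<noteq> []" for l
      unfolding msym_altdef
    proof (rule sum.neutral, rule ballI)
      fix \<alpha> assume "\<alpha> \<in> padded_perms l k"
      then have \<alpha>: "length \<alpha> = k" "mset \<alpha> = mset (l @ replicate (k - length l) 0)"
        unfolding padded_perms_def by blast+
      note set_\<alpha> = mset_eq_setD[OF \<alpha>(2)]
      obtain x where "x \<in> set l" "x \<noteq> 0" using l by (cases l) (auto simp: parts_def is_partition_def)
      then have "x \<in> set \<alpha>" using set_\<alpha> by simp
      then obtain i where "i < k" "\<alpha> ! i \<noteq> 0" using \<alpha>(1) \<open>x \<noteq> 0\<close> by (auto simp: in_set_conv_nth)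
      then show "(\<Prod>i<k. 0 ^ (\<alpha> ! i)) = (0 :: complex)" by (intro prod_zero) auto
    qed
    moreover have "msym [] k (\<lambda>_. 0 :: complex) = 1" by (simp add: msym_altdef nil)
    moreover have "[] \<in> parts k" by (simp add: parts_def is_partition_def)
    ultimately show ?thesis
      by (intro has_sum_finite_neutralI[where B = "{[]}"]) auto
  qed
  ultimately show ?thesis by (rule has_sum_unique[symmetric])
qed

section \<open>Integrals over tori\<close>

text \<open>Variables with index at least \<open>k\<close> are evaluated at \<open>1\<close>, so
  \<open>meval\<close> is a ring homomorphism on all polynomials.\<close>

definition meval :: "nat \<Rightarrow> (nat \<Rightarrow> complex) \<Rightarrow> mpoly \<Rightarrow> complex" where
  "meval k z P = (\<Sum>m\<in>keys P. lookup P m * (\<Prod>j<k. z j ^ lookup m j))"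

lemma meval_superset: "finite S \<Longrightarrow> keys P \<subseteq> S \<Longrightarrow> meval k z P = (\<Sum>m\<in>S. lookup P m * (\<Prod>j<k. z j ^ lookup m j))"
  unfolding meval_def by (intro sum.mono_neutral_left) (auto simp: in_keys_iff)

lemma meval_0 [simp]: "meval k z 0 = 0" by (simp add: meval_def)

lemma meval_single: "meval k z (single m c) = c * (\<Prod>j<k. z j ^ lookup m j)"
  by (cases "c = 0") (simp_all add: meval_def)

lemma meval_add: "meval k z (P + R) = meval k z P + meval k z R"
proof -
  have "keys (P + R) \<subseteq> keys P \<union> keys R" by (rule Poly_Mapping.keys_add)
  then show ?thesis
    by (simp add: meval_superset[of "keys P \<union> keys R"] lookup_add distrib_right sum.distrib)
qed

lemma meval_mult: "meval k z (P * R) = meval k z P * meval k z R"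
proof (induction P rule: poly_mapping_single_induct)
  case (single m c)
  show ?case
  proof (induction R rule: poly_mapping_single_induct)
    case (single n d)
    show ?case by (simp add: mult_single meval_single lookup_add power_add prod.distrib)
  qed (simp_all add: distrib_left meval_add)
qed (simp_all add: distrib_right meval_add)

lemma meval_Const [simp]: "meval k z (Const c) = c"
  by (simp add: Const_def meval_single)

lemma meval_1 [simp]: "meval k z 1 = 1" using meval_Const[of k z 1] by (simp add: Const_1)

lemma meval_Var: "i < k \<Longrightarrow> meval k z (Var i) = z i"
proof -
  assume "i < k"
  have "(\<Prod>j<k. z j ^ lookup (single i 1) j) = (\<Prod>j<k. if j = i then z i else 1)"
    by (intro prod.cong) (auto simp: lookup_single when_def)
  then show ?thesis using \<open>i < k\<close> by (simp add: Var_def meval_single)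
qed

lemma meval_sum: "meval k z (sum f S) = (\<Sum>i\<in>S. meval k z (f i))"
  by (induction S rule: infinite_finite_induct) (auto simp: meval_add)

lemma meval_prod: "meval k z (prod f S) = (\<Prod>i\<in>S. meval k z (f i))"
  by (induction S rule: infinite_finite_induct) (auto simp: meval_mult)

lemma meval_power: "meval k z (P ^ n) = meval k z P ^ n"
  by (induction n) (auto simp: meval_mult)

lemma meval_diff: "meval k z (P - R) = meval k z P - meval k z R"
  using meval_add[of k z "P - R" R] by (simp add: algebra_simps)

lemma meval_msym: "meval k z (msym l k Var) = msym l k z"
  unfolding msym_altdef meval_sum meval_prod by (intro sum.cong prod.cong refl) (simp add: meval_power meval_Var)

lemma meval_Delta: "(\<And>i. i < k \<Longrightarrow> meval k z (f i) = g i) \<Longrightarrow> meval k z (Delta k f) = Delta k g"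
  unfolding Delta_def meval_prod case_prod_unfold by (intro prod.cong refl) (auto simp: meval_diff)

text \<open>Such monomials are determined by their first \<open>k\<close> exponents, the only ones
  that a torus integral sees.\<close>

definition vars_below :: "nat \<Rightarrow> mpoly \<Rightarrow> bool" where
  "vars_below k P \<longleftrightarrow> (\<forall>m\<in>keys P. keys m \<subseteq> {..<k})"

lemma vars_below_0 [simp]: "vars_below k 0" by (simp add: vars_below_def)

lemma vars_below_single: "keys m \<subseteq> {..<k} \<Longrightarrow> vars_below k (single m c)"
  by (simp add: vars_below_def)

lemma vars_below_Const [simp]: "vars_below k (Const c)"
  unfolding Const_def by (rule vars_below_single) simp

lemma vars_below_1 [simp]: "vars_below k 1" using vars_below_Const[of k 1] by (simp add: Const_1)

lemma vars_below_Var: "i < k \<Longrightarrow> vars_below k (Var i)"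
  unfolding Var_def by (rule vars_below_single) simp

lemma vars_below_add: "vars_below k P \<Longrightarrow> vars_below k R \<Longrightarrow> vars_below k (P + R)"
  unfolding vars_below_def using Poly_Mapping.keys_add[of P R] by blast

lemma vars_below_diff:
  assumes "vars_below k P" "vars_below k R" shows "vars_below k (P - R)"
  unfolding vars_below_def
proof
  fix m assume "m \<in> keys (P - R)"
  then have "lookup P m \<noteq> lookup R m" by (simp add: in_keys_iff lookup_minus)
  then have "m \<in> keys P \<or> m \<in> keys R" by (auto simp: in_keys_iff)
  then show "keys m \<subseteq> {..<k}" using assms unfolding vars_below_def by blast
qed

lemma vars_below_mult:
  assumes "vars_below k P" "vars_below k R" shows "vars_below k (P * R)"
  unfolding vars_below_def
proof
  fix m assume "m \<in> keys (P * R)"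
  then obtain a b where "m = a + b" "a \<in> keys P" "b \<in> keys R" using keys_mult by blast
  then show "keys m \<subseteq> {..<k}" using assms Poly_Mapping.keys_add[of a b] unfolding vars_below_def by blast
qed

lemma vars_below_sum: "(\<And>i. i \<in> S \<Longrightarrow> vars_below k (f i)) \<Longrightarrow> vars_below k (sum f S)"
  by (induction S rule: infinite_finite_induct) (auto intro: vars_below_add)

lemma vars_below_prod: "(\<And>i. i \<in> S \<Longrightarrow> vars_below k (f i)) \<Longrightarrow> vars_below k (prod f S)"
  by (induction S rule: infinite_finite_induct) (auto intro: vars_below_mult)

lemma vars_below_power: "vars_below k P \<Longrightarrow> vars_below k (P ^ n)"
  by (induction n) (auto intro: vars_below_mult)

lemma has_contour_integral_powi:
  assumes "r > 0"
  shows "((\<lambda>v. v powi n) has_contour_integral (if n = -1 then 2 * of_real pi * \<i> else 0)) (circlepath 0 r)"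
proof (cases "n \<ge> 0")
  case True
  have "((\<lambda>v. v ^ nat n) has_contour_integral 0) (circlepath 0 r)"
    using assms by (intro Cauchy_theorem_disc_simple[of _ 0 "r + 1"]) (use assms in \<open>auto intro!: holomorphic_intros\<close>)
  then show ?thesis using True by (simp add: power_int_def)
next
  case False
  define m where "m = nat (- n) - 1"
  have n: "n = - int (Suc m)" using False by (simp add: m_def)
  have "((\<lambda>u. 1 / (u - 0) ^ Suc m) has_contour_integral (2 * of_real pi * \<i>) / fact m * (deriv ^^ m) (\<lambda>_. 1) 0) (circlepath 0 r)"
    using Cauchy_has_contour_integral_higher_derivative_circlepath[of 0 r "\<lambda>_. 1" 0 m] assms by simp
  moreover have "(2 * of_real pi * \<i>) / fact m * (deriv ^^ m) (\<lambda>_. 1) 0 = (if n = -1 then 2 * of_real pi * \<i> else 0 :: complex)"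
    by (simp add: n)
  moreover have "1 / (u - 0) ^ Suc m = u powi n" for u :: complex
    unfolding n power_int_minus power_int_of_nat by (simp add: divide_inverse)
  ultimately show ?thesis by (simp only:)
qed

text \<open>A Laurent polynomial with free index set and weights. Fixing the outermost variable only
  changes the weights, so the class is closed under the recursion of
  \<open>torus_integral\<close>.\<close>

definition laurent :: "nat \<Rightarrow> ((nat \<Rightarrow>\<^sub>0 nat) set) \<Rightarrow> ((nat \<Rightarrow>\<^sub>0 nat) \<Rightarrow> complex) \<Rightarrow> ((nat \<Rightarrow>\<^sub>0 nat) \<Rightarrow> nat \<Rightarrow> int) \<Rightarrow> (nat \<Rightarrow> complex) \<Rightarrow> complex" where
  "laurent k S w c z = (\<Sum>s\<in>S. w s * (\<Prod>j<k. z j powi c s j))"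

lemma laurent_Suc: "laurent (Suc k) S w c (z(k := v)) = laurent k S (\<lambda>s. w s * v powi c s k) c z"
  unfolding laurent_def by (intro sum.cong refl) (simp add: mult_ac)

lemma has_contour_integral_sum_powi:
  assumes "finite S" "r > 0"
  shows "((\<lambda>v. \<Sum>s\<in>S. d s * v powi c s) has_contour_integral (\<Sum>s\<in>S. d s * (if c s = -1 then 2 * of_real pi * \<i> else 0))) (circlepath 0 r)"
  using assms by (intro has_contour_integral_sum has_contour_integral_lmul has_contour_integral_powi)

lemma torus_integral_laurent:
  assumes "finite S" "\<And>j. j < k \<Longrightarrow> 0 < \<rho> j"
  shows "torus_integral k \<rho> (laurent k S w c) = (\<Sum>s\<in>S. w s * (if \<forall>j<k. c s j = -1 then (2 * of_real pi * \<i>) ^ k else 0))"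
  using assms
proof (induction k arbitrary: w)
  case 0
  then show ?case by (simp add: laurent_def)
next
  case (Suc k)
  let ?I = "\<lambda>s. if \<forall>j<k. c s j = -1 then (2 * of_real pi * \<i>) ^ k else 0 :: complex"
  have "torus_integral k \<rho> (\<lambda>z. laurent (Suc k) S w c (z(k := v))) = (\<Sum>s\<in>S. (w s * ?I s) * v powi c s k)" for v
    unfolding laurent_Suc using Suc.prems by (subst Suc.IH) (auto intro!: sum.cong)
  then have "torus_integral (Suc k) \<rho> (laurent (Suc k) S w c)
      = contour_integral (circlepath 0 (\<rho> k)) (\<lambda>v. \<Sum>s\<in>S. (w s * ?I s) * v powi c s k)"
    by simp
  also have "\<dots> = (\<Sum>s\<in>S. (w s * ?I s) * (if c s k = -1 then 2 * of_real pi * \<i> else 0))"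
    using Suc.prems by (intro contour_integral_unique has_contour_integral_sum_powi) auto
  also have "\<dots> = (\<Sum>s\<in>S. w s * (if \<forall>j<Suc k. c s j = -1 then (2 * of_real pi * \<i>) ^ Suc k else 0))"
    by (intro sum.cong) (auto simp: less_Suc_eq)
  finally show ?case .
qed

lemma laurent_inner_integrable:
  assumes "finite S" "\<And>j. j < Suc k \<Longrightarrow> 0 < \<rho> j"
  shows "(\<lambda>v. torus_integral k \<rho> (\<lambda>z. laurent (Suc k) S w c (z(k := v)))) contour_integrable_on circlepath 0 (\<rho> k)"
proof -
  let ?I = "\<lambda>s. if \<forall>j<k. c s j = -1 then (2 * of_real pi * \<i>) ^ k else 0 :: complex"
  have "torus_integral k \<rho> (\<lambda>z. laurent (Suc k) S w c (z(k := v))) = (\<Sum>s\<in>S. (w s * ?I s) * v powi c s k)" for v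
    unfolding laurent_Suc using assms by (subst torus_integral_laurent) (auto intro!: sum.cong)
  then show ?thesis
    using has_contour_integral_integrable[OF has_contour_integral_sum_powi[OF assms(1), of "\<rho> k" "\<lambda>s. w s * ?I s" "\<lambda>s. c s k"]] assms(2)[of k]
    by simp
qed

text \<open>Supplies the bound on inner integrals that makes term-by-term integration uniform in the
  outer variable.\<close>

lemma norm_torus_integral_le:
  assumes "finite S" "\<And>j. j < k \<Longrightarrow> 0 < \<rho> j" "B \<ge> 0"
    and "\<And>z. (\<And>j. j < k \<Longrightarrow> norm (z j) = \<rho> j) \<Longrightarrow> norm (laurent k S w c z) \<le> B"
  shows "norm (torus_integral k \<rho> (laurent k S w c)) \<le> B * (\<Prod>j<k. 2 * pi * \<rho> j)"
  using assms(2,4)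
proof (induction k arbitrary: w)
  case 0
  then show ?case by simp
next
  case (Suc k)
  let ?\<phi> = "\<lambda>v. torus_integral k \<rho> (\<lambda>z. laurent (Suc k) S w c (z(k := v)))"
  have pos: "(\<Prod>j<k. 2 * pi * \<rho> j) \<ge> 0" using Suc.prems(1) by (intro prod_nonneg) (simp add: less_imp_le)
  have "norm (?\<phi> v) \<le> B * (\<Prod>j<k. 2 * pi * \<rho> j)" if v: "norm v = \<rho> k" for v
    unfolding laurent_Suc
  proof (rule Suc.IH)
    fix z :: "nat \<Rightarrow> complex" assume "\<And>j. j < k \<Longrightarrow> norm (z j) = \<rho> j"
    then show "norm (laurent k S (\<lambda>s. w s * v powi c s k) c z) \<le> B"
      unfolding laurent_Suc[symmetric] using v by (intro Suc.prems(2)) (auto simp: less_Suc_eq)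
  qed (use Suc.prems in auto)
  then have "norm (contour_integral (circlepath 0 (\<rho> k)) ?\<phi>) \<le> (B * (\<Prod>j<k. 2 * pi * \<rho> j)) * (2 * pi * \<rho> k)"
    using Suc.prems(1)[of k] assms(3) pos
    by (intro has_contour_integral_bound_circlepath[OF has_contour_integral_integral[OF laurent_inner_integrable[OF assms(1) Suc.prems(1)]]]) auto
  then show ?case by (simp add: mult_ac)
qed

text \<open>One variable at a time: the inner integrals of the terms are bounded by a constant times
  \<open>M i\<close>, so by the Weierstrass test their sum converges uniformly on the outer circle.
  Limits run over finite subsets of \<open>I\<close>, and \<open>F\<close> enters only through its
  values on the torus.\<close>

lemma has_sum_torus_integral:
  assumes "\<And>i. i \<in> I \<Longrightarrow> finite (S i)" "\<And>j. j < k \<Longrightarrow> 0 < \<rho> j" "M summable_on I"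
    and "\<And>i z. i \<in> I \<Longrightarrow> (\<And>j. j < k \<Longrightarrow> norm (z j) = \<rho> j) \<Longrightarrow> norm (laurent k (S i) (w i) (c i) z) \<le> M i"
    and "\<And>z. (\<And>j. j < k \<Longrightarrow> norm (z j) = \<rho> j) \<Longrightarrow> ((\<lambda>i. laurent k (S i) (w i) (c i) z) has_sum F z) I"
  shows "((\<lambda>i. torus_integral k \<rho> (laurent k (S i) (w i) (c i))) has_sum torus_integral k \<rho> F) I"
  using assms(2,4,5)
proof (induction k arbitrary: w F)
  case 0
  then show ?case by simp
next
  case (Suc k)
  let ?\<gamma> = "circlepath 0 (\<rho> k)"
  let ?\<phi> = "\<lambda>i v. torus_integral k \<rho> (\<lambda>z. laurent (Suc k) (S i) (w i) (c i) (z(k := v)))"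
  let ?\<Phi> = "\<lambda>v. torus_integral k \<rho> (\<lambda>z. F (z(k := v)))"
  let ?K = "\<Prod>j<k. 2 * pi * \<rho> j"
  have M0: "M i \<ge> 0" if "i \<in> I" for i
    using order.trans[OF norm_ge_zero Suc.prems(2)[OF that, of "\<lambda>j. of_real (\<rho> j)"]] Suc.prems(1) by (simp add: less_imp_le)
  have upd: "norm ((z(k := v)) j) = \<rho> j" if "norm v = \<rho> k" "\<And>j. j < k \<Longrightarrow> norm (z j) = \<rho> j" "j < Suc k" for z v j
    using that by (auto simp: less_Suc_eq)
  have sums: "((\<lambda>i. ?\<phi> i v) has_sum ?\<Phi> v) I" if v: "v \<in> sphere 0 (\<rho> k)" for v
    unfolding laurent_Suc
  proof (rule Suc.IH)
    fix i :: 'a and z :: "nat \<Rightarrow> complex" assume "i \<in> I" "\<And>j. j < k \<Longrightarrow> norm (z j) = \<rho> j"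
    then show "norm (laurent k (S i) (\<lambda>s. w i s * v powi c i s k) (c i) z) \<le> M i"
      unfolding laurent_Suc[symmetric] using v upd by (intro Suc.prems(2)) auto
  next
    fix z :: "nat \<Rightarrow> complex" assume "\<And>j. j < k \<Longrightarrow> norm (z j) = \<rho> j"
    then show "((\<lambda>i. laurent k (S i) (\<lambda>s. w i s * v powi c i s k) (c i) z) has_sum F (z(k := v))) I"
      unfolding laurent_Suc[symmetric] using v upd by (intro Suc.prems(3)) auto
  qed (use Suc.prems(1) in auto)
  have bd: "norm (?\<phi> i v) \<le> M i * ?K" if i: "i \<in> I" and v: "v \<in> sphere 0 (\<rho> k)" for i v
    unfolding laurent_Suc
  proof (rule norm_torus_integral_le)
    fix z :: "nat \<Rightarrow> complex" assume "\<And>j. j < k \<Longrightarrow> norm (z j) = \<rho> j"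
    then show "norm (laurent k (S i) (\<lambda>s. w i s * v powi c i s k) (c i) z) \<le> M i"
      unfolding laurent_Suc[symmetric] using v i upd by (intro Suc.prems(2)) auto
  qed (use Suc.prems(1) assms(1) M0 i in auto)
  have int: "?\<phi> i contour_integrable_on ?\<gamma>" if "i \<in> I" for i
    by (rule laurent_inner_integrable[OF assms(1)[OF that] Suc.prems(1)])
  have "uniform_limit (sphere 0 (\<rho> k)) (\<lambda>X v. \<Sum>i\<in>X. ?\<phi> i v) ?\<Phi> (finite_subsets_at_top I)"
    by (rule Weierstrass_m_test_general'[where M = "\<lambda>i. M i * ?K"]) (use bd sums summable_on_cmult_left[OF assms(3)] in auto)
  moreover have "\<forall>\<^sub>F X in finite_subsets_at_top I. (\<lambda>v. \<Sum>i\<in>X. ?\<phi> i v) contour_integrable_on ?\<gamma>"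
    by (rule eventually_finite_subsets_at_top_weakI) (auto intro!: contour_integrable_sum int)
  ultimately have "((\<lambda>X. contour_integral ?\<gamma> (\<lambda>v. \<Sum>i\<in>X. ?\<phi> i v)) \<longlongrightarrow> contour_integral ?\<gamma> ?\<Phi>) (finite_subsets_at_top I)"
    using Suc.prems(1)[of k] by (intro contour_integral_uniform_limit_circlepath(2)) auto
  moreover have "\<forall>\<^sub>F X in finite_subsets_at_top I. contour_integral ?\<gamma> (\<lambda>v. \<Sum>i\<in>X. ?\<phi> i v) = (\<Sum>i\<in>X. contour_integral ?\<gamma> (?\<phi> i))"
    by (rule eventually_finite_subsets_at_top_weakI) (auto intro!: contour_integral_sum int)
  ultimately have "((\<lambda>X. \<Sum>i\<in>X. contour_integral ?\<gamma> (?\<phi> i)) \<longlongrightarrow> contour_integral ?\<gamma> ?\<Phi>) (finite_subsets_at_top I)"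
    by (rule Lim_transform_eventually)
  then show ?case by (simp add: has_sum_def)
qed

lemma meval_divide_eq_laurent:
  assumes "\<And>j. j < k \<Longrightarrow> z j \<noteq> 0"
  shows "C * meval k z P / (\<Prod>j<k. z j ^ e) = laurent k (keys P) (\<lambda>m. C * lookup P m) (\<lambda>m j. int (lookup m j) - int e) z"
proof -
  have p: "(\<Prod>j<k. z j ^ lookup m j) / (\<Prod>j<k. z j ^ e) = (\<Prod>j<k. z j powi (int (lookup m j) - int e))" for m
    unfolding prod_dividef[symmetric] using assms by (intro prod.cong) (auto simp: power_int_diff)
  then show ?thesis
    unfolding meval_def laurent_def sum_distrib_left sum_divide_distrib
    by (intro sum.cong refl) (simp only: p[symmetric] mult.assoc times_divide_eq_right)
qed

text \<open>Over the denominators \<open>z j ^ (2 * k)\<close>, the residue exponent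
  \<open>- 1\<close> corresponds to the exponent \<open>2 * k - 1\<close> in the numerator.\<close>

lemma torus_integral_meval:
  assumes "vars_below k P" "k \<ge> 1" "\<And>j. j < k \<Longrightarrow> 0 < \<rho> j"
  shows "torus_integral k \<rho> (laurent k (keys P) (\<lambda>m. C * lookup P m) (\<lambda>m j. int (lookup m j) - int (2 * k)))
    = (2 * of_real pi * \<i>) ^ k * (C * lookup P (top_exp k))"
proof -
  have iff: "(\<forall>j<k. int (lookup m j) - int (2 * k) = -1) \<longleftrightarrow> m = top_exp k" if "m \<in> keys P" for m
  proof
    assume h: "\<forall>j<k. int (lookup m j) - int (2 * k) = -1"
    show "m = top_exp k"
    proof (rule poly_mapping_eqI)
      fix j
      show "lookup m j = lookup (top_exp k) j"
      proof (cases "j < k")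
        case True
        then show ?thesis using h[rule_format, OF True] by (simp add: lookup_top_exp)
      next
        case False
        then have "j \<notin> keys m" using assms(1) that by (auto simp: vars_below_def)
        then show ?thesis using False by (simp add: top_exp_def lookup_sum_single in_keys_iff)
      qed
    qed
  next
    assume "m = top_exp k"
    then show "\<forall>j<k. int (lookup m j) - int (2 * k) = -1" using assms(2) by (auto simp: lookup_top_exp)
  qed
  have "torus_integral k \<rho> (laurent k (keys P) (\<lambda>m. C * lookup P m) (\<lambda>m j. int (lookup m j) - int (2 * k)))
     = (\<Sum>m\<in>keys P. C * lookup P m * (if m = top_exp k then (2 * of_real pi * \<i>) ^ k else 0))"
  proof (subst torus_integral_laurent[OF finite_keys assms(3)], assumption, intro sum.cong refl)
    fix m assume "m \<in> keys P"
    then show "C * lookup P m * (if \<forall>j<k. int (lookup m j) - int (2 * k) = - 1 then (2 * of_real pi * \<i>) ^ k else 0)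
       = C * lookup P m * (if m = top_exp k then (2 * of_real pi * \<i>) ^ k else 0)"
      by (simp only: iff)
  qed
  also have "\<dots> = (\<Sum>m\<in>keys P. if m = top_exp k then (2 * of_real pi * \<i>) ^ k * (C * lookup P m) else 0)"
    by (intro sum.cong) auto
  also have "\<dots> = (2 * of_real pi * \<i>) ^ k * (C * lookup P (top_exp k))"
    by (auto simp: in_keys_iff)
  finally show ?thesis .
qed

section \<open>The expansion of the residue\<close>

text \<open>The numerator belonging to the partition \<open>l\<close> and the \<open>n\<close>-th
  term of the exponential, with \<open>x ^ n\<close> and the Taylor coefficient taken out.\<close>

definition series_poly :: "nat \<Rightarrow> nat list \<Rightarrow> nat \<Rightarrow> mpoly" where
  "series_poly k l n = msym l k Var * (Delta k Var * Delta k (\<lambda>i. Var i ^ 2)) * (Const (1 / (2 ^ n * fact n)) * (\<Sum>i<k. Var i) ^ n)"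

lemma meval_series_poly:
  "meval k z (series_poly k l n) =
     msym l k z * (Delta k z * Delta k (\<lambda>i. z i ^ 2)) * ((1/2 * (\<Sum>i<k. z i)) ^ n / fact n)"
proof -
  have "meval k z (Delta k Var) = Delta k z" by (intro meval_Delta meval_Var)
  moreover have "meval k z (Delta k (\<lambda>i. Var i ^ 2)) = Delta k (\<lambda>i. z i ^ 2)"
    by (intro meval_Delta) (simp add: meval_power meval_Var)
  moreover have "meval k z (\<Sum>i<k. Var i) = (\<Sum>i<k. z i)"
    unfolding meval_sum by (intro sum.cong) (auto simp: meval_Var)
  ultimately show ?thesis
    unfolding series_poly_def meval_mult meval_power meval_msym meval_Const
    by (simp add: power_mult_distrib power_divide)
qed

lemma vars_below_series_poly: "vars_below k (series_poly k l n)"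
  unfolding series_poly_def msym_altdef Delta_def case_prod_unfold
  by (intro vars_below_mult vars_below_sum vars_below_prod vars_below_power vars_below_diff vars_below_Const vars_below_Var) auto

lemma lookup_series_poly_eq_0:
  "sum_list l + n \<noteq> k * (k + 1) div 2 \<Longrightarrow> lookup (series_poly k l n) (top_exp k) = 0"
  unfolding series_poly_def by (rule lookup_msym_Deltas_power)

lemma N_eq_lookup:
  assumes "sum_list l + n = k * (k + 1) div 2"
  shows "N l k = norm_const k * lookup (series_poly k l n) (top_exp k)"
proof -
  have n: "k * (k + 1) div 2 - sum_list l = n" and ns: "\<not> sum_list l > k * (k + 1) div 2"
    using assms by linarith+
  show ?thesis
    unfolding N_def Let_def n if_not_P[OF ns] norm_const_def series_poly_def top_exp_def by (simp only: mult.assoc)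
qed

lemma Delta_square:
  fixes z :: "nat \<Rightarrow> complex"
  shows "Delta k (\<lambda>j. z j ^ 2) = Delta k z * (\<Prod>(i, j)\<in>lpairs k. z i + z j)"
  unfolding Delta_def prod.distrib[symmetric] case_prod_unfold
  by (intro prod.cong) (auto simp: power2_eq_square algebra_simps)

text \<open>On the torus the poles of \<open>G\<close> are cancelled: \<open>Delta (z\<^sup>2)\<close> supplies the factors \<open>z\<^sub>i + z\<^sub>j\<close>, \<open>i < j\<close>,
  and the diagonal factors \<open>2 z\<^sub>j\<close> only change the power of \<open>z\<^sub>j\<close>.\<close>

lemma G_integrand_eq:
  assumes nz: "\<And>j. j < k \<Longrightarrow> z j \<noteq> 0" and k: "k \<ge> 1"
  shows "G k a z * (Delta k (\<lambda>j. z j ^ 2)) ^ 2 / (\<Prod>j<k. z j ^ (2 * k - 1)) =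
    a_const k / 2 ^ k * H k a z * (Delta k z * Delta k (\<lambda>j. z j ^ 2)) / (\<Prod>j<k. z j ^ (2 * k))"
proof (cases "\<exists>(i, j)\<in>lpairs k. z i + z j = 0")
  \<comment> \<open>Here \<open>zeta\<close> is taken at its pole, where its value is arbitrary;
    both sides contain the vanishing factor \<open>Delta k (\<lambda>j. z j ^ 2)\<close>.\<close>
  case True
  then have "(\<Prod>(i, j)\<in>lpairs k. z i + z j) = 0" by (intro prod_zero) auto
  then have "Delta k (\<lambda>j. z j ^ 2) = 0" by (simp only: Delta_square mult_zero_right)
  then show ?thesis by simp
next
  case False
  let ?Y = "\<Prod>j<k. X (1/2 + z j) a powr (- 1/2)"
  let ?S = "\<Prod>(i, j)\<in>lpairs k. z i + z j"
  let ?Z = "\<Prod>(i, j)\<in>upairs k. zeta (1 + z i + z j)"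
  have nz': "z i + z j \<noteq> 0" if "(i, j) \<in> upairs k" for i j
    using that False nz[of i] by (cases "i = j") (auto simp: upairs_def)
  have "(\<Prod>(i, j)\<in>upairs k. zeta_reg (z i + z j)) = (\<Prod>(i, j)\<in>upairs k. (z i + z j) * zeta (1 + z i + z j))"
    unfolding case_prod_unfold by (intro prod.cong refl) (use nz' in \<open>auto simp: zeta_reg_def add.assoc\<close>)
  also have "\<dots> = (\<Prod>(i, j)\<in>upairs k. z i + z j) * ?Z"
    by (simp add: case_prod_unfold prod.distrib)
  also have "(\<Prod>(i, j)\<in>upairs k. z i + z j) = ?S * (\<Prod>j<k. 2 * z j)"
    unfolding prod_upairs by simp
  also have "(\<Prod>j<k. 2 * z j) = 2 ^ k * (\<Prod>j<k. z j)" by (simp add: prod.distrib)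
  finally have zr: "(\<Prod>(i, j)\<in>upairs k. zeta_reg (z i + z j)) = ?S * (2 ^ k * (\<Prod>j<k. z j)) * ?Z" .
  have "(\<Prod>j<k. z j ^ (2 * k)) = (\<Prod>j<k. z j) * (\<Prod>j<k. z j ^ (2 * k - 1))"
    unfolding prod.distrib[symmetric] using k by (intro prod.cong) (auto simp flip: power_Suc)
  moreover have "(\<Prod>j<k. z j) \<noteq> 0" "(\<Prod>j<k. z j ^ (2 * k - 1)) \<noteq> 0" using nz by auto
  ultimately show ?thesis
    unfolding G_def H_def zr Delta_square using a_const_nonzero[of k]
    by (simp add: field_simps power2_eq_square)
qed

lemma norm_Delta_le:
  fixes f :: "nat \<Rightarrow> complex"
  assumes "\<And>j. j < k \<Longrightarrow> norm (f j) \<le> B"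
  shows "norm (Delta k f) \<le> (2 * B) ^ card (lpairs k)"
proof -
  have "norm (Delta k f) = (\<Prod>(i, j)\<in>lpairs k. norm (f j - f i))"
    unfolding Delta_def prod_norm[symmetric] case_prod_unfold ..
  also have "\<dots> \<le> (\<Prod>(i, j)\<in>lpairs k. 2 * B)"
    unfolding case_prod_unfold
  proof (intro prod_mono conjI norm_ge_zero)
    fix p assume "p \<in> {p. fst p < snd p \<and> snd p < k}"
    then have "norm (f (fst p)) \<le> B" "norm (f (snd p)) \<le> B" using assms by auto
    then show "norm (f (snd p) - f (fst p)) \<le> 2 * B"
      using norm_triangle_ineq4[of "f (snd p)" "f (fst p)"] by linarith
  qed
  finally show ?thesis by simp
qed

text \<open>Monomials with coefficient \<open>1\<close> are largest at the positive point. The bound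
  is itself the norm of a value of \<open>msym\<close>, so that multiplied by \<open>b\<close> it is
  a term of the Taylor expansion at that point.\<close>

lemma norm_msym_le:
  assumes "\<And>j. j < k \<Longrightarrow> norm (z j) \<le> r j"
  shows "norm (msym l k z :: complex) \<le> norm (msym l k (\<lambda>j. of_real (r j) :: complex))"
proof -
  have r: "r j \<ge> 0" if "j < k" for j using order.trans[OF norm_ge_zero assms[OF that]] .
  have "norm (msym l k z) \<le> (\<Sum>\<alpha>\<in>padded_perms l k. \<Prod>i<k. r i ^ (\<alpha> ! i))"
    unfolding msym_altdef
    by (rule sum_norm_le, unfold prod_norm[symmetric] norm_power, intro prod_mono conjI power_mono)
       (use assms in auto)
  also have "\<dots> = norm (of_real (\<Sum>\<alpha>\<in>padded_perms l k. \<Prod>i<k. r i ^ (\<alpha> ! i)) :: complex)"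
    using r by (subst norm_of_real, subst abs_of_nonneg) (auto intro!: sum_nonneg prod_nonneg)
  also have "of_real (\<Sum>\<alpha>\<in>padded_perms l k. \<Prod>i<k. r i ^ (\<alpha> ! i)) = msym l k (\<lambda>j. of_real (r j) :: complex)"
    unfolding msym_altdef by simp
  finally show ?thesis .
qed

lemma has_sum_exp: "((\<lambda>n. w ^ n / fact n) has_sum exp w) (UNIV :: nat set)" for w :: complex
proof (rule norm_summable_imp_has_sum)
  have eq: "(\<lambda>n. w ^ n / fact n) = (\<lambda>n. w ^ n /\<^sub>R fact n)"
    by (simp add: scaleR_conv_of_real divide_inverse mult.commute)
  show "(\<lambda>n. w ^ n / fact n) sums exp w" unfolding eq by (rule exp_converges)
  have "(\<lambda>n. norm (w ^ n / fact n)) = (\<lambda>n. norm (w ^ n /\<^sub>R fact n))" using eq by metis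
  then show "summable (\<lambda>n. norm (w ^ n / fact n))" using summable_norm_exp[of w] by simp
qed

lemma summable_on_product_nonneg:
  fixes f :: "'a \<Rightarrow> real" and g :: "'b \<Rightarrow> real"
  assumes "f summable_on I" "g summable_on J" "\<And>x. f x \<ge> 0" "\<And>y. g y \<ge> 0"
  shows "(\<lambda>(x, y). f x * g y) summable_on I \<times> J"
proof (rule summable_on_SigmaI)
  show "((\<lambda>y. case (x, y) of (x, y) \<Rightarrow> f x * g y) has_sum f x * infsum g J) J" for x
    using has_sum_cmult_right[OF has_sum_infsum[OF assms(2)], of "f x"] by simp
  show "(\<lambda>x. f x * infsum g J) summable_on I" by (rule summable_on_cmult_left[OF assms(1)])
qed (use assms in auto)

lemma has_sum_product_abs:
  fixes f :: "'a \<Rightarrow> complex" and g :: "'b \<Rightarrow> complex"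
  assumes f: "(f has_sum s) I" and g: "(g has_sum t) J"
    and "(\<lambda>x. norm (f x)) summable_on I" "(\<lambda>y. norm (g y)) summable_on J"
  shows "((\<lambda>(x, y). f x * g y) has_sum s * t) (I \<times> J)"
proof (rule has_sum_SigmaI)
  show "((\<lambda>y. case (x, y) of (x, y) \<Rightarrow> f x * g y) has_sum f x * t) J" for x
    using has_sum_cmult_right[OF g, of "f x"] by simp
  show "((\<lambda>x. f x * t) has_sum s * t) I" by (rule has_sum_cmult_left[OF f])
  have "(\<lambda>(x, y). norm (f x) * norm (g y)) summable_on I \<times> J"
    using assms by (intro summable_on_product_nonneg) auto
  then have "(\<lambda>p. norm (case p of (x, y) \<Rightarrow> f x * g y)) summable_on I \<times> J"
    by (simp add: case_prod_unfold norm_mult)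
  then show "(\<lambda>(x, y). f x * g y) summable_on I \<times> J" by (rule abs_summable_summable)
qed

lemma summable_on_exp_real: "w \<ge> 0 \<Longrightarrow> (\<lambda>n. w ^ n / fact n) summable_on (UNIV :: nat set)" for w :: real
  using summable_norm_exp[of w] by (intro norm_summable_imp_summable_on) (simp add: divide_inverse mult.commute)

lemma finite_partitions: "finite {l. is_partition l \<and> sum_list l \<le> K}"
proof (rule finite_subset)
  show "{l. is_partition l \<and> sum_list l \<le> K} \<subseteq> {l. set l \<subseteq> {..K} \<and> length l \<le> K}"
  proof clarify
    fix l assume l: "is_partition l" "sum_list l \<le> K"
    have "length l \<le> sum_list l" using l(1) unfolding is_partition_iff
      by (induction l) (auto simp: sorted_append)
    moreover have "set l \<subseteq> {..K}" using l(2) member_le_sum_list by fastforce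
    ultimately show "set l \<subseteq> {..K} \<and> length l \<le> K" using l(2) by simp
  qed
  show "finite {l. set l \<subseteq> {..K} \<and> length l \<le> K}" by (rule finite_lists_length_le) simp
qed

text \<open>On the torus the double series over partitions and powers of the exponential is
  dominated by its counterpart at the point with coordinates \<open>\<rho> j\<close>, where the
  Taylor expansion of \<open>H\<close> converges absolutely. It may therefore be integrated term by
  term.\<close>

lemma Q_expansion:
  assumes k: "k \<ge> 1" and \<delta>: "\<And>z. (\<forall>i<k. norm (z i) < \<delta>) \<Longrightarrow> ((\<lambda>l. b a l k * msym l k z) has_sum H k a z) (parts k)"
    and \<rho>: "\<And>j. j < k \<Longrightarrow> 0 < \<rho> j \<and> \<rho> j < \<delta>"
  shows "Q k a \<rho> x = (\<Sum>l\<in>{l\<in>parts k. sum_list l \<le> k * (k + 1) div 2}. c0 k * (b a l k * N l k) * x ^ (k * (k + 1) div 2 - sum_list l))"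
proof -
  let ?K = "k * (k + 1) div 2"
  let ?I = "parts k \<times> (UNIV :: nat set)"
  define A0 where "A0 = a_const k / 2 ^ k"
  define C where "C i = A0 * b a (fst i) k * x ^ snd i" for i :: "nat list \<times> nat"
  define P where "P i = series_poly k (fst i) (snd i)" for i :: "nat list \<times> nat"
  define f where "f i = laurent k (keys (P i)) (\<lambda>m. C i * lookup (P i) m) (\<lambda>m j. int (lookup m j) - int (2 * k))" for i
  define D where "D z = Delta k z * Delta k (\<lambda>j. z j ^ 2) / (\<Prod>j<k. z j ^ (2 * k))" for z :: "nat \<Rightarrow> complex"
  define F where "F z = G k a z * (Delta k (\<lambda>j. z j ^ 2)) ^ 2 / (\<Prod>j<k. z j ^ (2 * k - 1)) * exp (x / 2 * (\<Sum>j<k. z j))" for z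
  define u where "u l = norm (b a l k * msym l k (\<lambda>j. of_real (\<rho> j)))" for l
  define W where "W = norm x / 2 * (\<Sum>j<k. \<rho> j)"
  define T where "T = {z :: nat \<Rightarrow> complex. \<forall>j<k. norm (z j) = \<rho> j}"
  have T: "norm (z j) = \<rho> j" if "z \<in> T" "j < k" for z j using that by (simp add: T_def)
  define B where "B = (\<Sum>j<k. \<rho> j)"
  \<comment> \<open>Each difference in a \<open>Delta\<close> is at most twice the largest entry,
    and \<open>B\<close> bounds every radius.\<close>
  define E where "E = (2 * B) ^ card (lpairs k) * (2 * B ^ 2) ^ card (lpairs k) / (\<Prod>j<k. \<rho> j ^ (2 * k))"
  define M where "M i = norm A0 * E * (case i of (l, n) \<Rightarrow> u l * (W ^ n / fact n))" for i :: "nat list \<times> nat"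
  have pos: "\<And>j. j < k \<Longrightarrow> 0 < \<rho> j" using \<rho> by blast
  have B: "\<rho> j \<le> B" if "j < k" for j
    unfolding B_def using that pos by (intro member_le_sum) (auto intro: less_imp_le)
  have B0: "B \<ge> 0" unfolding B_def using pos by (intro sum_nonneg) (auto intro: less_imp_le)
  have W0: "W \<ge> 0" using B0 by (simp add: W_def B_def)
  have f_eq: "f (l, n) z = A0 * D z * ((b a l k * msym l k z) * ((x / 2 * (\<Sum>j<k. z j)) ^ n / fact n))"
    if z: "z \<in> T" for l n z
  proof -
    have "z j \<noteq> 0" if "j < k" for j using T[OF z that] pos[OF that] by auto
    then have "f (l, n) z = C (l, n) * meval k z (P (l, n)) / (\<Prod>j<k. z j ^ (2 * k))"
      unfolding f_def by (rule meval_divide_eq_laurent[symmetric])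
    then show ?thesis
      by (simp add: C_def P_def meval_series_poly D_def power_mult_distrib power_divide mult_ac)
  qed
  have D_le: "norm (D z) \<le> E" if z: "z \<in> T" for z
  proof -
    have pr: "norm (\<Prod>j<k. z j ^ (2 * k)) = (\<Prod>j<k. \<rho> j ^ (2 * k))"
      unfolding prod_norm[symmetric] norm_power using T[OF z] by (intro prod.cong) auto
    have d1: "norm (Delta k z) \<le> (2 * B) ^ card (lpairs k)" by (rule norm_Delta_le) (use T[OF z] B in simp)
    have d2: "norm (Delta k (\<lambda>j. z j ^ 2)) \<le> (2 * B ^ 2) ^ card (lpairs k)"
      by (rule norm_Delta_le) (use T[OF z] B pos in \<open>auto simp: norm_power less_imp_le intro!: power_mono\<close>)
    show ?thesis unfolding D_def E_def norm_divide norm_mult pr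
      by (rule divide_right_mono[OF mult_mono[OF d1 d2]]) (use pos B0 in \<open>auto intro!: prod_nonneg simp: less_imp_le\<close>)
  qed
  have hs\<rho>: "((\<lambda>l. b a l k * msym l k (\<lambda>j. of_real (\<rho> j))) has_sum H k a (\<lambda>j. of_real (\<rho> j))) (parts k)"
    using \<rho> by (intro \<delta>) (auto simp: less_imp_le)
  \<comment> \<open>Unconditional summability of complex numbers is absolute.\<close>
  have su: "u summable_on parts k"
    unfolding u_def using has_sum_imp_summable[OF hs\<rho>] by (simp add: summable_on_iff_abs_summable_on_complex)
  have ul: "norm (b a l k * msym l k z) \<le> u l" if z: "z \<in> T" for l z
    unfolding u_def norm_mult using T[OF z] by (intro mult_left_mono norm_msym_le) auto
  have Wl: "norm ((x / 2 * (\<Sum>j<k. z j)) ^ n / fact n) \<le> W ^ n / fact n" if z: "z \<in> T" for n z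
  proof -
    have "norm (\<Sum>j<k. z j) \<le> (\<Sum>j<k. \<rho> j)" using T[OF z] by (intro sum_norm_le) auto
    then have "norm (x / 2 * (\<Sum>j<k. z j)) \<le> W" unfolding W_def norm_mult norm_divide by (intro mult_mono) auto
    then show ?thesis by (simp add: norm_divide norm_power divide_right_mono power_mono)
  qed
  have "((\<lambda>i. torus_integral k \<rho> (f i)) has_sum torus_integral k \<rho> F) ?I"
    unfolding f_def
  proof (rule has_sum_torus_integral[where M = M], unfold f_def[symmetric])
    show "M summable_on ?I"
      unfolding M_def by (intro summable_on_cmult_right summable_on_product_nonneg su summable_on_exp_real W0)
        (use W0 in \<open>auto simp: u_def\<close>)
  next
    fix i :: "nat list \<times> nat" and z :: "nat \<Rightarrow> complex" assume "\<And>j. j < k \<Longrightarrow> norm (z j) = \<rho> j"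
    then have z: "z \<in> T" by (simp add: T_def)
    obtain l n where i: "i = (l, n)" by (cases i)
    have "norm (f i z) = norm (A0 * D z) * (norm (b a l k * msym l k z) * norm ((x / 2 * (\<Sum>j<k. z j)) ^ n / fact n))"
      unfolding i f_eq[OF z] by (simp only: norm_mult)
    also have "\<dots> \<le> (norm A0 * E) * (u l * (W ^ n / fact n))"
    proof (intro mult_mono mult_nonneg_nonneg norm_ge_zero ul[OF z] Wl[OF z])
      show "norm (A0 * D z) \<le> norm A0 * E" unfolding norm_mult by (intro mult_left_mono D_le[OF z] norm_ge_zero)
      show "0 \<le> E" using order.trans[OF norm_ge_zero D_le[OF z]] .
      show "0 \<le> u l" by (simp add: u_def)
    qed
    finally show "norm (f i z) \<le> M i" by (simp only: M_def i prod.case)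
  next
    fix z :: "nat \<Rightarrow> complex" assume "\<And>j. j < k \<Longrightarrow> norm (z j) = \<rho> j"
    then have z: "z \<in> T" by (simp add: T_def)
    let ?w = "x / 2 * (\<Sum>j<k. z j)"
    have hs: "((\<lambda>l. b a l k * msym l k z) has_sum H k a z) (parts k)" using \<rho> T[OF z] by (intro \<delta>) auto
    have "((\<lambda>(l, n). (b a l k * msym l k z) * (?w ^ n / fact n)) has_sum H k a z * exp ?w) ?I"
    proof (rule has_sum_product_abs[OF hs has_sum_exp])
      show "(\<lambda>l. norm (b a l k * msym l k z)) summable_on parts k"
        by (rule summable_on_comparison_test[OF su ul[OF z]]) auto
      show "(\<lambda>n. norm (?w ^ n / fact n)) summable_on UNIV"
        by (rule summable_on_comparison_test[OF summable_on_exp_real[OF W0] Wl[OF z]]) auto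
    qed
    from has_sum_cmult_right[OF this, of "A0 * D z"]
    have "((\<lambda>i. f i z) has_sum A0 * D z * (H k a z * exp ?w)) ?I"
    proof (rule has_sum_cong[THEN iffD1, rotated])
      fix i :: "nat list \<times> nat"
      show "A0 * D z * (case i of (l, n) \<Rightarrow> b a l k * msym l k z * (?w ^ n / fact n)) = f i z"
        by (cases i) (simp only: f_eq[OF z] prod.case)
    qed
    moreover have "F z = A0 * D z * (H k a z * exp ?w)"
    proof -
      have "z j \<noteq> 0" if "j < k" for j using T[OF z that] pos[OF that] by auto
      from G_integrand_eq[OF this k] show ?thesis
        unfolding F_def by (simp add: A0_def D_def mult_ac)
    qed
    ultimately show "((\<lambda>i. f i z) has_sum F z) ?I" by simp
  qed (use pos in auto)
  moreover have Tf: "torus_integral k \<rho> (f (l, n)) = (2 * of_real pi * \<i>) ^ k * (A0 * b a l k * x ^ n * lookup (series_poly k l n) (top_exp k))" for l n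
    unfolding f_def P_def C_def using torus_integral_meval[OF vars_below_series_poly k pos] by simp
  let ?J = "{l\<in>parts k. sum_list l \<le> ?K}"
  have fin: "finite ?J" by (rule finite_subset[OF _ finite_partitions[of ?K]]) (auto simp: parts_def)
  \<comment> \<open>By homogeneity only pairs with \<open>sum_list l + n = ?K\<close> survive, one
    for each partition.\<close>
  have "((\<lambda>i. torus_integral k \<rho> (f i)) has_sum (\<Sum>i\<in>(\<lambda>l. (l, ?K - sum_list l)) ` ?J. torus_integral k \<rho> (f i))) ?I"
  proof (rule has_sum_finite_neutralI)
    fix i assume i: "i \<in> ?I - (\<lambda>l. (l, ?K - sum_list l)) ` ?J"
    obtain l n where ln: "i = (l, n)" by (cases i)
    have "sum_list l + n \<noteq> ?K"
    proof
      assume h: "sum_list l + n = ?K"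
      then have "n = ?K - sum_list l" "sum_list l \<le> ?K" by linarith+
      then show False using i ln by auto
    qed
    from lookup_series_poly_eq_0[OF this] show "torus_integral k \<rho> (f i) = 0" unfolding ln Tf by simp
  qed (use fin in auto)
  ultimately have TF: "torus_integral k \<rho> F = (\<Sum>i\<in>(\<lambda>l. (l, ?K - sum_list l)) ` ?J. torus_integral k \<rho> (f i))"
    by (rule has_sum_unique)
  also have "\<dots> = (\<Sum>l\<in>?J. torus_integral k \<rho> (f (l, ?K - sum_list l)))"
    by (subst sum.reindex) (auto simp: inj_on_def)
  finally have TF: "torus_integral k \<rho> F = (\<Sum>l\<in>?J. (2 * of_real pi * \<i>) ^ k *
      (A0 * b a l k * x ^ (?K - sum_list l) * lookup (series_poly k l (?K - sum_list l)) (top_exp k)))"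
    unfolding Tf .
  let ?p = "(- 1) ^ (k * (k - 1) div 2) * 2 ^ k / fact k :: complex"
  have "Q k a \<rho> x = ?p * (1 / (2 * of_real pi * \<i>) ^ k) * torus_integral k \<rho> F"
    unfolding Q_def F_def ..
  also have "\<dots> = (\<Sum>l\<in>?J. c0 k * (b a l k * N l k) * x ^ (?K - sum_list l))"
    unfolding TF sum_distrib_left
  proof (rule sum.cong[OF refl])
    fix l assume "l \<in> ?J"
    then have "sum_list l + (?K - sum_list l) = ?K" by simp
    from N_eq_lookup[OF this] have N: "N l k = norm_const k * lookup (series_poly k l (?K - sum_list l)) (top_exp k)" .
    \<comment> \<open>The factorial products of \<open>c0\<close> and \<open>norm_const\<close> are
      inverse to each other.\<close>
    have c: "c0 k * norm_const k = A0 * ?p"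
    proof -
      let ?P1 = "\<Prod>j<k. fact (2 * j) / fact (k + j) :: complex" let ?P2 = "\<Prod>j<k. fact (k + j) / fact (2 * j) :: complex"
      have "?P1 * ?P2 = 1" unfolding prod.distrib[symmetric] by (rule prod.neutral) simp
      moreover have "c0 k * norm_const k = A0 * ?p * (?P1 * ?P2)"
        unfolding c0_def norm_const_def A0_def by (simp only: mult_ac)
      ultimately show ?thesis by (simp only: mult_1_right)
    qed
    have "(2 * of_real pi * \<i>) ^ k \<noteq> (0 :: complex)" by simp
    then show "?p * (1 / (2 * of_real pi * \<i>) ^ k) * ((2 * of_real pi * \<i>) ^ k *
      (A0 * b a l k * x ^ (?K - sum_list l) * lookup (series_poly k l (?K - sum_list l)) (top_exp k)))
      = c0 k * (b a l k * N l k) * x ^ (?K - sum_list l)"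
    proof -
      let ?t = "(2 * of_real pi * \<i>) ^ k :: complex" let ?L = "lookup (series_poly k l (?K - sum_list l)) (top_exp k)"
      have "?p * (1 / ?t) * (?t * (A0 * b a l k * x ^ (?K - sum_list l) * ?L)) = (A0 * ?p) * (b a l k * ?L * x ^ (?K - sum_list l))"
        using \<open>?t \<noteq> 0\<close> by (simp add: mult_ac)
      also have "\<dots> = c0 k * (b a l k * (norm_const k * ?L)) * x ^ (?K - sum_list l)"
        unfolding c[symmetric] by (simp only: mult_ac)
      finally show ?thesis unfolding N .
    qed
  qed
  finally show ?thesis .
qed

theorem theorem1p1:
  shows
   "(\<forall>k\<ge>1. \<forall>a\<in>{0, 1}. \<exists>c :: nat \<Rightarrow> complex.
       (\<exists>\<delta>>0. \<forall>\<rho> :: nat \<Rightarrow> real. (\<forall>j<k. 0 < \<rho> j \<and> \<rho> j < \<delta>) \<longrightarrow>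
          (\<forall>x. Q k a \<rho> x = (\<Sum>r\<le>k * (k + 1) div 2. c r * x ^ (k * (k + 1) div 2 - r)))) \<and>
       (\<forall>r>k * (k + 1) div 2. c r = 0) \<and>
       c 0 = c0 k \<and>
       (\<forall>r\<ge>1. c r = c0 k * (\<Sum>l | is_partition l \<and> sum_list l = r. b a l k * N l k))) \<and>
    (\<forall>l. is_partition l \<longrightarrow>
       (\<exists>P :: complex poly. degree P \<le> 2 * sum_list l \<and> (\<forall>k\<ge>1. poly P (of_nat k) = N l k)))"
proof (intro conjI allI impI ballI)
  fix l assume "is_partition l"
  then show "\<exists>P :: complex poly. degree P \<le> 2 * sum_list l \<and> (\<forall>k\<ge>1. poly P (of_nat k) = N l k)"
    using poly_on_pos_N unfolding poly_on_pos_def by blast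
next
  fix k a :: nat assume k: "k \<ge> 1"
  let ?K = "k * (k + 1) div 2"
  \<comment> \<open>The formula is used for \<open>r = 0\<close> too: only the empty partition
    occurs there, with \<open>b\<close> and \<open>N\<close> both equal to \<open>1\<close>.\<close>
  define c where "c r = c0 k * (\<Sum>l | is_partition l \<and> sum_list l = r. b a l k * N l k)" for r
  obtain \<delta> where \<delta>: "\<delta> > 0" "\<And>z. (\<forall>i<k. norm (z i) < \<delta>) \<Longrightarrow> ((\<lambda>l. b a l k * msym l k z) has_sum H k a z) (parts k)"
    and b0: "\<And>l. \<not> (is_partition l \<and> length l \<le> k) \<Longrightarrow> b a l k = 0"
    using taylor_coeffs_b[of k a] unfolding is_taylor_coeffs_def parts_def by blast
  have "Q k a \<rho> x = (\<Sum>r\<le>?K. c r * x ^ (?K - r))" if \<rho>: "\<forall>j<k. 0 < \<rho> j \<and> \<rho> j < \<delta>" for \<rho> x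
  proof -
    let ?T = "\<lambda>l. c0 k * (b a l k * N l k) * x ^ (?K - sum_list l)"
    let ?S = "{l. is_partition l \<and> sum_list l \<le> ?K}"
    have "Q k a \<rho> x = (\<Sum>l\<in>{l\<in>parts k. sum_list l \<le> ?K}. ?T l)"
      using Q_expansion[OF k \<delta>(2)] \<rho> by blast
    \<comment> \<open>Partitions with more than \<open>k\<close> parts are added freely, since their
      \<open>b\<close> vanishes.\<close>
    also have "\<dots> = (\<Sum>l\<in>?S. ?T l)"
    proof (rule sum.mono_neutral_left[OF finite_partitions])
      show "\<forall>l\<in>?S - {l\<in>parts k. sum_list l \<le> ?K}. ?T l = 0"
      proof
        fix l assume "l \<in> ?S - {l\<in>parts k. sum_list l \<le> ?K}"
        then have "b a l k = 0" by (intro b0) (auto simp: parts_def)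
        then show "?T l = 0" by simp
      qed
    qed (auto simp: parts_def)
    also have "\<dots> = (\<Sum>r\<le>?K. \<Sum>l\<in>{l\<in>?S. sum_list l = r}. ?T l)"
      by (rule sum.group[symmetric]) (use finite_partitions in auto)
    also have "\<dots> = (\<Sum>r\<le>?K. c r * x ^ (?K - r))"
    proof (rule sum.cong[OF refl])
      fix r assume "r \<in> {..?K}"
      then have "{l\<in>?S. sum_list l = r} = {l. is_partition l \<and> sum_list l = r}" by auto
      then show "(\<Sum>l\<in>{l\<in>?S. sum_list l = r}. ?T l) = c r * x ^ (?K - r)"
        by (simp add: c_def sum_distrib_left sum_distrib_right)
    qed
    finally show ?thesis .
  qed
  moreover have "c r = 0" if "r > ?K" for r
    using that unfolding c_def by (simp add: N_def)
  moreover have "c 0 = c0 k"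
  proof -
    have "{l. is_partition l \<and> sum_list l = 0} = {[]}"
      by (auto simp: is_partition_def) (metis gr_implies_not0 list.set_intros(1) neq_Nil_conv)
    then show ?thesis by (simp add: c_def b_Nil N_Nil)
  qed
  ultimately show "\<exists>c :: nat \<Rightarrow> complex.
       (\<exists>\<delta>>0. \<forall>\<rho> :: nat \<Rightarrow> real. (\<forall>j<k. 0 < \<rho> j \<and> \<rho> j < \<delta>) \<longrightarrow>
          (\<forall>x. Q k a \<rho> x = (\<Sum>r\<le>?K. c r * x ^ (?K - r)))) \<and>
       (\<forall>r>?K. c r = 0) \<and> c 0 = c0 k \<and>
       (\<forall>r\<ge>1. c r = c0 k * (\<Sum>l | is_partition l \<and> sum_list l = r. b a l k * N l k))"
    using \<delta>(1) c_def by (intro exI[of _ c] conjI exI[of _ \<delta>]) auto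
qed

end
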